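(* Let $\mathcal M$ be a two-fold strict monoidal category. Then the two-fold reduced bar construction $\overline W\mathcal M$, together with the natural transformations $\omega$, is a lax functor from $(\Delta^{op})^2$ to $Cat$; that is, for all arrows $e_1,e_2,e_3$ of $(\Delta^{op})^2$ such that $e_3\circ e_2\circ e_1$ is defined, the following equality of natural transformations $\overline W\mathcal M(e_3)\circ\overline W\mathcal M(e_2)\circ\overline W\mathcal M(e_1)\to\overline W\mathcal M(e_3\circ e_2\circ e_1)$ holds: $$\omega_{e_3\circ e_2,\,e_1}\circ\big(\omega_{e_3,e_2}\,\overline W\mathcal M(e_1)\big)=\omega_{e_3,\,e_2\circ e_1}\circ\big(\overline W\mathcal M(e_3)\,\omega_{e_2,e_1}\big).$$
   Context: **Two-fold strict monoidal category.** A category $\mathcal M$ with two strict monoidal structures $(\otimes_1,I_1)$, $(\otimes_2,I_2)$, arrows $\kappa:I_1\to I_2$, $\beta:I_1\to I_1\otimes_2I_1$, $\tau:I_2\otimes_1I_2\to I_2$ and a natural transformation $\iota_{A,B,C,D}:(A\otimes_2B)\otimes_1(C\otimes_2D)\to(A\otimes_1C)\otimes_2(B\otimes_1D)$ such that (1) $\iota_{A,D,B\otimes_1C,E\otimes_1F}\circ(\mathbf 1\otimes_1\iota_{B,E,C,F})=\iota_{A\otimes_1B,D\otimes_1E,C,F}\circ(\iota_{A,D,B,E}\otimes_1\mathbf 1)$; (2) $\iota_{A,B,I_1,I_1}\circ(\mathbf 1\otimes_1\beta)=\mathbf 1$; (3) $\iota_{I_1,I_1,A,B}\circ(\beta\otimes_1\mathbf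 1)=\mathbf 1$; (4) $\tau\circ(\mathbf 1\otimes_1\tau)=\tau\circ(\tau\otimes_1\mathbf 1)$; (5) $\tau\circ(\mathbf 1\otimes_1\kappa)=\mathbf 1$; (6) $\tau\circ(\kappa\otimes_1\mathbf 1)=\mathbf 1$; (7) $(\mathbf 1\otimes_2\iota_{B,C,E,F})\circ\iota_{A,B\otimes_2C,D,E\otimes_2F}=(\iota_{A,B,D,E}\otimes_2\mathbf 1)\circ\iota_{A\otimes_2B,C,D\otimes_2E,F}$; (8) $(\mathbf 1\otimes_2\tau)\circ\iota_{A,I_2,B,I_2}=\mathbf 1$; (9) $(\tau\otimes_2\mathbf 1)\circ\iota_{I_2,A,I_2,B}=\mathbf 1$; (10) $(\mathbf 1\otimes_2\beta)\circ\beta=(\beta\otimes_2\mathbf 1)\circ\beta$; (11) $(\mathbf 1\otimes_2\kappa)\circ\beta=\mathbf 1$; (12) $(\kappa\otimes_2\mathbf 1)\circ\beta=\mathbf 1$. **The category $\Delta^{op}$.** $\Delta$ is the simplicial category of nonempty finite ordinals, with objects written $0,1,2,\dots$ (geometric dimension). In $\Delta^{op}$, $d^n_i:n\to n-1$ ($n\ge1$, $0\le i\le n$) and $s^n_i:n-1\to n$ ($n\ge1$, $0\le i\le n-1$) are the opposites of the standard coface and codegeneracy maps. The arrows $\mathbf 1_n,d^n_i,s^n_i$ are called basic. Every arrow $f$ has a unique representation $f^{\rm nf}$ (its normal form) of the form $\mathbf 1$ or $s_{l_1}\circ\dots\circ s_{l_k}\circ d_{j_1}\circ\dots\circ d_{j_m}$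 (superscripts omitted) with $k+m\ge1$, $l_1>\dots>l_k$ and $j_1\ge\dots\ge j_m$. **Reduced bar construction.** For a strict monoidal category $(\mathcal C,\otimes,I)$ it is the functor $\overline W\mathcal C:\Delta^{op}\to Cat$ with $\overline W\mathcal C(n)=\mathcal C^n$; $\overline W\mathcal C(d^n_0)$ and $\overline W\mathcal C(d^n_n)$ delete the first, respectively last, coordinate; for $1\le i\le n-1$, $\overline W\mathcal C(d^n_i)(A_1,\dots,A_n)=(A_1,\dots,A_i\otimes A_{i+1},\dots,A_n)$; and $\overline W\mathcal C(s^n_j)(A_1,\dots,A_{n-1})=(A_1,\dots,A_j,I,A_{j+1},\dots,A_{n-1})$. $\overline W\mathcal M_i^p$ denotes the reduced bar construction of $\mathcal M^p$ with the componentwise structure given by $\otimes_i,I_i$ (its value at $n$ is $\mathcal M^{n\cdot p}=(\mathcal M^p)^n$, i.e. $n$ blocks of length $p$), and $\overline W\mathcal M_i=\overline W\mathcal M_i^1$. For a functor $F$, $(F)^o$ is its $o$-fold product with itself. The two-fold reduced bar construction is $\overline W\mathcal M(n,m)=\mathcal M^{n\cdot m}$ on objects of $(\Delta^{op})^2$ and $\overline W\mathcal M(f,g)=(\overline W\mathcal M_2(g))^{n_t}\circ\overline W\mathcal M_1^{m_s}(f)$ for $f:n_s\to n_t$, $g:m_s\to m_t$. It preserves identities. **Shuffles.** A sequence $\Phi$ of colour $k\in\{1,2\}$ is $(f_r,k)\dots(f_1,k)$ with $f_i$ basic and $f_r\circ\dots\circ f_1$ defined; $\circ\Phi$ denotes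 the word $f_r\circ\dots\circ f_1$. Identity members may be freely inserted or deleted (so a sequence may have no non-identity members, but it always has a definite source and target). Let $\Theta$ be a shuffle of $\Phi$ of colour 1 and $\Gamma$ of colour 2. The inner power of a member $(f,1)$ of $\Theta$ is the target of the closest member of colour 2 to its right (if there is none, the source of $\circ\Gamma$); the outer power of a member $(g,2)$ is the target of the closest member of colour 1 to its right (if there is none, the source of $\circ\Phi$). The functor $\overline W\mathcal M_\Theta$ is the composite, in the order of $\Theta$ (rightmost applied first), of $\overline W\mathcal M_1^i(f)$ for members $(f,1)$ of inner power $i$ and $(\overline W\mathcal M_2(g))^o$ for members $(g,2)$ of outer power $o$. One has $\overline W\mathcal M_{\Gamma\Phi}=\overline W\mathcal M(f,g)$ when $f,g$ are the composites of $\Phi,\Gamma$. **The transformations $\chi$.** For basic $f:n\to n'$, $g:m\to m'$, $\chi(f,g):\overline W\mathcal M_1^{m'}(f)\circ(\overline W\mathcal M_2(g))^n\to(\overline W\mathcal M_2(g))^{n'}\circ\overline W\mathcal M_1^m(f)$ is the identity natural transformation except in the following cases, where it is a tuple all of whose coordinates are identities except the indicated one: $f=s^{n+1}_j$, $g=s^{m+1}_i$: $\kappa$ in coordinate $j(m+1)+i+1$; $f=d^n_j$ ($1\le j\le n-1$), $g=s^{m+1}_i$: $\tau$ in coordinate $(j-1)(m+1)+i+1$; $f=s^{n+1}_j$, $g=d^m_i$ ($1\le i\le m-1$): $\beta$ in coordinate $j(m-1)+i$; $f=d^n_j$ ($1\le j\le n-1$), $g=d^m_i$ ($1\le i\le m-1$):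 the evident component of $\iota$ in coordinate $(j-1)(m-1)+i$. **Normalizing paths, $\varphi_\Theta$ and $\omega$.** A normalizing path starting with $\Theta$ is a list $\Theta_0,\dots,\Theta_j$ ($j\ge0$) of shuffles of $\Phi,\Gamma$ with $\Theta_0=\Theta$, $\Theta_j=\Gamma\Phi$ and, for each $0\le i\le j-1$, $\Theta_i=\Pi(f,1)(g,2)\Lambda$ and $\Theta_{i+1}=\Pi(g,2)(f,1)\Lambda$ for some non-identity members $(f,1),(g,2)$. Put $\varphi_i=\overline W\mathcal M_\Pi\;\chi(f,g)\;\overline W\mathcal M_\Lambda:\overline W\mathcal M_{\Theta_i}\to\overline W\mathcal M_{\Theta_{i+1}}$ (whiskering), where $\overline W\mathcal M_\Pi,\overline W\mathcal M_\Lambda$ are the parts of the composite $\overline W\mathcal M_{\Theta_i}$ coming from $\Pi,\Lambda$. Let $\varphi(\Theta_0,\dots,\Theta_j)=\varphi_{j-1}\circ\dots\circ\varphi_0$ (the identity if $j=0$); this is independent of the normalizing path starting with $\Theta$ and is denoted $\varphi_\Theta:\overline W\mathcal M_\Theta\to\overline W\mathcal M_{\Gamma\Phi}$. For a composable pair $e_1=(f_1,g_1)$, $e_2=(f_2,g_2)$ of arrows of $(\Delta^{op})^2$, let $\Phi_i$ be the sequence of colour 1 with $\circ\Phi_i$ equal to $f_i^{\rm nf}$ and $\Gamma_i$ the sequence of colour 2 with $\circ\Gamma_i$ equal to $g_i^{\rm nf}$, and define $\omega_{e_2,e_1}=\varphi_{\Gamma_2\Phi_2\Gamma_1\Phi_1}:\overline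 W\mathcal M(e_2)\circ\overline W\mathcal M(e_1)\to\overline W\mathcal M(e_2\circ e_1)$. *)

theory Defs
  imports Main
begin

record ('o, 'a) cat =
  Ob :: "'o set"
  Ar :: "'a set"
  dm :: "'a \<Rightarrow> 'o"
  cd :: "'a \<Rightarrow> 'o"
  ident :: "'o \<Rightarrow> 'a"  ("\<one>\<index>")
  cmp :: "'a \<Rightarrow> 'a \<Rightarrow> 'a"  (infixr "\<odot>\<index>" 55)

text \<open>Composition is written in the order of functions: first the right argument, then the left.\<close>

definition hom :: "('o, 'a, 'm) cat_scheme \<Rightarrow> 'o \<Rightarrow> 'o \<Rightarrow> 'a set" where
  "hom C A B = {f \<in> Ar C. dm C f = A \<and> cd C f = B}"

locale category =
  fixes C :: "('o, 'a, 'm) cat_scheme" (structure)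
  assumes dm_in: "f \<in> Ar C \<Longrightarrow> dm C f \<in> Ob C"
    and cd_in: "f \<in> Ar C \<Longrightarrow> cd C f \<in> Ob C"
    and ident_in: "A \<in> Ob C \<Longrightarrow> \<one> A \<in> hom C A A"
    and cmp_in: "\<lbrakk>f \<in> Ar C; g \<in> Ar C; dm C g = cd C f\<rbrakk> \<Longrightarrow> g \<odot> f \<in> hom C (dm C f) (cd C g)"
    and cmp_assoc: "\<lbrakk>f \<in> Ar C; g \<in> Ar C; h \<in> Ar C; dm C g = cd C f; dm C h = cd C g\<rbrakk>
      \<Longrightarrow> (h \<odot> g) \<odot> f = h \<odot> (g \<odot> f)"
    and ident_left: "f \<in> Ar C \<Longrightarrow> \<one> (cd C f) \<odot> f = f"
    and ident_right: "f \<in> Ar C \<Longrightarrow> f \<odot> \<one> (dm C f) = f"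

record ('o, 'a, 'p, 'b) ftor =
  fo :: "'o \<Rightarrow> 'p"
  fa :: "'a \<Rightarrow> 'b"

definition is_functor ::
  "('o, 'a, 'm) cat_scheme \<Rightarrow> ('p, 'b, 'k) cat_scheme \<Rightarrow> ('o, 'a, 'p, 'b) ftor \<Rightarrow> bool" where
  "is_functor C D F \<longleftrightarrow>
     (\<forall>A \<in> Ob C. fo F A \<in> Ob D \<and> fa F (ident C A) = ident D (fo F A)) \<and>
     (\<forall>f \<in> Ar C. fa F f \<in> hom D (fo F (dm C f)) (fo F (cd C f))) \<and>
     (\<forall>f \<in> Ar C. \<forall>g \<in> Ar C. dm C g = cd C f \<longrightarrow> fa F (cmp C g f) = cmp D (fa F g) (fa F f))"

definition id_ftor :: "('o, 'a, 'o, 'a) ftor" where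
  "id_ftor = \<lparr>fo = (\<lambda>A. A), fa = (\<lambda>f. f)\<rparr>"

definition comp_ftor ::
  "('p, 'b, 'q, 'c) ftor \<Rightarrow> ('o, 'a, 'p, 'b) ftor \<Rightarrow> ('o, 'a, 'q, 'c) ftor"  (infixr "\<circ>\<^sub>F" 55) where
  "G \<circ>\<^sub>F F = \<lparr>fo = fo G \<circ> fo F, fa = fa G \<circ> fa F\<rparr>"

definition ftor_eq_on ::
  "('o, 'a, 'm) cat_scheme \<Rightarrow> ('o, 'a, 'p, 'b) ftor \<Rightarrow> ('o, 'a, 'p, 'b) ftor \<Rightarrow> bool" where
  "ftor_eq_on C F G \<longleftrightarrow> (\<forall>A \<in> Ob C. fo F A = fo G A) \<and> (\<forall>f \<in> Ar C. fa F f = fa G f)"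

text \<open>A natural transformation is given by its family of components; only the components at
  objects of the source category are meaningful.\<close>

definition is_nat_trans ::
  "('o, 'a, 'm) cat_scheme \<Rightarrow> ('p, 'b, 'k) cat_scheme \<Rightarrow> ('o, 'a, 'p, 'b) ftor
     \<Rightarrow> ('o, 'a, 'p, 'b) ftor \<Rightarrow> ('o \<Rightarrow> 'b) \<Rightarrow> bool" where
  "is_nat_trans C D F G \<alpha> \<longleftrightarrow>
     (\<forall>A \<in> Ob C. \<alpha> A \<in> hom D (fo F A) (fo G A)) \<and>
     (\<forall>f \<in> Ar C. cmp D (\<alpha> (cd C f)) (fa F f) = cmp D (fa G f) (\<alpha> (dm C f)))"

definition prod_cat ::
  "('o, 'a, 'm) cat_scheme \<Rightarrow> ('p, 'b, 'k) cat_scheme \<Rightarrow> ('o \<times> 'p, 'a \<times> 'b) cat" where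
  "prod_cat C D = \<lparr>Ob = Ob C \<times> Ob D, Ar = Ar C \<times> Ar D,
     dm = map_prod (dm C) (dm D), cd = map_prod (cd C) (cd D),
     ident = map_prod (ident C) (ident D),
     cmp = (\<lambda>(g, g') (f, f'). (cmp C g f, cmp D g' f'))\<rparr>"

definition cat_power :: "('o, 'a, 'm) cat_scheme \<Rightarrow> nat \<Rightarrow> ('o list, 'a list) cat" where
  "cat_power C k = \<lparr>Ob = {X. length X = k \<and> set X \<subseteq> Ob C}, Ar = {F. length F = k \<and> set F \<subseteq> Ar C},
     dm = map (dm C), cd = map (cd C), ident = map (ident C), cmp = map2 (cmp C)\<rparr>"

text \<open>A lax functor from a category \<open>A\<close> to \<open>Cat\<close> that preserves identities strictly: categories
  \<open>WO x\<close>, functors \<open>WA e\<close>, and natural transformations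
  \<open>\<omega> e\<^sub>2 e\<^sub>1 : WA e\<^sub>2 \<circ> WA e\<^sub>1 \<rightarrow> WA (e\<^sub>2 \<circ> e\<^sub>1)\<close> subject to the unit and associativity laws.\<close>

definition lax_functor ::
  "('x, 'y, 'm) cat_scheme \<Rightarrow> ('x \<Rightarrow> ('o, 'a) cat) \<Rightarrow> ('y \<Rightarrow> ('o, 'a, 'o, 'a) ftor)
     \<Rightarrow> ('y \<Rightarrow> 'y \<Rightarrow> 'o \<Rightarrow> 'a) \<Rightarrow> bool" where
  "lax_functor A WO WA \<omega> \<longleftrightarrow>
     category A \<and>
     (\<forall>x \<in> Ob A. category (WO x)) \<and>
     (\<forall>e \<in> Ar A. is_functor (WO (dm A e)) (WO (cd A e)) (WA e)) \<and>
     (\<forall>x \<in> Ob A. ftor_eq_on (WO x) (WA (ident A x)) id_ftor) \<and>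
     (\<forall>e\<^sub>1 \<in> Ar A. \<forall>e\<^sub>2 \<in> Ar A. dm A e\<^sub>2 = cd A e\<^sub>1 \<longrightarrow>
        is_nat_trans (WO (dm A e\<^sub>1)) (WO (cd A e\<^sub>2)) (WA e\<^sub>2 \<circ>\<^sub>F WA e\<^sub>1) (WA (cmp A e\<^sub>2 e\<^sub>1)) (\<omega> e\<^sub>2 e\<^sub>1)) \<and>
     (\<forall>e \<in> Ar A. \<forall>X \<in> Ob (WO (dm A e)).
        \<omega> e (ident A (dm A e)) X = ident (WO (cd A e)) (fo (WA e) X) \<and>
        \<omega> (ident A (cd A e)) e X = ident (WO (cd A e)) (fo (WA e) X)) \<and>
     (\<forall>e\<^sub>1 \<in> Ar A. \<forall>e\<^sub>2 \<in> Ar A. \<forall>e\<^sub>3 \<in> Ar A. dm A e\<^sub>2 = cd A e\<^sub>1 \<longrightarrow> dm A e\<^sub>3 = cd A e\<^sub>2 \<longrightarrow>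
        (\<forall>X \<in> Ob (WO (dm A e\<^sub>1)).
           cmp (WO (cd A e\<^sub>3)) (\<omega> (cmp A e\<^sub>3 e\<^sub>2) e\<^sub>1 X) (\<omega> e\<^sub>3 e\<^sub>2 (fo (WA e\<^sub>1) X))
           = cmp (WO (cd A e\<^sub>3)) (\<omega> e\<^sub>3 (cmp A e\<^sub>2 e\<^sub>1) X) (fa (WA e\<^sub>3) (\<omega> e\<^sub>2 e\<^sub>1 X))))"

record ('o, 'a) smon =
  ob_ten :: "'o \<Rightarrow> 'o \<Rightarrow> 'o"
  ar_ten :: "'a \<Rightarrow> 'a \<Rightarrow> 'a"
  unt :: "'o"

locale strict_monoidal = category C
  for C :: "('o, 'a, 'm) cat_scheme" (structure) and T :: "('o, 'a) smon" +
  assumes unt_in: "unt T \<in> Ob C"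
    and ten_functor: "is_functor (prod_cat C C) C
      \<lparr>fo = (\<lambda>(A, B). ob_ten T A B), fa = (\<lambda>(f, g). ar_ten T f g)\<rparr>"
    and ob_assoc: "\<lbrakk>A \<in> Ob C; B \<in> Ob C; D \<in> Ob C\<rbrakk>
      \<Longrightarrow> ob_ten T (ob_ten T A B) D = ob_ten T A (ob_ten T B D)"
    and ob_unt_left: "A \<in> Ob C \<Longrightarrow> ob_ten T (unt T) A = A"
    and ob_unt_right: "A \<in> Ob C \<Longrightarrow> ob_ten T A (unt T) = A"
    and ar_assoc: "\<lbrakk>f \<in> Ar C; g \<in> Ar C; h \<in> Ar C\<rbrakk>
      \<Longrightarrow> ar_ten T (ar_ten T f g) h = ar_ten T f (ar_ten T g h)"
    and ar_unt_left: "f \<in> Ar C \<Longrightarrow> ar_ten T (\<one> (unt T)) f = f"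
    and ar_unt_right: "f \<in> Ar C \<Longrightarrow> ar_ten T f (\<one> (unt T)) = f"

text \<open>On objects the two tensors are written with a box, on arrows with a circle.\<close>

record ('o, 'a) two_fold = "('o, 'a) cat" +
  ob_ten1 :: "'o \<Rightarrow> 'o \<Rightarrow> 'o"  (infixr "\<boxtimes>\<^sub>1\<index>" 70)
  ar_ten1 :: "'a \<Rightarrow> 'a \<Rightarrow> 'a"  (infixr "\<otimes>\<^sub>1\<index>" 70)
  unt1 :: "'o"  ("I\<^sub>1\<index>")
  ob_ten2 :: "'o \<Rightarrow> 'o \<Rightarrow> 'o"  (infixr "\<boxtimes>\<^sub>2\<index>" 70)
  ar_ten2 :: "'a \<Rightarrow> 'a \<Rightarrow> 'a"  (infixr "\<otimes>\<^sub>2\<index>" 70)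
  unt2 :: "'o"  ("I\<^sub>2\<index>")
  kappa :: "'a"  ("\<kappa>\<index>")
  beta :: "'a"  ("\<beta>\<index>")
  tau :: "'a"  ("\<tau>\<index>")
  iota :: "'o \<Rightarrow> 'o \<Rightarrow> 'o \<Rightarrow> 'o \<Rightarrow> 'a"  ("\<iota>\<index>")

definition mon1 :: "('o, 'a, 'm) two_fold_scheme \<Rightarrow> ('o, 'a) smon" where
  "mon1 M = \<lparr>ob_ten = ob_ten1 M, ar_ten = ar_ten1 M, unt = unt1 M\<rparr>"

definition mon2 :: "('o, 'a, 'm) two_fold_scheme \<Rightarrow> ('o, 'a) smon" where
  "mon2 M = \<lparr>ob_ten = ob_ten2 M, ar_ten = ar_ten2 M, unt = unt2 M\<rparr>"

locale two_fold_strict_monoidal = category M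
  for M :: "('o, 'a, 'm) two_fold_scheme" (structure) +
  assumes mon1: "strict_monoidal M (mon1 M)"
    and mon2: "strict_monoidal M (mon2 M)"
    and kappa_in: "\<kappa> \<in> hom M I\<^sub>1 I\<^sub>2"
    and beta_in: "\<beta> \<in> hom M I\<^sub>1 (I\<^sub>1 \<boxtimes>\<^sub>2 I\<^sub>1)"
    and tau_in: "\<tau> \<in> hom M (I\<^sub>2 \<boxtimes>\<^sub>1 I\<^sub>2) I\<^sub>2"
    and iota_in: "\<lbrakk>A \<in> Ob M; B \<in> Ob M; C \<in> Ob M; D \<in> Ob M\<rbrakk>
      \<Longrightarrow> \<iota> A B C D \<in> hom M ((A \<boxtimes>\<^sub>2 B) \<boxtimes>\<^sub>1 (C \<boxtimes>\<^sub>2 D)) ((A \<boxtimes>\<^sub>1 C) \<boxtimes>\<^sub>2 (B \<boxtimes>\<^sub>1 D))"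
    and iota_natural: "\<lbrakk>a \<in> hom M A A'; b \<in> hom M B B'; c \<in> hom M C C'; d \<in> hom M D D'\<rbrakk>
      \<Longrightarrow> \<iota> A' B' C' D' \<odot> ((a \<otimes>\<^sub>2 b) \<otimes>\<^sub>1 (c \<otimes>\<^sub>2 d)) = ((a \<otimes>\<^sub>1 c) \<otimes>\<^sub>2 (b \<otimes>\<^sub>1 d)) \<odot> \<iota> A B C D"
    and ax1: "\<lbrakk>A \<in> Ob M; B \<in> Ob M; C \<in> Ob M; D \<in> Ob M; E \<in> Ob M; F \<in> Ob M\<rbrakk>
      \<Longrightarrow> \<iota> A D (B \<boxtimes>\<^sub>1 C) (E \<boxtimes>\<^sub>1 F) \<odot> (\<one> (A \<boxtimes>\<^sub>2 D) \<otimes>\<^sub>1 \<iota> B E C F)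
        = \<iota> (A \<boxtimes>\<^sub>1 B) (D \<boxtimes>\<^sub>1 E) C F \<odot> (\<iota> A D B E \<otimes>\<^sub>1 \<one> (C \<boxtimes>\<^sub>2 F))"
    and ax2: "\<lbrakk>A \<in> Ob M; B \<in> Ob M\<rbrakk> \<Longrightarrow> \<iota> A B I\<^sub>1 I\<^sub>1 \<odot> (\<one> (A \<boxtimes>\<^sub>2 B) \<otimes>\<^sub>1 \<beta>) = \<one> (A \<boxtimes>\<^sub>2 B)"
    and ax3: "\<lbrakk>A \<in> Ob M; B \<in> Ob M\<rbrakk> \<Longrightarrow> \<iota> I\<^sub>1 I\<^sub>1 A B \<odot> (\<beta> \<otimes>\<^sub>1 \<one> (A \<boxtimes>\<^sub>2 B)) = \<one> (A \<boxtimes>\<^sub>2 B)"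
    and ax4: "\<tau> \<odot> (\<one> I\<^sub>2 \<otimes>\<^sub>1 \<tau>) = \<tau> \<odot> (\<tau> \<otimes>\<^sub>1 \<one> I\<^sub>2)"
    and ax5: "\<tau> \<odot> (\<one> I\<^sub>2 \<otimes>\<^sub>1 \<kappa>) = \<one> I\<^sub>2"
    and ax6: "\<tau> \<odot> (\<kappa> \<otimes>\<^sub>1 \<one> I\<^sub>2) = \<one> I\<^sub>2"
    and ax7: "\<lbrakk>A \<in> Ob M; B \<in> Ob M; C \<in> Ob M; D \<in> Ob M; E \<in> Ob M; F \<in> Ob M\<rbrakk>
      \<Longrightarrow> (\<one> (A \<boxtimes>\<^sub>1 D) \<otimes>\<^sub>2 \<iota> B C E F) \<odot> \<iota> A (B \<boxtimes>\<^sub>2 C) D (E \<boxtimes>\<^sub>2 F)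
        = (\<iota> A B D E \<otimes>\<^sub>2 \<one> (C \<boxtimes>\<^sub>1 F)) \<odot> \<iota> (A \<boxtimes>\<^sub>2 B) C (D \<boxtimes>\<^sub>2 E) F"
    and ax8: "\<lbrakk>A \<in> Ob M; B \<in> Ob M\<rbrakk> \<Longrightarrow> (\<one> (A \<boxtimes>\<^sub>1 B) \<otimes>\<^sub>2 \<tau>) \<odot> \<iota> A I\<^sub>2 B I\<^sub>2 = \<one> (A \<boxtimes>\<^sub>1 B)"
    and ax9: "\<lbrakk>A \<in> Ob M; B \<in> Ob M\<rbrakk> \<Longrightarrow> (\<tau> \<otimes>\<^sub>2 \<one> (A \<boxtimes>\<^sub>1 B)) \<odot> \<iota> I\<^sub>2 A I\<^sub>2 B = \<one> (A \<boxtimes>\<^sub>1 B)"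
    and ax10: "(\<one> I\<^sub>1 \<otimes>\<^sub>2 \<beta>) \<odot> \<beta> = (\<beta> \<otimes>\<^sub>2 \<one> I\<^sub>1) \<odot> \<beta>"
    and ax11: "(\<one> I\<^sub>1 \<otimes>\<^sub>2 \<kappa>) \<odot> \<beta> = \<one> I\<^sub>1"
    and ax12: "(\<kappa> \<otimes>\<^sub>2 \<one> I\<^sub>1) \<odot> \<beta> = \<one> I\<^sub>1"

text \<open>\<open>DOp n xs\<close>, with \<open>length xs = k + 1\<close>, is the arrow \<open>n \<rightarrow> k\<close> of \<open>\<Delta>\<^sup>o\<^sup>p\<close> opposite to the monotone
  map \<open>i \<mapsto> xs ! i\<close> from \<open>{0..k}\<close> to \<open>{0..n}\<close>.\<close>

datatype darr = DOp (dsrc: nat) (dvals: "nat list")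

definition dtgt :: "darr \<Rightarrow> nat" where
  "dtgt f = length (dvals f) - 1"

definition delta_op :: "(nat, darr) cat" where
  "delta_op = \<lparr>Ob = UNIV,
     Ar = {f. dvals f \<noteq> [] \<and> sorted (dvals f) \<and> set (dvals f) \<subseteq> {0..dsrc f}},
     dm = dsrc, cd = dtgt, ident = (\<lambda>n. DOp n [0..<Suc n]),
     cmp = (\<lambda>g f. DOp (dsrc f) (map (\<lambda>i. dvals f ! i) (dvals g)))\<rparr>"

text \<open>The non-identity basic arrows: \<open>D n i\<close> is \<open>d\<^sup>n\<^sub>i : n \<rightarrow> n - 1\<close> and \<open>S n i\<close> is \<open>s\<^sup>n\<^sub>i : n - 1 \<rightarrow> n\<close>.\<close>

datatype basic = is_D: D (dim: nat) (idx: nat) | is_S: S (dim: nat) (idx: nat)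

fun basic_ok :: "basic \<Rightarrow> bool" where
  "basic_ok (D n i) \<longleftrightarrow> 1 \<le> n \<and> i \<le> n"
| "basic_ok (S n i) \<longleftrightarrow> 1 \<le> n \<and> i \<le> n - 1"

fun bsrc :: "basic \<Rightarrow> nat" where
  "bsrc (D n i) = n"
| "bsrc (S n i) = n - 1"

fun btgt :: "basic \<Rightarrow> nat" where
  "btgt (D n i) = n - 1"
| "btgt (S n i) = n"

fun basic_arr :: "basic \<Rightarrow> darr" where
  "basic_arr (D n i) = DOp n (map (\<lambda>x. if x < i then x else x + 1) [0..<n])"
| "basic_arr (S n i) = DOp (n - 1) (map (\<lambda>x. if x \<le> i then x else x - 1) [0..<Suc n])"

text \<open>A word \<open>[f\<^sub>r, \<dots>, f\<^sub>1]\<close> stands for \<open>f\<^sub>r \<circ> \<dots> \<circ> f\<^sub>1\<close>. Since identity members may be deleted, words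
  contain only non-identity basic arrows, and their source \<open>n\<close> is carried along separately.\<close>

fun word_tgt :: "nat \<Rightarrow> basic list \<Rightarrow> nat" where
  "word_tgt n [] = n"
| "word_tgt n (b # w) = btgt b"

fun word_ok :: "nat \<Rightarrow> basic list \<Rightarrow> bool" where
  "word_ok n [] \<longleftrightarrow> True"
| "word_ok n (b # w) \<longleftrightarrow> word_ok n w \<and> basic_ok b \<and> bsrc b = word_tgt n w"

fun word_arr :: "nat \<Rightarrow> basic list \<Rightarrow> darr" where
  "word_arr n [] = ident delta_op n"
| "word_arr n (b # w) = cmp delta_op (basic_arr b) (word_arr n w)"

definition is_nf :: "basic list \<Rightarrow> bool" where
  "is_nf w \<longleftrightarrow> (\<exists>ss ds. w = ss @ ds \<and> (\<forall>b \<in> set ss. is_S b) \<and> (\<forall>b \<in> set ds. is_D b) \<and>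
     sorted_wrt (>) (map idx ss) \<and> sorted_wrt (\<ge>) (map idx ds))"

definition nf :: "darr \<Rightarrow> basic list" where
  "nf f = (THE w. word_ok (dsrc f) w \<and> word_arr (dsrc f) w = f \<and> is_nf w)"

text \<open>The common shape of the action of a basic arrow on tuples of objects and on tuples of arrows.\<close>

fun bar_op :: "('x \<Rightarrow> 'x \<Rightarrow> 'x) \<Rightarrow> 'x \<Rightarrow> basic \<Rightarrow> 'x list \<Rightarrow> 'x list" where
  "bar_op t u (D n i) X =
     (if i = 0 then drop 1 X
      else if i = n then take (n - 1) X
      else take (i - 1) X @ [t (X ! (i - 1)) (X ! i)] @ drop (i + 1) X)"
| "bar_op t u (S n j) X = take j X @ [u] @ drop j X"

definition bar_basic ::
  "('o, 'a, 'm) cat_scheme \<Rightarrow> ('o, 'a) smon \<Rightarrow> basic \<Rightarrow> ('o list, 'a list, 'o list, 'a list) ftor" where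
  "bar_basic C T b =
     \<lparr>fo = bar_op (ob_ten T) (unt T) b, fa = bar_op (ar_ten T) (ident C (unt T)) b\<rparr>"

definition bar_word ::
  "('o, 'a, 'm) cat_scheme \<Rightarrow> ('o, 'a) smon \<Rightarrow> basic list \<Rightarrow> ('o list, 'a list, 'o list, 'a list) ftor" where
  "bar_word C T w = foldr (\<lambda>b F. bar_basic C T b \<circ>\<^sub>F F) w id_ftor"

text \<open>The functor is prescribed on the basic arrows; on an arbitrary arrow it is computed from the
  factorization of that arrow given by its normal form.\<close>

definition bar :: "('o, 'a, 'm) cat_scheme \<Rightarrow> ('o, 'a) smon \<Rightarrow> darr \<Rightarrow> ('o list, 'a list, 'o list, 'a list) ftor" where
  "bar C T f = bar_word C T (nf f)"

definition smon_power :: "('o, 'a) smon \<Rightarrow> nat \<Rightarrow> ('o list, 'a list) smon" where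
  "smon_power T p = \<lparr>ob_ten = map2 (ob_ten T), ar_ten = map2 (ar_ten T), unt = replicate p (unt T)\<rparr>"

text \<open>Splitting a tuple into \<open>n\<close> blocks of length \<open>p\<close>; this and \<open>concat\<close> identify
  the \<open>n\<cdot>p\<close>-th power with the \<open>n\<close>-th power of the \<open>p\<close>-th power.\<close>

definition blocks :: "nat \<Rightarrow> nat \<Rightarrow> 'x list \<Rightarrow> 'x list list" where
  "blocks n p X = map (\<lambda>i. take p (drop (i * p) X)) [0..<n]"

definition flat_ftor ::
  "nat \<Rightarrow> nat \<Rightarrow> ('o list list, 'a list list, 'o list list, 'a list list) ftor
     \<Rightarrow> ('o list, 'a list, 'o list, 'a list) ftor" where
  "flat_ftor n p F = \<lparr>fo = concat \<circ> fo F \<circ> blocks n p, fa = concat \<circ> fa F \<circ> blocks n p\<rparr>"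

definition bar_pow_basic ::
  "('o, 'a, 'm) cat_scheme \<Rightarrow> ('o, 'a) smon \<Rightarrow> nat \<Rightarrow> basic \<Rightarrow> ('o list, 'a list, 'o list, 'a list) ftor" where
  "bar_pow_basic C T p b = flat_ftor (bsrc b) p (bar_basic (cat_power C p) (smon_power T p) b)"

definition bar_pow ::
  "('o, 'a, 'm) cat_scheme \<Rightarrow> ('o, 'a) smon \<Rightarrow> nat \<Rightarrow> darr \<Rightarrow> ('o list, 'a list, 'o list, 'a list) ftor" where
  "bar_pow C T p f = flat_ftor (dsrc f) p (bar (cat_power C p) (smon_power T p) f)"

text \<open>The \<open>k\<close>-fold product \<open>(F)\<^sup>k\<close> of a functor \<open>F\<close> whose source is an \<open>m\<close>-th power.\<close>

definition prod_ftor ::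
  "nat \<Rightarrow> nat \<Rightarrow> ('o list, 'a list, 'o list, 'a list) ftor \<Rightarrow> ('o list, 'a list, 'o list, 'a list) ftor" where
  "prod_ftor k m F = flat_ftor k m \<lparr>fo = map (fo F), fa = map (fa F)\<rparr>"

definition two_bar_ob :: "('o, 'a, 'm) two_fold_scheme \<Rightarrow> nat \<times> nat \<Rightarrow> ('o list, 'a list) cat" where
  "two_bar_ob M = (\<lambda>(n, m). cat_power M (n * m))"

definition two_bar_ar ::
  "('o, 'a, 'm) two_fold_scheme \<Rightarrow> darr \<times> darr \<Rightarrow> ('o list, 'a list, 'o list, 'a list) ftor" where
  "two_bar_ar M = (\<lambda>(f, g).
     prod_ftor (dtgt f) (dsrc g) (bar M (mon2 M) g) \<circ>\<^sub>F bar_pow M (mon1 M) (dsrc g) f)"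

datatype member = Col1 basic | Col2 basic

fun col1 :: "member list \<Rightarrow> basic list" where
  "col1 [] = []"
| "col1 (Col1 b # \<Theta>) = b # col1 \<Theta>"
| "col1 (Col2 b # \<Theta>) = col1 \<Theta>"

fun col2 :: "member list \<Rightarrow> basic list" where
  "col2 [] = []"
| "col2 (Col1 b # \<Theta>) = col2 \<Theta>"
| "col2 (Col2 b # \<Theta>) = b # col2 \<Theta>"

text \<open>The functor determined by a shuffle whose colour 1 part has source \<open>n\<close> and whose colour 2 part
  has source \<open>m\<close>. The inner power of a leading \<open>Col1 b\<close> is \<open>word_tgt m (col2 \<Theta>)\<close>, the outer
  power of a leading \<open>Col2 b\<close> is \<open>word_tgt n (col1 \<Theta>)\<close>.\<close>

fun shuffle_ftor ::
  "('o, 'a, 'm) two_fold_scheme \<Rightarrow> nat \<Rightarrow> nat \<Rightarrow> member list \<Rightarrow> ('o list, 'a list, 'o list, 'a list) ftor" where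
  "shuffle_ftor M n m [] = id_ftor"
| "shuffle_ftor M n m (Col1 b # \<Theta>) =
     bar_pow_basic M (mon1 M) (word_tgt m (col2 \<Theta>)) b \<circ>\<^sub>F shuffle_ftor M n m \<Theta>"
| "shuffle_ftor M n m (Col2 b # \<Theta>) =
     prod_ftor (word_tgt n (col1 \<Theta>)) (bsrc b) (bar_basic M (mon2 M) b) \<circ>\<^sub>F shuffle_ftor M n m \<Theta>"

text \<open>The component of \<open>\<chi>(f, g)\<close> at \<open>X\<close>, a tuple of \<open>bsrc f\<close> blocks of length \<open>bsrc g\<close>. Positions in
  lists are counted from 0, hence are one less than the coordinates counted from 1.\<close>

definition chi :: "('o, 'a, 'm) two_fold_scheme \<Rightarrow> basic \<Rightarrow> basic \<Rightarrow> 'o list \<Rightarrow> 'a list" where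
  "chi M f g X =
     (let ids = map (ident M) (fo (bar_pow_basic M (mon1 M) (btgt g) f \<circ>\<^sub>F
                                   prod_ftor (bsrc f) (bsrc g) (bar_basic M (mon2 M) g)) X)
      in case (f, g) of
        (S n j, S m i) \<Rightarrow> ids[j * m + i := kappa M]
      | (D n j, S m i) \<Rightarrow> if 1 \<le> j \<and> j \<le> n - 1 then ids[(j - 1) * m + i := tau M] else ids
      | (S n j, D m i) \<Rightarrow> if 1 \<le> i \<and> i \<le> m - 1 then ids[j * (m - 1) + (i - 1) := beta M] else ids
      | (D n j, D m i) \<Rightarrow>
          if 1 \<le> j \<and> j \<le> n - 1 \<and> 1 \<le> i \<and> i \<le> m - 1
          then ids[(j - 1) * (m - 1) + (i - 1) :=
                 iota M (X ! ((j - 1) * m + (i - 1))) (X ! ((j - 1) * m + i))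
                        (X ! (j * m + (i - 1))) (X ! (j * m + i))]
          else ids)"

text \<open>\<open>(n, m)\<close> are the sources of the two colours. The part \<open>\<Pi>\<close> of a shuffle \<open>\<Pi>(f,1)(g,2)\<Lambda>\<close>
  starts at \<open>(btgt f, btgt g)\<close>.\<close>

definition whisker_chi ::
  "('o, 'a, 'm) two_fold_scheme \<Rightarrow> nat \<Rightarrow> nat \<Rightarrow> member list \<Rightarrow> basic \<Rightarrow> basic \<Rightarrow> member list
     \<Rightarrow> 'o list \<Rightarrow> 'a list" where
  "whisker_chi M n m \<Pi> f g \<Lambda> X =
     fa (shuffle_ftor M (btgt f) (btgt g) \<Pi>) (chi M f g (fo (shuffle_ftor M n m \<Lambda>) X))"

definition swap_step :: "member list \<Rightarrow> member list \<Rightarrow> bool" where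
  "swap_step \<Theta> \<Theta>' \<longleftrightarrow> (\<exists>\<Pi> f g \<Lambda>. \<Theta> = \<Pi> @ [Col1 f, Col2 g] @ \<Lambda> \<and> \<Theta>' = \<Pi> @ [Col2 g, Col1 f] @ \<Lambda>)"

definition step_trans ::
  "('o, 'a, 'm) two_fold_scheme \<Rightarrow> nat \<Rightarrow> nat \<Rightarrow> member list \<Rightarrow> member list \<Rightarrow> 'o list \<Rightarrow> 'a list" where
  "step_trans M n m \<Theta> \<Theta>' = (THE \<alpha>. \<exists>\<Pi> f g \<Lambda>. \<Theta> = \<Pi> @ [Col1 f, Col2 g] @ \<Lambda> \<and>
     \<Theta>' = \<Pi> @ [Col2 g, Col1 f] @ \<Lambda> \<and> \<alpha> = whisker_chi M n m \<Pi> f g \<Lambda>)"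

definition normalizing_path ::
  "basic list \<Rightarrow> basic list \<Rightarrow> member list \<Rightarrow> member list list \<Rightarrow> bool" where
  "normalizing_path \<Phi> \<Gamma> \<Theta> P \<longleftrightarrow>
     P \<noteq> [] \<and> set P \<subseteq> shuffles (map Col1 \<Phi>) (map Col2 \<Gamma>) \<and>
     hd P = \<Theta> \<and> last P = map Col2 \<Gamma> @ map Col1 \<Phi> \<and>
     (\<forall>i. Suc i < length P \<longrightarrow> swap_step (P ! i) (P ! Suc i))"

fun path_trans ::
  "('o, 'a, 'm) two_fold_scheme \<Rightarrow> nat \<Rightarrow> nat \<Rightarrow> member list list \<Rightarrow> 'o list \<Rightarrow> 'a list" where
  "path_trans M n m [] X = []"
| "path_trans M n m [\<Theta>] X = map (ident M) (fo (shuffle_ftor M n m \<Theta>) X)"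
| "path_trans M n m (\<Theta> # \<Theta>' # P) X =
     map2 (cmp M) (path_trans M n m (\<Theta>' # P) X) (step_trans M n m \<Theta> \<Theta>' X)"

text \<open>The transformation does not depend on the normalizing path, so any choice of path will do.\<close>

definition phi ::
  "('o, 'a, 'm) two_fold_scheme \<Rightarrow> nat \<Rightarrow> nat \<Rightarrow> member list \<Rightarrow> 'o list \<Rightarrow> 'a list" where
  "phi M n m \<Theta> = path_trans M n m (SOME P. normalizing_path (col1 \<Theta>) (col2 \<Theta>) \<Theta> P)"

definition omega ::
  "('o, 'a, 'm) two_fold_scheme \<Rightarrow> darr \<times> darr \<Rightarrow> darr \<times> darr \<Rightarrow> 'o list \<Rightarrow> 'a list" where
  "omega M = (\<lambda>(f\<^sub>2, g\<^sub>2) (f\<^sub>1, g\<^sub>1). phi M (dsrc f\<^sub>1) (dsrc g\<^sub>1)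
     (map Col2 (nf g\<^sub>2) @ map Col1 (nf f\<^sub>2) @ map Col2 (nf g\<^sub>1) @ map Col1 (nf f\<^sub>1)))"

end

theory Submission
  imports Defs
begin

text \<open>Axioms (1)-(12) produce, for every finite matrix of objects, one canonical interchange arrow from
  the \<open>\<otimes>\<^sub>1\<close>-product of the \<open>\<otimes>\<^sub>2\<close>-products of its rows to the \<open>\<otimes>\<^sub>2\<close>-product of the
  \<open>\<otimes>\<^sub>1\<close>-products of its columns; \<open>\<kappa>\<close>, \<open>\<tau>\<close>, \<open>\<beta>\<close> and \<open>\<iota>\<close> are the cases where both
  dimensions are 0 or 2. This arrow is natural and compatible with grouping the rows and with grouping
  the columns. It therefore extends \<open>\<chi>(f, g)\<close> from basic to arbitrary arrows of \<open>\<Delta>\<^sup>o\<^sup>p\<close>, compatibly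
  with composition in \<open>f\<close> and in \<open>g\<close>. Composing these cells along a shuffle \<open>\<Theta>\<close> yields a
  transformation that agrees with \<open>\<phi>\<^sub>\<Theta>\<close> for every normalizing path, so \<open>\<omega>\<close> of
  \<open>(f\<^sub>2, g\<^sub>2), (f\<^sub>1, g\<^sub>1)\<close> is the whiskering of \<open>\<chi>(f\<^sub>2, g\<^sub>1)\<close>, and the coherence law becomes the
  naturality of \<open>\<chi>(f\<^sub>3, g\<^sub>2)\<close> at \<open>\<chi>(f\<^sub>2, g\<^sub>1)\<close>.\<close>

section \<open>The interchange arrow of a matrix\<close>

text \<open>Coordinate \<open>i\<close> of a tuple behaves like the edge from \<open>i\<close> to
  \<open>i + 1\<close> of a simplex. The arrow opposite to a monotone map \<phi> puts into
  coordinate \<open>i\<close> the product of the edges between \<open>\<phi> i\<close> and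
  \<open>\<phi> (i + 1)\<close>: an outer face drops an edge, an inner face merges two, a degeneracy
  creates an empty product. One formula thus covers all basic arrows and all their composites. The
  distinguished entry of \<chi> sits where a row interval of length 0 or 2 meets a column interval
  of length 0 or 2; an interval of length 1 forces an identity. Index bounds would clutter every
  composition law, so monotone maps and matrices are made total, and bounds return only when a
  finite corner is read off as a tuple. Path independence requires no confluence argument about
  swaps: the recursively defined \<open>psi\<close> splits off exactly one whiskered \<chi> at each
  swap and is an identity at the normal shuffle. Normal forms enter through the total map that they
  represent; their existence and uniqueness give meaning to the definite description in
  \<open>nf\<close>.\<close>

definition bigop :: "('x \<Rightarrow> 'x \<Rightarrow> 'x) \<Rightarrow> 'x \<Rightarrow> 'i list \<Rightarrow> ('i \<Rightarrow> 'x) \<Rightarrow> 'x" where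
  "bigop t u is F = foldr (\<lambda>i. t (F i)) is u"

lemma bigop_Nil [simp]: "bigop t u [] F = u"
  and bigop_Cons [simp]: "bigop t u (i # is) F = t (F i) (bigop t u is F)"
  by (simp_all add: bigop_def)

text \<open>The tensors obey the monoid laws only on a carrier. The same abstract monoid serves
  objects and arrows for both tensors, and later also \<open>p\<close>-tuples of either. Requiring
  \<open>F i \<in> R\<close> for every index keeps range conditions out of the product laws.\<close>

locale monoid_on =
  fixes R :: "'x set" and t :: "'x \<Rightarrow> 'x \<Rightarrow> 'x" and u :: 'x
  assumes u_in [simp]: "u \<in> R"
    and t_in [simp]: "\<lbrakk>x \<in> R; y \<in> R\<rbrakk> \<Longrightarrow> t x y \<in> R"
    and t_assoc: "\<lbrakk>x \<in> R; y \<in> R; z \<in> R\<rbrakk> \<Longrightarrow> t (t x y) z = t x (t y z)"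
    and t_left [simp]: "x \<in> R \<Longrightarrow> t u x = x"
    and t_right [simp]: "x \<in> R \<Longrightarrow> t x u = x"
begin

lemma bigop_in [simp]: "(\<And>i. F i \<in> R) \<Longrightarrow> bigop t u is F \<in> R"
  by (induction "is") simp_all

lemma bigop_append: "(\<And>i. F i \<in> R) \<Longrightarrow> bigop t u (is @ js) F = t (bigop t u is F) (bigop t u js F)"
  by (induction "is") (simp_all add: t_assoc)

lemma bigop_concat:
  "(\<And>i. F i \<in> R) \<Longrightarrow> bigop t u (concat (map h ks)) F = bigop t u ks (\<lambda>k. bigop t u (h k) F)"
  by (induction ks) (simp_all add: bigop_append)

lemma bigop_unit [simp]: "bigop t u is (\<lambda>_. u) = u"
  by (induction "is") simp_all

end

section \<open>Rules of computation for the two tensors, and the interchange arrows built from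
  them\<close>

context two_fold_strict_monoidal
begin

lemmas mon_defs = mon1_def mon2_def

lemma ten_facts:
  assumes "strict_monoidal M T"
  shows "\<lbrakk>A \<in> Ob M; B \<in> Ob M\<rbrakk> \<Longrightarrow> ob_ten T A B \<in> Ob M"
    and "\<lbrakk>A \<in> Ob M; B \<in> Ob M\<rbrakk> \<Longrightarrow> ar_ten T (\<one> A) (\<one> B) = \<one> (ob_ten T A B)"
    and "\<lbrakk>f \<in> Ar M; g \<in> Ar M\<rbrakk> \<Longrightarrow> ar_ten T f g \<in> Ar M"
    and "\<lbrakk>f \<in> Ar M; g \<in> Ar M\<rbrakk> \<Longrightarrow> dm M (ar_ten T f g) = ob_ten T (dm M f) (dm M g)"
    and "\<lbrakk>f \<in> Ar M; g \<in> Ar M\<rbrakk> \<Longrightarrow> cd M (ar_ten T f g) = ob_ten T (cd M f) (cd M g)"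
    and "\<lbrakk>f \<in> Ar M; f' \<in> Ar M; g \<in> Ar M; g' \<in> Ar M; dm M g = cd M f; dm M g' = cd M f'\<rbrakk>
      \<Longrightarrow> ar_ten T g g' \<odot> ar_ten T f f' = ar_ten T (g \<odot> f) (g' \<odot> f')"
proof -
  interpret strict_monoidal M T by fact
  note F = ten_functor[unfolded is_functor_def prod_cat_def hom_def, simplified]
  show "\<lbrakk>A \<in> Ob M; B \<in> Ob M\<rbrakk> \<Longrightarrow> ob_ten T A B \<in> Ob M"
    and "\<lbrakk>A \<in> Ob M; B \<in> Ob M\<rbrakk> \<Longrightarrow> ar_ten T (\<one> A) (\<one> B) = \<one> (ob_ten T A B)"
    and "\<lbrakk>f \<in> Ar M; g \<in> Ar M\<rbrakk> \<Longrightarrow> ar_ten T f g \<in> Ar M"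
    and "\<lbrakk>f \<in> Ar M; g \<in> Ar M\<rbrakk> \<Longrightarrow> dm M (ar_ten T f g) = ob_ten T (dm M f) (dm M g)"
    and "\<lbrakk>f \<in> Ar M; g \<in> Ar M\<rbrakk> \<Longrightarrow> cd M (ar_ten T f g) = ob_ten T (cd M f) (cd M g)"
    and "\<lbrakk>f \<in> Ar M; f' \<in> Ar M; g \<in> Ar M; g' \<in> Ar M; dm M g = cd M f; dm M g' = cd M f'\<rbrakk>
      \<Longrightarrow> ar_ten T g g' \<odot> ar_ten T f f' = ar_ten T (g \<odot> f) (g' \<odot> f')"
    using F by auto
qed

lemmas ten1_facts = ten_facts[OF mon1, unfolded mon1_def smon.simps]
lemmas ten2_facts = ten_facts[OF mon2, unfolded mon2_def smon.simps]

lemma unt1_in: "I\<^sub>1 \<in> Ob M" and unt2_in: "I\<^sub>2 \<in> Ob M"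
  using strict_monoidal.unt_in[OF mon1] strict_monoidal.unt_in[OF mon2] by (simp_all add: mon_defs)

lemma ident_facts:
  assumes "A \<in> Ob M"
  shows "\<one> A \<in> Ar M" "dm M (\<one> A) = A" "cd M (\<one> A) = A"
  using ident_in[OF assms] by (simp_all add: hom_def)

lemma cmp_facts:
  assumes "f \<in> Ar M" "g \<in> Ar M" "dm M g = cd M f"
  shows "g \<odot> f \<in> Ar M" "dm M (g \<odot> f) = dm M f" "cd M (g \<odot> f) = cd M g"
  using cmp_in[OF assms] by (simp_all add: hom_def)

lemmas struct_facts =
  kappa_in[unfolded hom_def, simplified] beta_in[unfolded hom_def, simplified]
  tau_in[unfolded hom_def, simplified] iota_in[unfolded hom_def, simplified]

lemmas typing [simp] = ten1_facts(1-5) ten2_facts(1-5) unt1_in unt2_in ident_facts cmp_facts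
  struct_facts dm_in cd_in

lemmas interchange1 = ten1_facts(6) and interchange2 = ten2_facts(6)

lemma ident_left' [simp]: "\<lbrakk>f \<in> Ar M; cd M f = A\<rbrakk> \<Longrightarrow> \<one> A \<odot> f = f"
  using ident_left by blast

lemma ident_right' [simp]: "\<lbrakk>f \<in> Ar M; dm M f = A\<rbrakk> \<Longrightarrow> f \<odot> \<one> A = f"
  using ident_right by blast

text \<open>Expressing the objects through \<open>dm\<close> and \<open>cd\<close> lets naturality
  be instantiated by four arrows alone.\<close>

lemma iota_nat:
  assumes "a \<in> Ar M" "b \<in> Ar M" "c \<in> Ar M" "d \<in> Ar M"
  shows "\<iota> (cd M a) (cd M b) (cd M c) (cd M d) \<odot> ((a \<otimes>\<^sub>2 b) \<otimes>\<^sub>1 (c \<otimes>\<^sub>2 d))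
    = ((a \<otimes>\<^sub>1 c) \<otimes>\<^sub>2 (b \<otimes>\<^sub>1 d)) \<odot> \<iota> (dm M a) (dm M b) (dm M c) (dm M d)"
  by (rule iota_natural) (use assms in \<open>auto simp: hom_def\<close>)

sublocale ob1: monoid_on "Ob M" "ob_ten1 M" "I\<^sub>1"
proof -
  interpret strict_monoidal M "mon1 M" by (rule mon1)
  show "monoid_on (Ob M) (ob_ten1 M) I\<^sub>1"
    using ob_assoc ob_unt_left ob_unt_right by unfold_locales (simp_all add: mon_defs)
qed

sublocale ob2: monoid_on "Ob M" "ob_ten2 M" "I\<^sub>2"
proof -
  interpret strict_monoidal M "mon2 M" by (rule mon2)
  show "monoid_on (Ob M) (ob_ten2 M) I\<^sub>2"
    using ob_assoc ob_unt_left ob_unt_right by unfold_locales (simp_all add: mon_defs)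
qed

sublocale ar1: monoid_on "Ar M" "ar_ten1 M" "\<one> I\<^sub>1"
proof -
  interpret strict_monoidal M "mon1 M" by (rule mon1)
  show "monoid_on (Ar M) (ar_ten1 M) (\<one> I\<^sub>1)"
    using ar_assoc ar_unt_left ar_unt_right by unfold_locales (simp_all add: mon_defs)
qed

sublocale ar2: monoid_on "Ar M" "ar_ten2 M" "\<one> I\<^sub>2"
proof -
  interpret strict_monoidal M "mon2 M" by (rule mon2)
  show "monoid_on (Ar M) (ar_ten2 M) (\<one> I\<^sub>2)"
    using ar_assoc ar_unt_left ar_unt_right by unfold_locales (simp_all add: mon_defs)
qed

abbreviation T1 where "T1 \<equiv> bigop (ob_ten1 M) I\<^sub>1"
abbreviation T2 where "T2 \<equiv> bigop (ob_ten2 M) I\<^sub>2"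
abbreviation A1 where "A1 \<equiv> bigop (ar_ten1 M) (\<one> I\<^sub>1)"
abbreviation A2 where "A2 \<equiv> bigop (ar_ten2 M) (\<one> I\<^sub>2)"

lemma A1_type [simp]:
  assumes "\<And>i. f i \<in> Ar M"
  shows "dm M (A1 is f) = T1 is (\<lambda>i. dm M (f i))" "cd M (A1 is f) = T1 is (\<lambda>i. cd M (f i))"
  by (induction "is") (simp_all add: assms)

lemma A2_type [simp]:
  assumes "\<And>i. f i \<in> Ar M"
  shows "dm M (A2 is f) = T2 is (\<lambda>i. dm M (f i))" "cd M (A2 is f) = T2 is (\<lambda>i. cd M (f i))"
  by (induction "is") (simp_all add: assms)

lemma A1_ident [simp]: "(\<And>i. F i \<in> Ob M) \<Longrightarrow> A1 is (\<lambda>i. \<one> (F i)) = \<one> (T1 is F)"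
  by (induction "is") simp_all

lemma A2_ident [simp]: "(\<And>i. F i \<in> Ob M) \<Longrightarrow> A2 is (\<lambda>i. \<one> (F i)) = \<one> (T2 is F)"
  by (induction "is") simp_all

lemma A1_cmp:
  assumes "\<And>i. f i \<in> Ar M" "\<And>i. g i \<in> Ar M" "\<And>i. dm M (g i) = cd M (f i)"
  shows "A1 is g \<odot> A1 is f = A1 is (\<lambda>i. g i \<odot> f i)"
  by (induction "is") (simp_all add: assms interchange1)

lemma A2_cmp:
  assumes "\<And>i. f i \<in> Ar M" "\<And>i. g i \<in> Ar M" "\<And>i. dm M (g i) = cd M (f i)"
  shows "A2 is g \<odot> A2 is f = A2 is (\<lambda>i. g i \<odot> f i)"
  by (induction "is") (simp_all add: assms interchange2)

text \<open>By axioms (1)-(6) every power \<open>\<otimes>\<^sub>2\<^sup>q : M\<^sup>q \<rightarrow> M\<close> is a lax monoidal functor for \<open>\<otimes>\<^sub>1\<close>; its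
  structure maps are \<open>J\<close> (binary) and \<open>U\<close> (nullary).\<close>

primrec J :: "'i list \<Rightarrow> ('i \<Rightarrow> 'o) \<Rightarrow> ('i \<Rightarrow> 'o) \<Rightarrow> 'a" where
  "J [] F G = \<tau>"
| "J (b # bs) F G = (\<one> (F b \<boxtimes>\<^sub>1 G b) \<otimes>\<^sub>2 J bs F G) \<odot> \<iota> (F b) (T2 bs F) (G b) (T2 bs G)"

primrec U :: "'i list \<Rightarrow> 'a" where
  "U [] = \<kappa>"
| "U (b # bs) = (\<one> I\<^sub>1 \<otimes>\<^sub>2 U bs) \<odot> \<beta>"

lemma J_type [simp]:
  assumes "\<And>i. F i \<in> Ob M" "\<And>i. G i \<in> Ob M"
  shows "J bs F G \<in> Ar M" "dm M (J bs F G) = T2 bs F \<boxtimes>\<^sub>1 T2 bs G"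
    "cd M (J bs F G) = T2 bs (\<lambda>b. F b \<boxtimes>\<^sub>1 G b)"
  using assms by (induction bs) simp_all

lemma U_type [simp]:
  "U bs \<in> Ar M" "dm M (U bs) = I\<^sub>1" "cd M (U bs) = T2 bs (\<lambda>_. I\<^sub>1)"
  by (induction bs) simp_all

lemma J_nat:
  assumes f [simp]: "\<And>i. f i \<in> Ar M" and g [simp]: "\<And>i. g i \<in> Ar M"
  shows "J bs (\<lambda>i. cd M (f i)) (\<lambda>i. cd M (g i)) \<odot> (A2 bs f \<otimes>\<^sub>1 A2 bs g)
    = A2 bs (\<lambda>i. f i \<otimes>\<^sub>1 g i) \<odot> J bs (\<lambda>i. dm M (f i)) (\<lambda>i. dm M (g i))"
proof (induction bs)
  case (Cons b bs)
  let ?F = "\<lambda>i. dm M (f i)" and ?G = "\<lambda>i. dm M (g i)"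
  let ?F' = "\<lambda>i. cd M (f i)" and ?G' = "\<lambda>i. cd M (g i)"
  let ?J = "J bs ?F ?G" and ?J' = "J bs ?F' ?G'"
  let ?i = "\<iota> (?F b) (T2 bs ?F) (?G b) (T2 bs ?G)"
  let ?i' = "\<iota> (?F' b) (T2 bs ?F') (?G' b) (T2 bs ?G')"
  have "((\<one> (?F' b \<boxtimes>\<^sub>1 ?G' b) \<otimes>\<^sub>2 ?J') \<odot> ?i') \<odot> ((f b \<otimes>\<^sub>2 A2 bs f) \<otimes>\<^sub>1 (g b \<otimes>\<^sub>2 A2 bs g))
    = (\<one> (?F' b \<boxtimes>\<^sub>1 ?G' b) \<otimes>\<^sub>2 ?J') \<odot> ((f b \<otimes>\<^sub>1 g b) \<otimes>\<^sub>2 (A2 bs f \<otimes>\<^sub>1 A2 bs g)) \<odot> ?i"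
    using iota_nat[of "f b" "A2 bs f" "g b" "A2 bs g"] by (simp add: cmp_assoc)
  also have "\<dots> = ((f b \<otimes>\<^sub>1 g b) \<otimes>\<^sub>2 (?J' \<odot> (A2 bs f \<otimes>\<^sub>1 A2 bs g))) \<odot> ?i"
    by (simp add: cmp_assoc[symmetric] interchange2)
  also have "\<dots> = ((f b \<otimes>\<^sub>1 g b) \<otimes>\<^sub>2 (A2 bs (\<lambda>i. f i \<otimes>\<^sub>1 g i) \<odot> ?J)) \<odot> ?i"
    by (simp only: Cons.IH)
  also have "\<dots> = ((f b \<otimes>\<^sub>1 g b) \<otimes>\<^sub>2 A2 bs (\<lambda>i. f i \<otimes>\<^sub>1 g i)) \<odot> (\<one> (?F b \<boxtimes>\<^sub>1 ?G b) \<otimes>\<^sub>2 ?J) \<odot> ?i"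
    by (simp add: cmp_assoc[symmetric] interchange2)
  finally show ?case by simp
qed simp

text \<open>Induction over the columns, with \<open>ax4\<close> for no column and \<open>ax1\<close>
  for a new one. Naturality of \<iota> (\<open>L\<close> and \<open>R\<close>) moves the structure
  maps of the remaining columns past \<iota>, so that two adjacent \<iota>'s meet in the shape of
  \<open>ax1\<close>.\<close>

lemma J_assoc:
  assumes [simp]: "\<And>i. F i \<in> Ob M" "\<And>i. G i \<in> Ob M" "\<And>i. H i \<in> Ob M"
  shows "J bs F (\<lambda>i. G i \<boxtimes>\<^sub>1 H i) \<odot> (\<one> (T2 bs F) \<otimes>\<^sub>1 J bs G H)
    = J bs (\<lambda>i. F i \<boxtimes>\<^sub>1 G i) H \<odot> (J bs F G \<otimes>\<^sub>1 \<one> (T2 bs H))"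
proof (induction bs)
  case (Cons b bs)
  let ?GH = "\<lambda>i. G i \<boxtimes>\<^sub>1 H i" and ?FG = "\<lambda>i. F i \<boxtimes>\<^sub>1 G i"
  have L: "\<iota> (F b) (T2 bs F) (?GH b) (T2 bs ?GH) \<odot> (\<one> (F b \<boxtimes>\<^sub>2 T2 bs F) \<otimes>\<^sub>1 (\<one> (?GH b) \<otimes>\<^sub>2 J bs G H))
    = (\<one> (F b \<boxtimes>\<^sub>1 ?GH b) \<otimes>\<^sub>2 (\<one> (T2 bs F) \<otimes>\<^sub>1 J bs G H)) \<odot> \<iota> (F b) (T2 bs F) (?GH b) (T2 bs G \<boxtimes>\<^sub>1 T2 bs H)"
    using iota_nat[of "\<one> (F b)" "\<one> (T2 bs F)" "\<one> (?GH b)" "J bs G H"] by simp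
  have R: "\<iota> (?FG b) (T2 bs ?FG) (H b) (T2 bs H) \<odot> ((\<one> (?FG b) \<otimes>\<^sub>2 J bs F G) \<otimes>\<^sub>1 \<one> (H b \<boxtimes>\<^sub>2 T2 bs H))
    = (\<one> (?FG b \<boxtimes>\<^sub>1 H b) \<otimes>\<^sub>2 (J bs F G \<otimes>\<^sub>1 \<one> (T2 bs H))) \<odot> \<iota> (?FG b) (T2 bs F \<boxtimes>\<^sub>1 T2 bs G) (H b) (T2 bs H)"
    using iota_nat[of "\<one> (?FG b)" "J bs F G" "\<one> (H b)" "\<one> (T2 bs H)"] by simp
  have "J (b # bs) F ?GH \<odot> (\<one> (T2 (b # bs) F) \<otimes>\<^sub>1 J (b # bs) G H)
    = (\<one> (F b \<boxtimes>\<^sub>1 ?GH b) \<otimes>\<^sub>2 J bs F ?GH) \<odot> (\<iota> (F b) (T2 bs F) (?GH b) (T2 bs ?GH)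
       \<odot> (\<one> (F b \<boxtimes>\<^sub>2 T2 bs F) \<otimes>\<^sub>1 (\<one> (?GH b) \<otimes>\<^sub>2 J bs G H)))
       \<odot> (\<one> (F b \<boxtimes>\<^sub>2 T2 bs F) \<otimes>\<^sub>1 \<iota> (G b) (T2 bs G) (H b) (T2 bs H))"
    by (simp add: cmp_assoc interchange1)
  also have "\<dots> = (\<one> (F b \<boxtimes>\<^sub>1 ?GH b) \<otimes>\<^sub>2 (J bs F ?GH \<odot> (\<one> (T2 bs F) \<otimes>\<^sub>1 J bs G H)))
       \<odot> \<iota> (F b) (T2 bs F) (?GH b) (T2 bs G \<boxtimes>\<^sub>1 T2 bs H)
       \<odot> (\<one> (F b \<boxtimes>\<^sub>2 T2 bs F) \<otimes>\<^sub>1 \<iota> (G b) (T2 bs G) (H b) (T2 bs H))"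
    unfolding L by (simp add: cmp_assoc[symmetric] interchange2 ob1.t_assoc)
  also have "\<dots> = (\<one> (F b \<boxtimes>\<^sub>1 ?GH b) \<otimes>\<^sub>2 (J bs ?FG H \<odot> (J bs F G \<otimes>\<^sub>1 \<one> (T2 bs H))))
       \<odot> \<iota> (?FG b) (T2 bs F \<boxtimes>\<^sub>1 T2 bs G) (H b) (T2 bs H)
       \<odot> (\<iota> (F b) (T2 bs F) (G b) (T2 bs G) \<otimes>\<^sub>1 \<one> (H b \<boxtimes>\<^sub>2 T2 bs H))"
    unfolding Cons.IH by (subst ax1) simp_all
  also have "\<dots> = (\<one> (?FG b \<boxtimes>\<^sub>1 H b) \<otimes>\<^sub>2 J bs ?FG H) \<odot> (\<iota> (?FG b) (T2 bs ?FG) (H b) (T2 bs H)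
       \<odot> ((\<one> (?FG b) \<otimes>\<^sub>2 J bs F G) \<otimes>\<^sub>1 \<one> (H b \<boxtimes>\<^sub>2 T2 bs H)))
       \<odot> (\<iota> (F b) (T2 bs F) (G b) (T2 bs G) \<otimes>\<^sub>1 \<one> (H b \<boxtimes>\<^sub>2 T2 bs H))"
    unfolding R by (simp add: cmp_assoc[symmetric] interchange2 ob1.t_assoc)
  also have "\<dots> = J (b # bs) ?FG H \<odot> (J (b # bs) F G \<otimes>\<^sub>1 \<one> (T2 (b # bs) H))"
    by (simp add: cmp_assoc interchange1)
  finally show ?case .
qed (use ax4 in simp)

text \<open>The scheme of \<open>J_assoc\<close>, with \<open>ax5\<close> for no column and
  \<open>ax2\<close> cancelling \<iota> against \<beta> in a new one.\<close>

lemma J_unit_right: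
  assumes [simp]: "\<And>i. F i \<in> Ob M"
  shows "J bs F (\<lambda>_. I\<^sub>1) \<odot> (\<one> (T2 bs F) \<otimes>\<^sub>1 U bs) = \<one> (T2 bs F)"
proof (induction bs)
  case (Cons b bs)
  let ?I = "\<lambda>_. I\<^sub>1"
  have L: "\<iota> (F b) (T2 bs F) I\<^sub>1 (T2 bs ?I) \<odot> (\<one> (F b \<boxtimes>\<^sub>2 T2 bs F) \<otimes>\<^sub>1 (\<one> I\<^sub>1 \<otimes>\<^sub>2 U bs))
    = (\<one> (F b) \<otimes>\<^sub>2 (\<one> (T2 bs F) \<otimes>\<^sub>1 U bs)) \<odot> \<iota> (F b) (T2 bs F) I\<^sub>1 I\<^sub>1"
    using iota_nat[of "\<one> (F b)" "\<one> (T2 bs F)" "\<one> I\<^sub>1" "U bs"] by simp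
  have "J (b # bs) F ?I \<odot> (\<one> (T2 (b # bs) F) \<otimes>\<^sub>1 U (b # bs))
    = (\<one> (F b) \<otimes>\<^sub>2 J bs F ?I) \<odot> (\<iota> (F b) (T2 bs F) I\<^sub>1 (T2 bs ?I)
       \<odot> (\<one> (F b \<boxtimes>\<^sub>2 T2 bs F) \<otimes>\<^sub>1 (\<one> I\<^sub>1 \<otimes>\<^sub>2 U bs))) \<odot> (\<one> (F b \<boxtimes>\<^sub>2 T2 bs F) \<otimes>\<^sub>1 \<beta>)"
    by (simp add: cmp_assoc interchange1)
  also have "\<dots> = (\<one> (F b) \<otimes>\<^sub>2 (J bs F ?I \<odot> (\<one> (T2 bs F) \<otimes>\<^sub>1 U bs)))
       \<odot> \<iota> (F b) (T2 bs F) I\<^sub>1 I\<^sub>1 \<odot> (\<one> (F b \<boxtimes>\<^sub>2 T2 bs F) \<otimes>\<^sub>1 \<beta>)"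
    unfolding L by (simp add: cmp_assoc[symmetric] interchange2)
  also have "\<dots> = \<one> (T2 (b # bs) F)"
    unfolding Cons.IH by (subst ax2) simp_all
  finally show ?case .
qed (use ax5 in simp)

text \<open>Mirror image of \<open>J_unit_right\<close>, resting on \<open>ax6\<close> and
  \<open>ax3\<close>.\<close>

lemma J_unit_left:
  assumes [simp]: "\<And>i. F i \<in> Ob M"
  shows "J bs (\<lambda>_. I\<^sub>1) F \<odot> (U bs \<otimes>\<^sub>1 \<one> (T2 bs F)) = \<one> (T2 bs F)"
proof (induction bs)
  case (Cons b bs)
  let ?I = "\<lambda>_. I\<^sub>1"
  have L: "\<iota> I\<^sub>1 (T2 bs ?I) (F b) (T2 bs F) \<odot> ((\<one> I\<^sub>1 \<otimes>\<^sub>2 U bs) \<otimes>\<^sub>1 \<one> (F b \<boxtimes>\<^sub>2 T2 bs F))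
    = (\<one> (F b) \<otimes>\<^sub>2 (U bs \<otimes>\<^sub>1 \<one> (T2 bs F))) \<odot> \<iota> I\<^sub>1 I\<^sub>1 (F b) (T2 bs F)"
    using iota_nat[of "\<one> I\<^sub>1" "U bs" "\<one> (F b)" "\<one> (T2 bs F)"] by simp
  have "J (b # bs) ?I F \<odot> (U (b # bs) \<otimes>\<^sub>1 \<one> (T2 (b # bs) F))
    = (\<one> (F b) \<otimes>\<^sub>2 J bs ?I F) \<odot> (\<iota> I\<^sub>1 (T2 bs ?I) (F b) (T2 bs F)
       \<odot> ((\<one> I\<^sub>1 \<otimes>\<^sub>2 U bs) \<otimes>\<^sub>1 \<one> (F b \<boxtimes>\<^sub>2 T2 bs F))) \<odot> (\<beta> \<otimes>\<^sub>1 \<one> (F b \<boxtimes>\<^sub>2 T2 bs F))"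
    by (simp add: cmp_assoc interchange1)
  also have "\<dots> = (\<one> (F b) \<otimes>\<^sub>2 (J bs ?I F \<odot> (U bs \<otimes>\<^sub>1 \<one> (T2 bs F))))
       \<odot> \<iota> I\<^sub>1 I\<^sub>1 (F b) (T2 bs F) \<odot> (\<beta> \<otimes>\<^sub>1 \<one> (F b \<boxtimes>\<^sub>2 T2 bs F))"
    unfolding L by (simp add: cmp_assoc[symmetric] interchange2)
  also have "\<dots> = \<one> (T2 (b # bs) F)"
    unfolding Cons.IH by (subst ax3) simp_all
  finally show ?case .
qed (use ax6 in simp)

text \<open>The recursion of \<open>J\<close> peels off one column; \<open>ax7\<close> rebrackets
  this to a cut at any place. For an empty left part, \<open>ax9\<close> absorbs the extra
  \<tau>.\<close>

lemma J_append:
  assumes [simp]: "\<And>i. F i \<in> Ob M" "\<And>i. G i \<in> Ob M"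
  shows "J (bs @ cs) F G = (J bs F G \<otimes>\<^sub>2 J cs F G) \<odot> \<iota> (T2 bs F) (T2 cs F) (T2 bs G) (T2 cs G)"
proof (induction bs)
  case Nil
  have "(\<tau> \<otimes>\<^sub>2 J cs F G) \<odot> \<iota> I\<^sub>2 (T2 cs F) I\<^sub>2 (T2 cs G)
    = (\<one> I\<^sub>2 \<otimes>\<^sub>2 J cs F G) \<odot> (\<tau> \<otimes>\<^sub>2 \<one> (T2 cs F \<boxtimes>\<^sub>1 T2 cs G)) \<odot> \<iota> I\<^sub>2 (T2 cs F) I\<^sub>2 (T2 cs G)"
    by (simp add: cmp_assoc[symmetric] interchange2 del: ar2.t_left)
  also have "\<dots> = J cs F G"
    by (subst ax9) simp_all
  finally show ?case by simp
next
  case (Cons b bs)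
  let ?i = "\<iota> (T2 bs F) (T2 cs F) (T2 bs G) (T2 cs G)"
  have "J ((b # bs) @ cs) F G
    = (\<one> (F b \<boxtimes>\<^sub>1 G b) \<otimes>\<^sub>2 (J bs F G \<otimes>\<^sub>2 J cs F G)) \<odot> (\<one> (F b \<boxtimes>\<^sub>1 G b) \<otimes>\<^sub>2 ?i)
      \<odot> \<iota> (F b) (T2 bs F \<boxtimes>\<^sub>2 T2 cs F) (G b) (T2 bs G \<boxtimes>\<^sub>2 T2 cs G)"
    by (simp add: Cons.IH ob2.bigop_append cmp_assoc[symmetric] interchange2)
  also have "\<dots> = ((\<one> (F b \<boxtimes>\<^sub>1 G b) \<otimes>\<^sub>2 J bs F G) \<otimes>\<^sub>2 J cs F G)
      \<odot> (\<iota> (F b) (T2 bs F) (G b) (T2 bs G) \<otimes>\<^sub>2 \<one> (T2 cs F \<boxtimes>\<^sub>1 T2 cs G))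
      \<odot> \<iota> (F b \<boxtimes>\<^sub>2 T2 bs F) (T2 cs F) (G b \<boxtimes>\<^sub>2 T2 bs G) (T2 cs G)"
    by (subst ax7) (simp_all add: ar2.t_assoc)
  also have "\<dots> = (J (b # bs) F G \<otimes>\<^sub>2 J cs F G)
      \<odot> \<iota> (T2 (b # bs) F) (T2 cs F) (T2 (b # bs) G) (T2 cs G)"
    by (simp add: cmp_assoc[symmetric] interchange2 ob2.t_assoc)
  finally show ?case .
qed

lemma J_concat:
  assumes [simp]: "\<And>i. F i \<in> Ob M" "\<And>i. G i \<in> Ob M"
  shows "J (concat (map h ks)) F G
    = A2 ks (\<lambda>k. J (h k) F G) \<odot> J ks (\<lambda>k. T2 (h k) F) (\<lambda>k. T2 (h k) G)"
proof (induction ks)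
  case (Cons k ks)
  have "J (concat (map h (k # ks))) F G
    = (J (h k) F G \<otimes>\<^sub>2 (A2 ks (\<lambda>k. J (h k) F G) \<odot> J ks (\<lambda>k. T2 (h k) F) (\<lambda>k. T2 (h k) G)))
      \<odot> \<iota> (T2 (h k) F) (T2 ks (\<lambda>k. T2 (h k) F)) (T2 (h k) G) (T2 ks (\<lambda>k. T2 (h k) G))"
    by (simp add: J_append Cons.IH ob2.bigop_concat)
  also have "\<dots> = A2 (k # ks) (\<lambda>k. J (h k) F G) \<odot> J (k # ks) (\<lambda>k. T2 (h k) F) (\<lambda>k. T2 (h k) G)"
    by (simp add: cmp_assoc[symmetric] interchange2)
  finally show ?case .
qed simp

text \<open>The nullary analogue of \<open>J_append\<close>: coassociativity \<open>ax10\<close>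
  moves the cut, and \<open>ax12\<close> handles an empty left part.\<close>

lemma U_append: "U (bs @ cs) = (U bs \<otimes>\<^sub>2 U cs) \<odot> \<beta>"
proof (induction bs)
  case Nil
  have "(\<kappa> \<otimes>\<^sub>2 U cs) \<odot> \<beta> = (\<one> I\<^sub>2 \<otimes>\<^sub>2 U cs) \<odot> (\<kappa> \<otimes>\<^sub>2 \<one> I\<^sub>1) \<odot> \<beta>"
    by (simp add: cmp_assoc[symmetric] interchange2 del: ar2.t_left)
  also have "\<dots> = U cs"
    by (simp add: ax12)
  finally show ?case by simp
next
  case (Cons b bs)
  have "U ((b # bs) @ cs) = (\<one> I\<^sub>1 \<otimes>\<^sub>2 (U bs \<otimes>\<^sub>2 U cs)) \<odot> (\<one> I\<^sub>1 \<otimes>\<^sub>2 \<beta>) \<odot> \<beta>"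
    by (simp add: Cons.IH cmp_assoc[symmetric] interchange2)
  also have "\<dots> = ((\<one> I\<^sub>1 \<otimes>\<^sub>2 U bs) \<otimes>\<^sub>2 U cs) \<odot> (\<beta> \<otimes>\<^sub>2 \<one> I\<^sub>1) \<odot> \<beta>"
    by (simp add: ax10 ar2.t_assoc)
  also have "\<dots> = (U (b # bs) \<otimes>\<^sub>2 U cs) \<odot> \<beta>"
    by (simp add: cmp_assoc[symmetric] interchange2 ob2.t_assoc)
  finally show ?case .
qed

lemma U_concat: "U (concat (map h ks)) = A2 ks (\<lambda>k. U (h k)) \<odot> U ks"
proof (induction ks)
  case (Cons k ks)
  have "U (concat (map h (k # ks))) = (U (h k) \<otimes>\<^sub>2 (A2 ks (\<lambda>k. U (h k)) \<odot> U ks)) \<odot> \<beta>"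
    by (simp add: U_append Cons.IH)
  also have "\<dots> = A2 (k # ks) (\<lambda>k. U (h k)) \<odot> U (k # ks)"
    by (simp add: cmp_assoc[symmetric] interchange2)
  finally show ?case .
qed simp

text \<open>The coherence arrow of the lax monoidal functor \<open>\<otimes>\<^sub>2\<^sup>q\<close> for the rows indexed by \<open>as\<close>; \<open>bs\<close>
  indexes the \<open>q\<close> columns. Grouping rows is coherence for lax monoidal functors; grouping columns uses
  axioms (7)-(12).\<close>

primrec K :: "'i list \<Rightarrow> 'j list \<Rightarrow> ('i \<Rightarrow> 'j \<Rightarrow> 'o) \<Rightarrow> 'a" where
  "K [] bs A = U bs"
| "K (a # as) bs A = J bs (A a) (\<lambda>b. T1 as (\<lambda>a. A a b)) \<odot> (\<one> (T2 bs (A a)) \<otimes>\<^sub>1 K as bs A)"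

lemma K_type [simp]:
  assumes "\<And>a b. A a b \<in> Ob M"
  shows "K as bs A \<in> Ar M" "dm M (K as bs A) = T1 as (\<lambda>a. T2 bs (A a))"
    "cd M (K as bs A) = T2 bs (\<lambda>b. T1 as (\<lambda>a. A a b))"
  using assms by (induction "as") simp_all

lemma K_nat:
  assumes [simp]: "\<And>a b. f a b \<in> Ar M"
  shows "K as bs (\<lambda>a b. cd M (f a b)) \<odot> A1 as (\<lambda>a. A2 bs (f a))
    = A2 bs (\<lambda>b. A1 as (\<lambda>a. f a b)) \<odot> K as bs (\<lambda>a b. dm M (f a b))"
proof (induction "as")
  case (Cons a as)
  let ?F = "\<lambda>a b. dm M (f a b)" and ?F' = "\<lambda>a b. cd M (f a b)"
  let ?r = "\<lambda>b. T1 as (\<lambda>a. ?F a b)" and ?r' = "\<lambda>b. T1 as (\<lambda>a. ?F' a b)"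
  have "K (a # as) bs ?F' \<odot> A1 (a # as) (\<lambda>a. A2 bs (f a))
    = J bs (?F' a) ?r' \<odot> (A2 bs (f a) \<otimes>\<^sub>1 (K as bs ?F' \<odot> A1 as (\<lambda>a. A2 bs (f a))))"
    by (simp add: cmp_assoc interchange1)
  also have "\<dots> = (J bs (?F' a) ?r' \<odot> (A2 bs (f a) \<otimes>\<^sub>1 A2 bs (\<lambda>b. A1 as (\<lambda>a. f a b))))
      \<odot> (\<one> (T2 bs (?F a)) \<otimes>\<^sub>1 K as bs ?F)"
    unfolding Cons.IH by (simp add: cmp_assoc interchange1)
  also have "\<dots> = (A2 bs (\<lambda>b. f a b \<otimes>\<^sub>1 A1 as (\<lambda>a. f a b)) \<odot> J bs (?F a) ?r)
      \<odot> (\<one> (T2 bs (?F a)) \<otimes>\<^sub>1 K as bs ?F)"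
    using J_nat[of "f a" "\<lambda>b. A1 as (\<lambda>a. f a b)" bs] by simp
  also have "\<dots> = A2 bs (\<lambda>b. A1 (a # as) (\<lambda>a. f a b)) \<odot> K (a # as) bs ?F"
    by (simp add: cmp_assoc)
  finally show ?case .
qed simp

text \<open>Associativity and left unit of the lax monoidal structure, that is
  \<open>J_assoc\<close> and \<open>J_unit_left\<close>, carried through an induction over the upper
  rows.\<close>

lemma K_append:
  assumes [simp]: "\<And>a b. A a b \<in> Ob M"
  shows "K (as @ cs) bs A
    = J bs (\<lambda>b. T1 as (\<lambda>a. A a b)) (\<lambda>b. T1 cs (\<lambda>a. A a b)) \<odot> (K as bs A \<otimes>\<^sub>1 K cs bs A)"
proof (induction "as")
  case Nil
  let ?c = "\<lambda>b. T1 cs (\<lambda>a. A a b)"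
  have "J bs (\<lambda>_. I\<^sub>1) ?c \<odot> (U bs \<otimes>\<^sub>1 K cs bs A)
    = (J bs (\<lambda>_. I\<^sub>1) ?c \<odot> (U bs \<otimes>\<^sub>1 \<one> (T2 bs ?c))) \<odot> (\<one> I\<^sub>1 \<otimes>\<^sub>1 K cs bs A)"
    by (simp add: cmp_assoc interchange1 del: ar1.t_left)
  also have "\<dots> = K cs bs A"
    by (subst J_unit_left) simp_all
  finally show ?case by simp
next
  case (Cons a as)
  let ?r = "\<lambda>b. T1 as (\<lambda>a. A a b)" and ?c = "\<lambda>b. T1 cs (\<lambda>a. A a b)"
  have "K ((a # as) @ cs) bs A
    = (J bs (A a) (\<lambda>b. ?r b \<boxtimes>\<^sub>1 ?c b) \<odot> (\<one> (T2 bs (A a)) \<otimes>\<^sub>1 J bs ?r ?c))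
      \<odot> (\<one> (T2 bs (A a)) \<otimes>\<^sub>1 (K as bs A \<otimes>\<^sub>1 K cs bs A))"
    by (simp add: Cons.IH ob1.bigop_append cmp_assoc interchange1)
  also have "\<dots> = (J bs (\<lambda>b. A a b \<boxtimes>\<^sub>1 ?r b) ?c \<odot> (J bs (A a) ?r \<otimes>\<^sub>1 \<one> (T2 bs ?c)))
      \<odot> ((\<one> (T2 bs (A a)) \<otimes>\<^sub>1 K as bs A) \<otimes>\<^sub>1 K cs bs A)"
    by (subst J_assoc) (simp_all add: ar1.t_assoc)
  also have "\<dots> = J bs (\<lambda>b. T1 (a # as) (\<lambda>a. A a b)) ?c \<odot> (K (a # as) bs A \<otimes>\<^sub>1 K cs bs A)"
    by (simp add: cmp_assoc interchange1 ob1.t_assoc)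
  finally show ?case .
qed

lemma K_concat_rows:
  assumes [simp]: "\<And>a b. A a b \<in> Ob M"
  shows "K (concat (map h ks)) bs A
    = K ks bs (\<lambda>k b. T1 (h k) (\<lambda>a. A a b)) \<odot> A1 ks (\<lambda>k. K (h k) bs A)"
proof (induction ks)
  case (Cons k ks)
  have "K (concat (map h (k # ks))) bs A
    = J bs (\<lambda>b. T1 (h k) (\<lambda>a. A a b)) (\<lambda>b. T1 ks (\<lambda>k. T1 (h k) (\<lambda>a. A a b)))
      \<odot> (K (h k) bs A \<otimes>\<^sub>1 (K ks bs (\<lambda>k b. T1 (h k) (\<lambda>a. A a b)) \<odot> A1 ks (\<lambda>k. K (h k) bs A)))"
    by (simp add: K_append Cons.IH ob1.bigop_concat)
  also have "\<dots> = K (k # ks) bs (\<lambda>k b. T1 (h k) (\<lambda>a. A a b)) \<odot> A1 (k # ks) (\<lambda>k. K (h k) bs A)"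
    by (simp add: cmp_assoc interchange1)
  finally show ?case .
qed simp

lemma K_concat_cols:
  assumes [simp]: "\<And>a b. A a b \<in> Ob M"
  shows "K as (concat (map h ks)) A
    = A2 ks (\<lambda>k. K as (h k) A) \<odot> K as ks (\<lambda>a k. T2 (h k) (A a))"
proof (induction "as")
  case Nil
  show ?case by (simp add: U_concat)
next
  case (Cons a as)
  let ?r = "\<lambda>b. T1 as (\<lambda>a. A a b)" and ?B = "\<lambda>a k. T2 (h k) (A a)"
  let ?Js = "A2 ks (\<lambda>k. J (h k) (A a) ?r)" and ?Ks = "A2 ks (\<lambda>k. K as (h k) A)"
  \<comment> \<open>Naturality of \<open>J\<close> at the interchange arrows of the lower rows moves
    them past the \<open>J\<close> of the top row; the factors belonging to one group of columns can
    then be merged by \<open>A2_cmp\<close>.\<close>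
  have N: "J ks (?B a) (\<lambda>k. T2 (h k) ?r) \<odot> (\<one> (T2 ks (?B a)) \<otimes>\<^sub>1 ?Ks)
     = A2 ks (\<lambda>k. \<one> (?B a k) \<otimes>\<^sub>1 K as (h k) A) \<odot> J ks (?B a) (\<lambda>k. T1 as (\<lambda>a. ?B a k))"
    using J_nat[of "\<lambda>k. \<one> (?B a k)" "\<lambda>k. K as (h k) A" ks] by simp
  have "K (a # as) (concat (map h ks)) A
    = ?Js \<odot> (J ks (?B a) (\<lambda>k. T2 (h k) ?r) \<odot> (\<one> (T2 ks (?B a)) \<otimes>\<^sub>1 ?Ks)) \<odot> (\<one> (T2 ks (?B a)) \<otimes>\<^sub>1 K as ks ?B)"
    by (simp add: Cons.IH J_concat cmp_assoc interchange1 ob2.bigop_concat)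
  also have "\<dots> = (?Js \<odot> A2 ks (\<lambda>k. \<one> (?B a k) \<otimes>\<^sub>1 K as (h k) A)) \<odot> K (a # as) ks ?B"
    unfolding N by (simp add: cmp_assoc)
  also have "\<dots> = A2 ks (\<lambda>k. K (a # as) (h k) A) \<odot> K (a # as) ks ?B"
    by (subst A2_cmp) simp_all
  finally show ?case .
qed

text \<open>Together with \<open>K_single_col\<close> this explains the identity coordinates of
  \<chi>. Here the right unit law of \<open>J\<close> is responsible.\<close>

lemma K_single_row [simp]:
  assumes [simp]: "\<And>a b. A a b \<in> Ob M"
  shows "K [a] bs A = \<one> (T2 bs (A a))"
  using J_unit_right[of "A a" bs] by simp

text \<open>For one column, \<open>J\<close> is an \<iota> followed by \<tau> in its second factor,
  trivial by \<open>ax8\<close>, and \<open>U\<close> is \<beta> followed by \<kappa>, trivial by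
  \<open>ax11\<close>.\<close>

lemma K_single_col [simp]:
  assumes [simp]: "\<And>a b. A a b \<in> Ob M"
  shows "K as [b] A = \<one> (T1 as (\<lambda>a. A a b))"
  by (induction "as") (simp_all add: ax8 ax11)

lemma K_small:
  assumes [simp]: "\<And>a b. A a b \<in> Ob M"
  shows "K [] [] A = \<kappa>" "K [a, a'] [] A = \<tau>" "K [] [b, b'] A = \<beta>"
    "K [a, a'] [b, b'] A = \<iota> (A a b) (A a b') (A a' b) (A a' b')"
proof -
  show "K [] [] A = \<kappa>" by simp
  show "K [a, a'] [] A = \<tau>" using K_single_row[of A a' "[]"] by simp
  show "K [] [b, b'] A = \<beta>" by (simp add: ax11)
  show "K [a, a'] [b, b'] A = \<iota> (A a b) (A a b') (A a' b) (A a' b')"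
    \<comment> \<open>The second row contributes an identity. Of the two \<iota>'s in
      \<open>J\<close>, the inner one involves the unit of the second tensor and cancels against
      \<tau> by \<open>ax8\<close>.\<close>
    using K_single_row[of A a' "[b, b']"] by (simp add: ax8)
qed

end

section \<open>The transformations on infinite matrices\<close>

text \<open>Consecutive intervals of a monotone map, some possibly empty, tile the large interval.
  This turns statements about grouping a list into statements about composing maps.\<close>

lemma concat_upt:
  assumes "mono (\<phi> :: nat \<Rightarrow> nat)"
  shows "concat (map (\<lambda>k. [\<phi> k..<\<phi> (Suc k)]) [a..<b]) = [\<phi> a..<\<phi> b]"
proof (induction b)
  case (Suc b)
  have "a \<le> b \<Longrightarrow> [\<phi> a..<\<phi> b] @ [\<phi> b..<\<phi> (Suc b)] = [\<phi> a..<\<phi> (Suc b)]"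
    using upt_add_eq_append[of "\<phi> a" "\<phi> b" "\<phi> (Suc b) - \<phi> b"] monoD[OF assms, of a b]
      monoD[OF assms, of b "Suc b"] by simp
  moreover have "\<not> a \<le> b \<Longrightarrow> \<phi> (Suc b) \<le> \<phi> a"
    using monoD[OF assms, of "Suc b" a] by simp
  ultimately show ?case using Suc by simp
next
  case 0
  show ?case using monoD[OF assms, of 0 a] by simp
qed

text \<open>The source of functoriality of the bar construction: multiplying in two stages equals
  multiplying over the tiled interval.\<close>

lemma (in monoid_on) bigop_upt:
  assumes "mono \<phi>" "\<And>i. F i \<in> R"
  shows "bigop t u [a..<b] (\<lambda>k. bigop t u [\<phi> k..<\<phi> (Suc k)] F) = bigop t u [\<phi> a..<\<phi> b] F"
  using bigop_concat[of F "\<lambda>k. [\<phi> k..<\<phi> (Suc k)]" "[a..<b]"] assms by (simp add: concat_upt)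

text \<open>The monotone map opposite to a basic arrow, extended to all of \<open>nat\<close>; it no longer depends on
  the dimension.\<close>

fun basic_map :: "basic \<Rightarrow> nat \<Rightarrow> nat" where
  "basic_map (D n i) x = (if x < i then x else x + 1)"
| "basic_map (S n i) x = (if x \<le> i then x else x - 1)"

text \<open>A word is a composite in the opposite category, so its leading letter acts first on
  points and its last letter acts last.\<close>

definition word_map :: "basic list \<Rightarrow> nat \<Rightarrow> nat" where
  "word_map w = foldr (\<lambda>b \<phi>. \<phi> \<circ> basic_map b) w id"

lemma word_map_simps [simp]:
  "word_map [] = id" "word_map (b # w) = word_map w \<circ> basic_map b"
  by (simp_all add: word_map_def)

lemma mono_basic_map [simp]: "mono (basic_map b)"
  by (cases b) (auto intro!: monoI)

lemma mono_word_map [simp]: "mono (word_map w)"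
proof (induction w)
  case (Cons b w)
  then show ?case
    by (auto intro!: monoI dest: monoD[OF mono_basic_map, of _ _ b] monoD)
qed (simp add: mono_def)

lemma word_map_append: "word_map (v @ w) = word_map w \<circ> word_map v"
  by (induction v) (simp_all add: comp_assoc)

lemma col_append [simp]:
  "col1 (\<Theta> @ \<Theta>') = col1 \<Theta> @ col1 \<Theta>'" "col2 (\<Theta> @ \<Theta>') = col2 \<Theta> @ col2 \<Theta>'"
  by (induction \<Theta> rule: col1.induct) simp_all

lemma col_map [simp]:
  "col1 (map Col1 w) = w" "col2 (map Col1 w) = []" "col1 (map Col2 w) = []" "col2 (map Col2 w) = w"
  by (induction w) simp_all

context two_fold_strict_monoidal
begin

text \<open>Tuples with \<open>n\<close> blocks of length \<open>m\<close> are treated as infinite matrices, of which only the upper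
  left \<open>n \<times> m\<close> corner is relevant.\<close>

definition F1 :: "(nat \<Rightarrow> nat) \<Rightarrow> (nat \<Rightarrow> nat \<Rightarrow> 'o) \<Rightarrow> nat \<Rightarrow> nat \<Rightarrow> 'o" where
  "F1 \<phi> A = (\<lambda>i j. T1 [\<phi> i..<\<phi> (Suc i)] (\<lambda>a. A a j))"

definition F2 :: "(nat \<Rightarrow> nat) \<Rightarrow> (nat \<Rightarrow> nat \<Rightarrow> 'o) \<Rightarrow> nat \<Rightarrow> nat \<Rightarrow> 'o" where
  "F2 \<psi> A = (\<lambda>i j. T2 [\<psi> j..<\<psi> (Suc j)] (A i))"

definition G1 :: "(nat \<Rightarrow> nat) \<Rightarrow> (nat \<Rightarrow> nat \<Rightarrow> 'a) \<Rightarrow> nat \<Rightarrow> nat \<Rightarrow> 'a" where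
  "G1 \<phi> f = (\<lambda>i j. A1 [\<phi> i..<\<phi> (Suc i)] (\<lambda>a. f a j))"

definition G2 :: "(nat \<Rightarrow> nat) \<Rightarrow> (nat \<Rightarrow> nat \<Rightarrow> 'a) \<Rightarrow> nat \<Rightarrow> nat \<Rightarrow> 'a" where
  "G2 \<psi> f = (\<lambda>i j. A2 [\<psi> j..<\<psi> (Suc j)] (f i))"

text \<open>The extension of \<open>\<chi>\<close> to arbitrary monotone maps.\<close>

definition X :: "(nat \<Rightarrow> nat) \<Rightarrow> (nat \<Rightarrow> nat) \<Rightarrow> (nat \<Rightarrow> nat \<Rightarrow> 'o) \<Rightarrow> nat \<Rightarrow> nat \<Rightarrow> 'a" where
  "X \<phi> \<psi> A = (\<lambda>i j. K [\<phi> i..<\<phi> (Suc i)] [\<psi> j..<\<psi> (Suc j)] A)"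

definition mcmp :: "(nat \<Rightarrow> nat \<Rightarrow> 'a) \<Rightarrow> (nat \<Rightarrow> nat \<Rightarrow> 'a) \<Rightarrow> nat \<Rightarrow> nat \<Rightarrow> 'a"  (infixr "\<bullet>" 55) where
  "g \<bullet> f = (\<lambda>i j. g i j \<odot> f i j)"

definition mid :: "(nat \<Rightarrow> nat \<Rightarrow> 'o) \<Rightarrow> nat \<Rightarrow> nat \<Rightarrow> 'a" where
  "mid A = (\<lambda>i j. \<one> (A i j))"

definition mob :: "(nat \<Rightarrow> nat \<Rightarrow> 'o) \<Rightarrow> bool" where
  "mob A \<longleftrightarrow> (\<forall>i j. A i j \<in> Ob M)"

definition mhom :: "(nat \<Rightarrow> nat \<Rightarrow> 'a) \<Rightarrow> (nat \<Rightarrow> nat \<Rightarrow> 'o) \<Rightarrow> (nat \<Rightarrow> nat \<Rightarrow> 'o) \<Rightarrow> bool" where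
  "mhom f A B \<longleftrightarrow> (\<forall>i j. f i j \<in> Ar M \<and> dm M (f i j) = A i j \<and> cd M (f i j) = B i j)"

lemma mobD: "mob A \<Longrightarrow> A i j \<in> Ob M"
  by (simp add: mob_def)

lemma mhomD:
  assumes "mhom f A B"
  shows "f i j \<in> Ar M" "dm M (f i j) = A i j" "cd M (f i j) = B i j" "A i j \<in> Ob M" "B i j \<in> Ob M"
proof -
  show *: "f i j \<in> Ar M" "dm M (f i j) = A i j" "cd M (f i j) = B i j"
    using assms by (simp_all add: mhom_def)
  show "A i j \<in> Ob M" "B i j \<in> Ob M" using dm_in[OF *(1)] cd_in[OF *(1)] * by simp_all
qed

lemma mhom_mob:
  assumes "mhom f A B"
  shows "mob A" "mob B"
  using mhomD[OF assms] by (simp_all add: mob_def)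

lemma mob_F [simp]:
  assumes "mob A"
  shows "mob (F1 \<phi> A)" "mob (F2 \<phi> A)"
  using assms by (auto simp: mob_def F1_def F2_def)

lemma mhom_mid [simp]: "mob A \<Longrightarrow> mhom (mid A) A A"
  by (simp add: mhom_def mob_def mid_def)

lemma mhom_mcmp [intro]: "\<lbrakk>mhom f A B; mhom g B C\<rbrakk> \<Longrightarrow> mhom (g \<bullet> f) A C"
  by (simp add: mhom_def mcmp_def)

lemma mhom_G1 [intro]: "mhom f A B \<Longrightarrow> mhom (G1 \<phi> f) (F1 \<phi> A) (F1 \<phi> B)"
  by (simp add: mhom_def G1_def F1_def)

lemma mhom_G2 [intro]: "mhom f A B \<Longrightarrow> mhom (G2 \<phi> f) (F2 \<phi> A) (F2 \<phi> B)"
  by (simp add: mhom_def G2_def F2_def)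

lemma mhom_X [intro]: "mob A \<Longrightarrow> mhom (X \<phi> \<psi> A) (F1 \<phi> (F2 \<psi> A)) (F2 \<psi> (F1 \<phi> A))"
  by (simp add: mhom_def mob_def X_def F1_def F2_def)

lemma mcmp_assoc: "\<lbrakk>mhom f A B; mhom g B A'; mhom h A' B'\<rbrakk> \<Longrightarrow> (h \<bullet> g) \<bullet> f = h \<bullet> (g \<bullet> f)"
  by (intro ext) (simp add: mcmp_def cmp_assoc mhomD)

lemma G1_mcmp: "\<lbrakk>mhom f A B; mhom g B C\<rbrakk> \<Longrightarrow> G1 \<phi> (g \<bullet> f) = G1 \<phi> g \<bullet> G1 \<phi> f"
  by (intro ext) (simp add: mcmp_def G1_def A1_cmp mhomD)

lemma G2_mcmp: "\<lbrakk>mhom f A B; mhom g B C\<rbrakk> \<Longrightarrow> G2 \<phi> (g \<bullet> f) = G2 \<phi> g \<bullet> G2 \<phi> f"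
  by (intro ext) (simp add: mcmp_def G2_def A2_cmp mhomD)

lemma G_mid:
  assumes "mob A"
  shows "G1 \<phi> (mid A) = mid (F1 \<phi> A)" "G2 \<phi> (mid A) = mid (F2 \<phi> A)"
  using mobD[OF assms] by (auto intro!: ext simp: mid_def G1_def G2_def F1_def F2_def)

lemma F_comp:
  assumes "mob A" "mono \<phi>"
  shows "F1 \<psi> (F1 \<phi> A) = F1 (\<phi> \<circ> \<psi>) A" "F2 \<psi> (F2 \<phi> A) = F2 (\<phi> \<circ> \<psi>) A"
  using mobD[OF assms(1)] assms(2)
  by (auto intro!: ext simp: F1_def F2_def ob1.bigop_upt ob2.bigop_upt)

lemma G_comp:
  assumes "mhom f A B" "mono \<phi>"
  shows "G1 \<psi> (G1 \<phi> f) = G1 (\<phi> \<circ> \<psi>) f" "G2 \<psi> (G2 \<phi> f) = G2 (\<phi> \<circ> \<psi>) f"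
  using mhomD[OF assms(1)] assms(2)
  by (auto intro!: ext simp: G1_def G2_def ar1.bigop_upt ar2.bigop_upt)

lemma F_id [simp]: "mob A \<Longrightarrow> F1 id A = A" "mob A \<Longrightarrow> F2 id A = A"
  by (intro ext, simp add: F1_def F2_def mob_def)+

lemma G_id [simp]: "mhom f A B \<Longrightarrow> G1 id f = f" "mhom f A B \<Longrightarrow> G2 id f = f"
  by (intro ext, simp add: G1_def G2_def mhomD)+

text \<open>The intervals of \<open>id\<close> are singletons, so \<open>K_single_row\<close> and
  \<open>K_single_col\<close> apply.\<close>

lemma X_id [simp]:
  assumes "mob A"
  shows "X id \<psi> A = mid (F2 \<psi> A)" "X \<phi> id A = mid (F1 \<phi> A)"
  by (intro ext, simp add: X_def mid_def F1_def F2_def mobD[OF assms] del: K.simps)+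

text \<open>The intervals of \<phi> tile each interval of the composite, so this is grouping of rows
  in \<open>K\<close>. The cell for \<phi> comes earlier because \<phi> belongs to the arrow applied
  earlier.\<close>

lemma X_comp_rows:
  assumes "mob A" "mono \<phi>"
  shows "X (\<phi> \<circ> \<phi>') \<psi> A = X \<phi>' \<psi> (F1 \<phi> A) \<bullet> G1 \<phi>' (X \<phi> \<psi> A)"
proof (intro ext)
  fix i j
  show "X (\<phi> \<circ> \<phi>') \<psi> A i j = (X \<phi>' \<psi> (F1 \<phi> A) \<bullet> G1 \<phi>' (X \<phi> \<psi> A)) i j"
    using K_concat_rows[of A "\<lambda>k. [\<phi> k..<\<phi> (Suc k)]" "[\<phi>' i..<\<phi>' (Suc i)]"] assms
    by (simp add: X_def mcmp_def F1_def G1_def concat_upt mobD)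
qed

lemma X_comp_cols:
  assumes "mob A" "mono \<psi>"
  shows "X \<phi> (\<psi> \<circ> \<psi>') A = G2 \<psi>' (X \<phi> \<psi> A) \<bullet> X \<phi> \<psi>' (F2 \<psi> A)"
proof (intro ext)
  fix i j
  show "X \<phi> (\<psi> \<circ> \<psi>') A i j = (G2 \<psi>' (X \<phi> \<psi> A) \<bullet> X \<phi> \<psi>' (F2 \<psi> A)) i j"
    using K_concat_cols[of A _ "\<lambda>k. [\<psi> k..<\<psi> (Suc k)]" "[\<psi>' j..<\<psi>' (Suc j)]"] assms
    by (simp add: X_def mcmp_def F2_def G2_def concat_upt mobD)
qed

lemma X_nat:
  assumes "mhom f A B"
  shows "X \<phi> \<psi> B \<bullet> G1 \<phi> (G2 \<psi> f) = G2 \<psi> (G1 \<phi> f) \<bullet> X \<phi> \<psi> A"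
proof (intro ext)
  fix i j
  show "(X \<phi> \<psi> B \<bullet> G1 \<phi> (G2 \<psi> f)) i j = (G2 \<psi> (G1 \<phi> f) \<bullet> X \<phi> \<psi> A) i j"
    using K_nat[of f "[\<phi> i..<\<phi> (Suc i)]" "[\<psi> j..<\<psi> (Suc j)]"] mhomD[OF assms]
    by (simp add: X_def mcmp_def G1_def G2_def)
qed

text \<open>Splitting the composite indices by \<open>X_comp_rows\<close> on the left and
  \<open>X_comp_cols\<close> on the right leaves three cells on each side. The outermost, built from
  \<open>?y\<close>, is common. What remains compares \<open>?x\<close> after \<open>?s\<close> with
  \<open>?z\<close> after \<open>?x\<close>, suitably whiskered, and this is \<open>X_nat\<close> at
  \<open>?x\<close>.\<close>

lemma lax_coherence:
  assumes A: "mob A" and mono: "mono \<phi>\<^sub>1" "mono \<phi>\<^sub>2" "mono \<psi>\<^sub>1" "mono \<psi>\<^sub>2"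
  shows "G2 (\<psi>\<^sub>2 \<circ> \<psi>\<^sub>3) (X (\<phi>\<^sub>2 \<circ> \<phi>\<^sub>3) \<psi>\<^sub>1 (F1 \<phi>\<^sub>1 A))
      \<bullet> G2 \<psi>\<^sub>3 (X \<phi>\<^sub>3 \<psi>\<^sub>2 (F1 \<phi>\<^sub>2 (F2 \<psi>\<^sub>1 (F1 \<phi>\<^sub>1 A))))
    = G2 \<psi>\<^sub>3 (X \<phi>\<^sub>3 (\<psi>\<^sub>1 \<circ> \<psi>\<^sub>2) (F1 (\<phi>\<^sub>1 \<circ> \<phi>\<^sub>2) A))
      \<bullet> G2 \<psi>\<^sub>3 (G1 \<phi>\<^sub>3 (G2 \<psi>\<^sub>2 (X \<phi>\<^sub>2 \<psi>\<^sub>1 (F1 \<phi>\<^sub>1 A))))"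
proof -
  define B where "B = F1 \<phi>\<^sub>1 A"
  have B: "mob B" using A by (simp add: B_def)
  let ?s = "X \<phi>\<^sub>3 \<psi>\<^sub>2 (F1 \<phi>\<^sub>2 (F2 \<psi>\<^sub>1 B))" and ?x = "X \<phi>\<^sub>2 \<psi>\<^sub>1 B"
    and ?y = "X \<phi>\<^sub>3 \<psi>\<^sub>1 (F1 \<phi>\<^sub>2 B)" and ?z = "X \<phi>\<^sub>3 \<psi>\<^sub>2 (F2 \<psi>\<^sub>1 (F1 \<phi>\<^sub>2 B))"
  have x: "mhom ?x (F1 \<phi>\<^sub>2 (F2 \<psi>\<^sub>1 B)) (F2 \<psi>\<^sub>1 (F1 \<phi>\<^sub>2 B))" using B by (rule mhom_X)
  have y: "mhom ?y (F1 \<phi>\<^sub>3 (F2 \<psi>\<^sub>1 (F1 \<phi>\<^sub>2 B))) (F2 \<psi>\<^sub>1 (F1 \<phi>\<^sub>3 (F1 \<phi>\<^sub>2 B)))"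
    using B by (simp add: mhom_X)
  have z: "mhom ?z (F1 \<phi>\<^sub>3 (F2 \<psi>\<^sub>2 (F2 \<psi>\<^sub>1 (F1 \<phi>\<^sub>2 B)))) (F2 \<psi>\<^sub>2 (F1 \<phi>\<^sub>3 (F2 \<psi>\<^sub>1 (F1 \<phi>\<^sub>2 B))))"
    using B by (simp add: mhom_X)
  have s: "mhom ?s (F1 \<phi>\<^sub>3 (F2 \<psi>\<^sub>2 (F1 \<phi>\<^sub>2 (F2 \<psi>\<^sub>1 B)))) (F2 \<psi>\<^sub>2 (F1 \<phi>\<^sub>3 (F1 \<phi>\<^sub>2 (F2 \<psi>\<^sub>1 B))))"
    using B by (simp add: mhom_X)
  note gx = mhom_G1[OF x, of \<phi>\<^sub>3]
  have "G2 (\<psi>\<^sub>2 \<circ> \<psi>\<^sub>3) (X (\<phi>\<^sub>2 \<circ> \<phi>\<^sub>3) \<psi>\<^sub>1 B) \<bullet> G2 \<psi>\<^sub>3 ?s = G2 \<psi>\<^sub>3 (G2 \<psi>\<^sub>2 (?y \<bullet> G1 \<phi>\<^sub>3 ?x) \<bullet> ?s)"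
    by (subst G2_mcmp[OF s mhom_G2[OF mhom_mcmp[OF gx y]]])
      (simp add: X_comp_rows[OF B mono(2)] G_comp(2)[OF mhom_mcmp[OF gx y] mono(4)])
  also have "G2 \<psi>\<^sub>2 (?y \<bullet> G1 \<phi>\<^sub>3 ?x) \<bullet> ?s = G2 \<psi>\<^sub>2 ?y \<bullet> (G2 \<psi>\<^sub>2 (G1 \<phi>\<^sub>3 ?x) \<bullet> ?s)"
    by (simp add: G2_mcmp[OF gx y] mcmp_assoc[OF s mhom_G2[OF gx] mhom_G2[OF y]])
  also have "\<dots> = (G2 \<psi>\<^sub>2 ?y \<bullet> ?z) \<bullet> G1 \<phi>\<^sub>3 (G2 \<psi>\<^sub>2 ?x)"
    by (simp add: X_nat[OF x, symmetric] mcmp_assoc[OF mhom_G1[OF mhom_G2[OF x]] z mhom_G2[OF y]])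
  also have "G2 \<psi>\<^sub>2 ?y \<bullet> ?z = X \<phi>\<^sub>3 (\<psi>\<^sub>1 \<circ> \<psi>\<^sub>2) (F1 \<phi>\<^sub>2 B)"
    using B mono(3) by (simp add: X_comp_cols)
  also have "F1 \<phi>\<^sub>2 B = F1 (\<phi>\<^sub>1 \<circ> \<phi>\<^sub>2) A"
    using A mono(1) by (simp add: B_def F_comp)
  also have "G2 \<psi>\<^sub>3 (X \<phi>\<^sub>3 (\<psi>\<^sub>1 \<circ> \<psi>\<^sub>2) (F1 (\<phi>\<^sub>1 \<circ> \<phi>\<^sub>2) A) \<bullet> G1 \<phi>\<^sub>3 (G2 \<psi>\<^sub>2 ?x))
    = G2 \<psi>\<^sub>3 (X \<phi>\<^sub>3 (\<psi>\<^sub>1 \<circ> \<psi>\<^sub>2) (F1 (\<phi>\<^sub>1 \<circ> \<phi>\<^sub>2) A)) \<bullet> G2 \<psi>\<^sub>3 (G1 \<phi>\<^sub>3 (G2 \<psi>\<^sub>2 ?x))"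
  proof (rule G2_mcmp[OF mhom_G1[OF mhom_G2[OF x]]])
    show "mhom (X \<phi>\<^sub>3 (\<psi>\<^sub>1 \<circ> \<psi>\<^sub>2) (F1 (\<phi>\<^sub>1 \<circ> \<phi>\<^sub>2) A)) (F1 \<phi>\<^sub>3 (F2 \<psi>\<^sub>2 (F2 \<psi>\<^sub>1 (F1 \<phi>\<^sub>2 B))))
      (F2 (\<psi>\<^sub>1 \<circ> \<psi>\<^sub>2) (F1 \<phi>\<^sub>3 (F1 (\<phi>\<^sub>1 \<circ> \<phi>\<^sub>2) A)))"
      using mhom_X[of "F1 (\<phi>\<^sub>1 \<circ> \<phi>\<^sub>2) A" \<phi>\<^sub>3 "\<psi>\<^sub>1 \<circ> \<psi>\<^sub>2"] A B mono by (simp add: F_comp B_def)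
  qed
  finally show ?thesis unfolding B_def .
qed

section \<open>Shuffles acting on infinite matrices\<close>

fun shuffle_ob :: "member list \<Rightarrow> (nat \<Rightarrow> nat \<Rightarrow> 'o) \<Rightarrow> nat \<Rightarrow> nat \<Rightarrow> 'o" where
  "shuffle_ob [] A = A"
| "shuffle_ob (Col1 b # \<Theta>) A = F1 (basic_map b) (shuffle_ob \<Theta> A)"
| "shuffle_ob (Col2 b # \<Theta>) A = F2 (basic_map b) (shuffle_ob \<Theta> A)"

fun shuffle_ar :: "member list \<Rightarrow> (nat \<Rightarrow> nat \<Rightarrow> 'a) \<Rightarrow> nat \<Rightarrow> nat \<Rightarrow> 'a" where
  "shuffle_ar [] A = A"
| "shuffle_ar (Col1 b # \<Theta>) A = G1 (basic_map b) (shuffle_ar \<Theta> A)"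
| "shuffle_ar (Col2 b # \<Theta>) A = G2 (basic_map b) (shuffle_ar \<Theta> A)"

text \<open>A description of \<open>\<phi>\<^sub>\<Theta>\<close> that does not refer to normalizing paths.\<close>

fun psi :: "member list \<Rightarrow> (nat \<Rightarrow> nat \<Rightarrow> 'o) \<Rightarrow> nat \<Rightarrow> nat \<Rightarrow> 'a" where
  "psi [] A = mid A"
| "psi (Col1 b # \<Theta>) A =
     X (basic_map b) (word_map (col2 \<Theta>)) (F1 (word_map (col1 \<Theta>)) A) \<bullet> G1 (basic_map b) (psi \<Theta> A)"
| "psi (Col2 b # \<Theta>) A = G2 (basic_map b) (psi \<Theta> A)"

lemma mob_shuffle_ob [simp]: "mob A \<Longrightarrow> mob (shuffle_ob \<Theta> A)"
  by (induction \<Theta> A rule: shuffle_ob.induct) simp_all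

lemma mhom_shuffle_ar: "mhom f A B \<Longrightarrow> mhom (shuffle_ar \<Theta> f) (shuffle_ob \<Theta> A) (shuffle_ob \<Theta> B)"
  by (induction \<Theta> f rule: shuffle_ar.induct) (simp_all add: mhom_G1 mhom_G2)

lemma shuffle_ob_append: "shuffle_ob (\<Theta> @ \<Theta>') A = shuffle_ob \<Theta> (shuffle_ob \<Theta>' A)"
  by (induction \<Theta> A rule: shuffle_ob.induct) simp_all

lemma mhom_psi:
  assumes A: "mob A"
  shows "mhom (psi \<Theta> A) (shuffle_ob \<Theta> A) (F2 (word_map (col2 \<Theta>)) (F1 (word_map (col1 \<Theta>)) A))"
proof (induction \<Theta> rule: col1.induct)
  case (2 b \<Theta>)
  have "mhom (X (basic_map b) (word_map (col2 \<Theta>)) (F1 (word_map (col1 \<Theta>)) A))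
    (F1 (basic_map b) (F2 (word_map (col2 \<Theta>)) (F1 (word_map (col1 \<Theta>)) A)))
    (F2 (word_map (col2 \<Theta>)) (F1 (word_map (col1 \<Theta>) \<circ> basic_map b) A))"
    using mhom_X[of "F1 (word_map (col1 \<Theta>)) A"] A by (simp add: F_comp)
  with mhom_G1[OF 2] show ?case
    unfolding psi.simps shuffle_ob.simps col1.simps col2.simps word_map_simps by (rule mhom_mcmp)
next
  case (3 b \<Theta>)
  have "mob (F1 (word_map (col1 \<Theta>)) A)" using A by simp
  from F_comp(2)[OF this mono_word_map] show ?case
    using mhom_G2[OF 3, of "basic_map b"]
    unfolding psi.simps shuffle_ob.simps col1.simps col2.simps word_map_simps by metis
next
  case 1
  show "mhom (psi [] A) (shuffle_ob [] A) (F2 (word_map (col2 [])) (F1 (word_map (col1 [])) A))"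
    by (simp add: A)
qed

text \<open>In \<open>psi\<close> a letter of colour 1 crosses all colour 2 letters to its right in
  a single cell. With \<open>g\<close> among them, \<open>X_comp_cols\<close> splits this cell into
  the crossing of \<open>g\<close> and the crossing of the rest; \<open>X_nat\<close> then carries
  the crossing of \<open>g\<close> past \<open>psi \<Lambda> A\<close>. Letters of \<Pi> only
  whisker the result.\<close>

lemma psi_step:
  assumes A: "mob A"
  shows "psi (\<Pi> @ Col1 f # Col2 g # \<Lambda>) A
    = psi (\<Pi> @ Col2 g # Col1 f # \<Lambda>) A \<bullet> shuffle_ar \<Pi> (X (basic_map f) (basic_map g) (shuffle_ob \<Lambda> A))"
proof (induction \<Pi> rule: col1.induct)
  case 1
  let ?\<phi> = "basic_map f" and ?\<psi> = "basic_map g"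
  let ?B = "F1 (word_map (col1 \<Lambda>)) A" and ?\<gamma> = "word_map (col2 \<Lambda>)"
  let ?x = "X ?\<phi> ?\<gamma> ?B" and ?y = "X ?\<phi> ?\<psi> (F2 ?\<gamma> ?B)" and ?z = "X ?\<phi> ?\<psi> (shuffle_ob \<Lambda> A)"
  have x: "mhom ?x (F1 ?\<phi> (F2 ?\<gamma> ?B)) (F2 ?\<gamma> (F1 ?\<phi> ?B))" using A by (simp add: mhom_X)
  have y: "mhom ?y (F1 ?\<phi> (F2 ?\<psi> (F2 ?\<gamma> ?B))) (F2 ?\<psi> (F1 ?\<phi> (F2 ?\<gamma> ?B)))"
    using A by (simp add: mhom_X)
  have z: "mhom ?z (F1 ?\<phi> (F2 ?\<psi> (shuffle_ob \<Lambda> A))) (F2 ?\<psi> (F1 ?\<phi> (shuffle_ob \<Lambda> A)))"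
    using A by (simp add: mhom_X)
  note p = mhom_psi[OF A, of \<Lambda>]
  note gp = mhom_G1[OF mhom_G2[OF p]]
  have "psi ([] @ Col1 f # Col2 g # \<Lambda>) A = (G2 ?\<psi> ?x \<bullet> ?y) \<bullet> G1 ?\<phi> (G2 ?\<psi> (psi \<Lambda> A))"
    using A by (simp add: X_comp_cols)
  also have "\<dots> = G2 ?\<psi> ?x \<bullet> (G2 ?\<psi> (G1 ?\<phi> (psi \<Lambda> A)) \<bullet> ?z)"
    by (simp add: mcmp_assoc[OF gp y mhom_G2[OF x]] X_nat[OF p])
  also have "\<dots> = G2 ?\<psi> (?x \<bullet> G1 ?\<phi> (psi \<Lambda> A)) \<bullet> ?z"
    by (simp add: G2_mcmp[OF mhom_G1[OF p] x] mcmp_assoc[OF z mhom_G2[OF mhom_G1[OF p]] mhom_G2[OF x]])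
  finally show ?case by simp
next
  case (2 b \<Pi>)
  let ?l = "\<Pi> @ Col1 f # Col2 g # \<Lambda>" and ?r = "\<Pi> @ Col2 g # Col1 f # \<Lambda>"
  let ?z = "X (basic_map f) (basic_map g) (shuffle_ob \<Lambda> A)"
  have z: "mhom (shuffle_ar \<Pi> ?z) (shuffle_ob ?l A) (shuffle_ob ?r A)"
    using mhom_shuffle_ar[OF mhom_X[of "shuffle_ob \<Lambda> A"]] A by (simp add: shuffle_ob_append)
  note p = mhom_psi[OF A, of ?r]
  have x: "mhom (X (basic_map b) (word_map (col2 ?r)) (F1 (word_map (col1 ?r)) A))
    (F1 (basic_map b) (F2 (word_map (col2 ?r)) (F1 (word_map (col1 ?r)) A)))
    (F2 (word_map (col2 ?r)) (F1 (basic_map b) (F1 (word_map (col1 ?r)) A)))"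
    by (rule mhom_X) (simp add: A)
  show ?case
    using mcmp_assoc[OF mhom_G1[OF z] mhom_G1[OF p] x]
    by (simp add: 2 G1_mcmp[OF z p])
next
  case (3 b \<Pi>)
  let ?l = "\<Pi> @ Col1 f # Col2 g # \<Lambda>" and ?r = "\<Pi> @ Col2 g # Col1 f # \<Lambda>"
  have z: "mhom (shuffle_ar \<Pi> (X (basic_map f) (basic_map g) (shuffle_ob \<Lambda> A))) (shuffle_ob ?l A) (shuffle_ob ?r A)"
    using mhom_shuffle_ar[OF mhom_X[of "shuffle_ob \<Lambda> A"]] A by (simp add: shuffle_ob_append)
  show ?case by (simp add: 3 G2_mcmp[OF z mhom_psi[OF A, of ?r]])
qed

lemma shuffle_ob_map:
  assumes "mob A"
  shows "shuffle_ob (map Col1 w) A = F1 (word_map w) A" "shuffle_ob (map Col2 w) A = F2 (word_map w) A"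
  using assms by (induction w) (simp_all add: F_comp)

lemma psi_Col2: "mob A \<Longrightarrow> psi (map Col2 w @ \<Theta>) A = G2 (word_map w) (psi \<Theta> A)"
proof (induction w)
  case Nil
  then show ?case using G_id(2)[OF mhom_psi] by (simp del: id_apply)
next
  case (Cons b w)
  show "psi (map Col2 (b # w) @ \<Theta>) A = G2 (word_map (b # w)) (psi \<Theta> A)"
    using G_comp(2)[OF mhom_psi[OF Cons.prems, of \<Theta>], of "word_map w"] Cons by simp
qed

text \<open>The assumptions say that \<Theta> behaves like a normal shuffle. Both the empty word and
  a normal block occur as \<Theta>: the former yields triviality of \<open>psi\<close> at normal
  shuffles, the latter the formula for \<omega>. The letters of \<open>w\<close> cross one at a
  time, assembled by \<open>X_comp_rows\<close>.\<close>

lemma psi_Col1: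
  assumes A: "mob A" and \<Theta>: "psi \<Theta> A = mid (shuffle_ob \<Theta> A)"
    "shuffle_ob \<Theta> A = F2 (word_map (col2 \<Theta>)) (F1 (word_map (col1 \<Theta>)) A)"
  shows "psi (map Col1 w @ \<Theta>) A = X (word_map w) (word_map (col2 \<Theta>)) (F1 (word_map (col1 \<Theta>)) A)"
proof (induction w)
  case Nil
  show ?case using A \<Theta> X_id(1)[of "F1 (word_map (col1 \<Theta>)) A"] by (simp del: X_id id_apply)
next
  case (Cons b w)
  have "mob (F1 (word_map (col1 \<Theta>)) A)" using A by simp
  from X_comp_rows[OF this mono_word_map]
  show "psi (map Col1 (b # w) @ \<Theta>) A
    = X (word_map (b # w)) (word_map (col2 \<Theta>)) (F1 (word_map (col1 \<Theta>)) A)"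
    using Cons.IH A by (simp add: word_map_append F_comp)
qed

end

section \<open>Normal forms in the opposite simplicial category\<close>

text \<open>Continuing with slope 1 beyond the target dimension makes \<open>arr_map\<close> strictly (contravariantly)
  functorial into total maps.\<close>

definition arr_map :: "darr \<Rightarrow> nat \<Rightarrow> nat" where
  "arr_map f i = (if i \<le> dtgt f then dvals f ! i else dsrc f + (i - dtgt f))"

lemma delta_op_simps [simp]:
  "Ob delta_op = UNIV" "dm delta_op = dsrc" "cd delta_op = dtgt"
  "dsrc (ident delta_op n) = n" "dtgt (ident delta_op n) = n"
  "dsrc (cmp delta_op g f) = dsrc f" "dtgt (cmp delta_op g f) = dtgt g"
  by (simp_all add: delta_op_def dtgt_def)

lemma delta_op_length: "f \<in> Ar delta_op \<Longrightarrow> length (dvals f) = Suc (dtgt f)"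
  by (cases "dvals f") (auto simp: delta_op_def dtgt_def)

lemma arr_map_bounds:
  assumes f: "f \<in> Ar delta_op"
  shows "i \<le> dtgt f \<Longrightarrow> arr_map f i \<le> dsrc f" and "dtgt f < i \<Longrightarrow> dsrc f < arr_map f i"
proof -
  assume "i \<le> dtgt f"
  then have "dvals f ! i \<in> set (dvals f)" using delta_op_length[OF f] by simp
  with f \<open>i \<le> dtgt f\<close> show "arr_map f i \<le> dsrc f" by (auto simp: delta_op_def arr_map_def)
qed (simp add: arr_map_def)

lemma mono_arr_map [simp]:
  assumes f: "f \<in> Ar delta_op"
  shows "mono (arr_map f)"
proof (rule monoI)
  fix i j :: nat assume "i \<le> j"
  consider "j \<le> dtgt f" | "i \<le> dtgt f" "dtgt f < j" | "dtgt f < i" by linarith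
  then show "arr_map f i \<le> arr_map f j"
  proof cases
    case 1
    have "sorted (dvals f)" using f by (simp add: delta_op_def)
    then show ?thesis
      using 1 \<open>i \<le> j\<close> delta_op_length[OF f] by (simp add: arr_map_def sorted_nth_mono)
  next
    case 2
    then show ?thesis using arr_map_bounds[OF f, of i] arr_map_bounds[OF f, of j] by simp
  next
    case 3
    then show ?thesis using \<open>i \<le> j\<close> by (simp add: arr_map_def)
  qed
qed

lemma arr_map_ident: "arr_map (ident delta_op n) = id"
  by (auto intro!: ext simp: arr_map_def simp del: upt_Suc) (simp add: delta_op_def del: upt_Suc)

lemma arr_map_cmp:
  assumes f: "f \<in> Ar delta_op" and g: "g \<in> Ar delta_op" and gf: "dsrc g = dtgt f"
  shows "arr_map (cmp delta_op g f) = arr_map f \<circ> arr_map g"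
proof
  fix i
  show "arr_map (cmp delta_op g f) i = (arr_map f \<circ> arr_map g) i"
  proof (cases "i \<le> dtgt g")
    case True
    then have "dvals g ! i \<le> dtgt f" using arr_map_bounds(1)[OF g True] gf by (simp add: arr_map_def)
    with True show ?thesis
      using delta_op_length[OF g] by (simp add: arr_map_def) (simp add: delta_op_def)
  next
    case False
    then have "\<not> dtgt f + (i - dtgt g) \<le> dtgt f" by simp
    with False gf show ?thesis by (simp add: arr_map_def)
  qed
qed

text \<open>Equations between arrows reduce to equations between functions on \<open>nat\<close>, so
  the category laws follow from those of function composition.\<close>

lemma arr_map_inject:
  assumes "f \<in> Ar delta_op" "g \<in> Ar delta_op" "dsrc f = dsrc g" "dtgt f = dtgt g" "arr_map f = arr_map g"
  shows "f = g"
proof (rule darr.expand, intro conjI)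
  show "dvals f = dvals g"
  proof (rule nth_equalityI)
    show "length (dvals f) = length (dvals g)" using assms by (simp add: delta_op_length)
  next
    fix i assume "i < length (dvals f)"
    then have "i \<le> dtgt f" using assms by (simp add: delta_op_length)
    then show "dvals f ! i = dvals g ! i"
      using fun_cong[OF assms(5), of i] assms(4) by (simp add: arr_map_def)
  qed
qed fact

lemma delta_op_cmp_in:
  assumes f: "f \<in> Ar delta_op" and g: "g \<in> Ar delta_op" and gf: "dsrc g = dtgt f"
  shows "cmp delta_op g f \<in> Ar delta_op"
proof -
  have vals: "dvals (cmp delta_op g f) = map (arr_map f) (dvals g)"
    using g gf by (auto simp: delta_op_def arr_map_def)
  have "sorted (map (arr_map f) (dvals g))"
    unfolding sorted_map
  proof (rule sorted_wrt_mono_rel)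
    show "sorted_wrt (\<le>) (dvals g)" using g by (simp add: delta_op_def)
  qed (use monoD[OF mono_arr_map[OF f]] in simp)
  moreover have "arr_map f x \<le> dsrc f" if "x \<in> set (dvals g)" for x
  proof (rule arr_map_bounds(1)[OF f])
    show "x \<le> dtgt f" using g gf that by (auto simp: delta_op_def)
  qed
  moreover have "dvals g \<noteq> []" using g by (simp add: delta_op_def)
  ultimately have "dvals (cmp delta_op g f) \<noteq> [] \<and> sorted (dvals (cmp delta_op g f))
      \<and> set (dvals (cmp delta_op g f)) \<subseteq> {0..dsrc (cmp delta_op g f)}"
    unfolding vals by auto
  then show ?thesis by (simp add: delta_op_def)
qed

lemma delta_op_ident_in: "ident delta_op n \<in> Ar delta_op"
  by (auto simp: delta_op_def simp del: upt_Suc)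

lemma category_delta_op: "category delta_op"
proof
  fix f g h
  assume fgh: "f \<in> Ar delta_op" "g \<in> Ar delta_op" "h \<in> Ar delta_op"
    "dm delta_op g = cd delta_op f" "dm delta_op h = cd delta_op g"
  show "cmp delta_op (cmp delta_op h g) f = cmp delta_op h (cmp delta_op g f)"
    by (rule arr_map_inject)
      (use fgh in \<open>simp_all add: delta_op_cmp_in arr_map_cmp comp_assoc\<close>)
next
  fix f assume f: "f \<in> Ar delta_op"
  show "cmp delta_op (ident delta_op (cd delta_op f)) f = f"
    by (rule arr_map_inject)
      (use f in \<open>simp_all add: delta_op_cmp_in delta_op_ident_in arr_map_cmp arr_map_ident\<close>)
  show "cmp delta_op f (ident delta_op (dm delta_op f)) = f"
    by (rule arr_map_inject)
      (use f in \<open>simp_all add: delta_op_cmp_in delta_op_ident_in arr_map_cmp arr_map_ident\<close>)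
qed (simp_all add: hom_def delta_op_cmp_in delta_op_ident_in)

lemma basic_arr_simps:
  assumes "basic_ok b"
  shows "basic_arr b \<in> Ar delta_op" "dsrc (basic_arr b) = bsrc b" "dtgt (basic_arr b) = btgt b"
    "arr_map (basic_arr b) = basic_map b"
proof -
  show "basic_arr b \<in> Ar delta_op"
  proof (cases b)
    case (D n i)
    then show ?thesis using assms
      by (auto simp: delta_op_def sorted_map sorted_wrt_upt intro!: sorted_wrt_mono_rel[OF _ sorted_upt])
  next
    case (S n i)
    then show ?thesis using assms
      by (auto simp: delta_op_def sorted_map sorted_wrt_upt simp del: upt_Suc
          intro!: sorted_wrt_mono_rel[OF _ sorted_upt])
  qed
  show "dsrc (basic_arr b) = bsrc b" "dtgt (basic_arr b) = btgt b"
    by (cases b; simp add: dtgt_def)+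
  then show "arr_map (basic_arr b) = basic_map b"
    using assms by (cases b) (auto intro!: ext simp: arr_map_def nth_append simp del: upt_Suc)
qed

lemma word_arr_simps:
  assumes "word_ok n w"
  shows "word_arr n w \<in> Ar delta_op" "dsrc (word_arr n w) = n" "dtgt (word_arr n w) = word_tgt n w"
    "arr_map (word_arr n w) = word_map w"
proof -
  have "word_arr n w \<in> Ar delta_op \<and> dsrc (word_arr n w) = n \<and> dtgt (word_arr n w) = word_tgt n w
    \<and> arr_map (word_arr n w) = word_map w"
    using assms
    by (induction w)
      (simp_all add: delta_op_ident_in arr_map_ident delta_op_cmp_in basic_arr_simps arr_map_cmp)
  then show "word_arr n w \<in> Ar delta_op" "dsrc (word_arr n w) = n" "dtgt (word_arr n w) = word_tgt n w"
    "arr_map (word_arr n w) = word_map w" by blast+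
qed

lemma word_tgt_append [simp]: "word_tgt n (v @ w) = word_tgt (word_tgt n w) v"
  by (cases v) simp_all

lemma word_ok_append [simp]: "word_ok n (v @ w) \<longleftrightarrow> word_ok n w \<and> word_ok (word_tgt n w) v"
  by (induction v) auto

section \<open>Uniqueness and existence of normal forms\<close>

lemma D_word_below:
  assumes "\<forall>b \<in> set ds. is_D b \<and> j \<le> idx b" "x < j"
  shows "word_map ds x = x"
  using assms
proof (induction ds)
  case (Cons b ds)
  then show ?case by (cases b) auto
qed simp

lemma strict_mono_D_word: "\<forall>b \<in> set ds. is_D b \<Longrightarrow> strict_mono (word_map ds)"
proof (induction ds)
  case (Cons b ds)
  then have "strict_mono (basic_map b)" by (cases b) (auto simp: strict_mono_def)
  with Cons show ?case by (simp add: strict_mono_def)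
qed (simp add: strict_mono_def)

text \<open>A codegeneracy with index \<open>k\<close> shifts the points above \<open>k\<close> down
  by one, to points that are at least \<open>k\<close>. The remaining indices are smaller than
  \<open>k\<close>, so no later collapse can occur there.\<close>

lemma S_word_above:
  assumes "\<forall>b \<in> set ss. is_S b \<and> idx b < l" "sorted_wrt (>) (map idx ss)" "\<forall>b \<in> set ds. is_D b" "l \<le> x"
  shows "word_map (ss @ ds) x < word_map (ss @ ds) (Suc x)"
  using assms
proof (induction ss arbitrary: l x)
  case Nil
  then show ?case using strict_mono_D_word[of ds] by (simp add: strict_mono_def)
next
  case (Cons b ss)
  obtain m k where b: "b = S m k" using Cons.prems by (cases b) auto
  then have x: "k < x" using Cons.prems by simp
  have "word_map (ss @ ds) (x - 1) < word_map (ss @ ds) (Suc (x - 1))"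
    by (rule Cons.IH[of k]) (use Cons.prems b x in auto)
  then show ?case using b x by simp
qed

text \<open>Induction from the end of the word: the last letter is recovered from the map and then
  cancelled, since a coface is injective.\<close>

lemma D_word_unique:
  assumes "\<forall>b \<in> set ds. is_D b" "sorted_wrt (\<ge>) (map idx ds)" "word_ok n ds"
    "\<forall>b \<in> set ds'. is_D b" "sorted_wrt (\<ge>) (map idx ds')" "word_ok n ds'" "word_map ds = word_map ds'"
  shows "ds = ds'"
  using assms
proof (induction ds arbitrary: n ds' rule: rev_induct)
  \<comment> \<open>\<open>j\<close> is the least omitted value: the coface of index
    \<open>j\<close>, acting last, omits it, and all indices are at least \<open>j\<close>, so
    smaller points stay fixed.\<close>
  have gap: "word_map (vs @ [D n j]) x \<noteq> j" "x < j \<Longrightarrow> word_map (vs @ [D n j]) x = x"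
    if "\<forall>b \<in> set (vs @ [D n j]). is_D b" "sorted_wrt (\<ge>) (map idx (vs @ [D n j]))" for vs j n x
  proof -
    show "word_map (vs @ [D n j]) x \<noteq> j" by (simp add: word_map_append)
    show "word_map (vs @ [D n j]) x = x" if "x < j"
      using D_word_below[of vs j x] \<open>x < j\<close> \<open>\<forall>b \<in> set (vs @ [D n j]). is_D b\<close>
        \<open>sorted_wrt (\<ge>) (map idx (vs @ [D n j]))\<close>
      by (auto simp: word_map_append sorted_wrt_append)
  qed
  {
    case Nil
    show ?case
    proof (cases ds' rule: rev_cases)
      case (snoc vs b)
      then obtain k j where "b = D k j" using Nil by (cases b) auto
      with snoc Nil gap(1)[of vs k j j] show ?thesis by (metis word_map_simps(1) id_apply)
    qed simp
  next
    case (snoc b vs)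
    obtain k j where b: "b = D k j" using snoc.prems by (cases b) auto
    have "ds' \<noteq> []"
      using snoc.prems gap(1)[of vs k j j] b by (metis word_map_simps(1) id_apply)
    then obtain vs' b' where ds': "ds' = vs' @ [b']" by (cases ds' rule: rev_cases) auto
    obtain k' j' where b': "b' = D k' j'" using snoc.prems ds' by (cases b') auto
    have "\<not> j < j'" "\<not> j' < j"
      using gap[of vs k j] gap[of vs' k' j'] snoc.prems ds' b b' by metis+
    then have "j = j'" by simp
    moreover have "k = n" "k' = n" using snoc.prems ds' b b' by auto
    moreover have "word_map vs = word_map vs'"
    proof
      fix x
      have "basic_map (D n j) (word_map vs x) = basic_map (D n j) (word_map vs' x)"
        using fun_cong[OF snoc.prems(7), of x] ds' b b' \<open>k = n\<close> \<open>k' = n\<close> \<open>j = j'\<close>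
        by (simp add: word_map_append del: basic_map.simps)
      then show "word_map vs x = word_map vs' x" by (auto split: if_splits)
    qed
    then have "vs = vs'"
      using snoc.prems ds' b b' \<open>k = n\<close> \<open>k' = n\<close>
      by (intro snoc.IH[of "n - 1"]) (auto simp: sorted_wrt_append)
    ultimately show ?case using ds' b b' by simp
  }
qed

text \<open>The leading degeneracy is recovered from the map and cancelled; once none is left,
  \<open>D_word_unique\<close> takes over.\<close>

lemma nf_unique:
  assumes "is_nf w" "word_ok n w" "is_nf w'" "word_ok n w'" "word_map w = word_map w'"
    "word_tgt n w = word_tgt n w'"
  shows "w = w'"
proof -
  have "ss @ ds = ss' @ ds'"
    if "\<forall>b \<in> set ss. is_S b" "sorted_wrt (>) (map idx ss)" "\<forall>b \<in> set ss'. is_S b" "sorted_wrt (>) (map idx ss')"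
      and ds: "\<forall>b \<in> set ds. is_D b" "sorted_wrt (\<ge>) (map idx ds)" "\<forall>b \<in> set ds'. is_D b" "sorted_wrt (\<ge>) (map idx ds')"
      and "word_ok n (ss @ ds)" "word_ok n (ss' @ ds')" "word_map (ss @ ds) = word_map (ss' @ ds')"
        "word_tgt n (ss @ ds) = word_tgt n (ss' @ ds')"
    for ss ss' ds ds'
    using that
  proof (induction ss arbitrary: ss')
    \<comment> \<open>The leading index \<open>l\<close> is the largest point where the map fails to
      increase, hence is determined by the map.\<close>
    have rep: "word_map (S m l # v @ es) l = word_map (S m l # v @ es) (Suc l)"
      "l < x \<Longrightarrow> word_map (S m l # v @ es) x < word_map (S m l # v @ es) (Suc x)"
      if "\<forall>b \<in> set (S m l # v). is_S b" "sorted_wrt (>) (map idx (S m l # v))" "\<forall>b \<in> set es. is_D b"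
      for v m l es x
    proof -
      show "word_map (S m l # v @ es) l = word_map (S m l # v @ es) (Suc l)" by simp
      show "word_map (S m l # v @ es) x < word_map (S m l # v @ es) (Suc x)" if "l < x"
        using S_word_above[of "S m l # v" "Suc l" es x] \<open>l < x\<close>
          \<open>\<forall>b \<in> set (S m l # v). is_S b\<close> \<open>sorted_wrt (>) (map idx (S m l # v))\<close>
          \<open>\<forall>b \<in> set es. is_D b\<close> by (auto simp: less_SucI)
    qed
    have less: "word_map es x < word_map es (Suc x)" if "\<forall>b \<in> set es. is_D b" for es x
      using strict_mono_D_word[OF that] by (simp add: strict_mono_def)
    {
      case Nil
      have "ss' = []"
      proof (cases ss')
        case (Cons b v)
        then obtain m l where "b = S m l" using Nil by (cases b) auto
        then show ?thesis
          using Nil Cons rep(1)[of m l v ds'] less[of ds l] by (metis append_Cons append_Nil less_irrefl)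
      qed
      then show ?case using D_word_unique Nil by simp
    next
      case (Cons b v)
      obtain m l where b: "b = S m l" using Cons.prems by (cases b) auto
      have "ss' \<noteq> []"
        using Cons.prems b rep(1)[of m l v ds] less[of ds' l] by (metis append_Cons append_Nil less_irrefl)
      then obtain b' v' where ss': "ss' = b' # v'" by (cases ss') auto
      obtain m' l' where b': "b' = S m' l'" using Cons.prems ss' by (cases b') auto
      have eq: "word_map (S m l # v @ ds) = word_map (S m' l' # v' @ ds')"
      proof
        fix x
        show "word_map (S m l # v @ ds) x = word_map (S m' l' # v' @ ds') x"
          using fun_cong[OF Cons.prems(11), of x] b b' ss' by simp
      qed
      have "\<not> l < l'" "\<not> l' < l"
        using rep[of m l v ds] rep[of m' l' v' ds'] Cons.prems b b' ss' eq
        by (metis append_Cons less_irrefl)+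
      then have "l = l'" by simp
      moreover have "m = m'" using Cons.prems b b' ss' by simp
      moreover have "word_map (v @ ds) = word_map (v' @ ds')"
      proof
        fix x
        show "word_map (v @ ds) x = word_map (v' @ ds') x"
          \<comment> \<open>The substituted point is the value at \<open>x\<close> of the coface of
            index \<open>l\<close>, a section of the codegeneracy of index \<open>l\<close>; this
            cancels the codegeneracy.\<close>
          using fun_cong[OF eq, of "if x < l then x else Suc x"] \<open>l = l'\<close> by (auto split: if_splits)
      qed
      then have "v @ ds = v' @ ds'"
        using Cons.prems b b' ss' \<open>m = m'\<close> by (intro Cons.IH) auto
      ultimately show ?case using b b' ss' by simp
    }
  qed
  then show ?thesis using assms by (auto simp: is_nf_def)
qed

text \<open>The first factor of \<open>ds\<close> is read off as the least point moved by \<open>\<phi>\<close>, which is the least value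
  that \<open>\<phi>\<close> omits.\<close>

lemma D_word_exists:
  assumes "strict_mono \<phi>" "\<forall>x<j. \<phi> x = x" "\<forall>x\<le>k. \<phi> x \<le> n" "\<forall>x>k. \<phi> x = n + (x - k)" "k \<le> n"
  shows "\<exists>ds. (\<forall>b \<in> set ds. is_D b \<and> j \<le> idx b) \<and> sorted_wrt (\<ge>) (map idx ds) \<and> word_ok n ds
    \<and> word_map ds = \<phi> \<and> word_tgt n ds = k"
  using assms
proof (induction "n - k" arbitrary: n \<phi> j)
  case 0
  have "\<phi> x = x" for x
  proof (cases "x \<le> k")
    case True
    \<comment> \<open>A strictly monotone map gains at least \<open>d\<close> over \<open>d\<close>
      steps. Since \<open>\<phi> k \<le> k\<close>, no point up to \<open>k\<close> can be moved
      upwards.\<close>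
    have "\<phi> x + d \<le> \<phi> (x + d)" for d
    proof (induction d)
      case (Suc d)
      then show ?case using strict_monoD[OF 0(2), of "x + d" "x + Suc d"] by simp
    qed simp
    from this[of "k - x"] True have "\<phi> x + (k - x) \<le> \<phi> k" by simp
    moreover have "\<phi> k \<le> k" using 0(1,6) 0(4)[rule_format, of k] by simp
    ultimately have "\<phi> x \<le> x" using True by linarith
    moreover have "x \<le> \<phi> x" using 0(2) strict_mono_imp_increasing by blast
    ultimately show ?thesis by simp
  next
    case False
    then show ?thesis using 0 by simp
  qed
  then have "word_map [] = \<phi>" by auto
  then show ?case using 0 by (intro exI[of _ "[]"]) simp
next
  case (Suc d)
  then have kn: "k < n" by simp
  define i where "i = (LEAST x. \<phi> x \<noteq> x)"
  \<comment> \<open>The tail of slope 1 supplies a moved point: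
    \<open>\<phi> (Suc k) = Suc n\<close> and \<open>k < n\<close>. It also bounds the least moved
    point by \<open>Suc k \<le> n\<close>, so that \<open>D n i\<close> is a legitimate
    face.\<close>
  have ne: "\<phi> (Suc k) \<noteq> Suc k" using Suc.prems(4)[rule_format, of "Suc k"] kn by simp
  have i: "\<phi> i \<noteq> i" "i \<le> Suc k" 
    unfolding i_def using LeastI[of "\<lambda>x. \<phi> x \<noteq> x", OF ne] Least_le[of "\<lambda>x. \<phi> x \<noteq> x", OF ne] .
  have below: "\<phi> x = x" if "x < i" for x using that not_less_Least unfolding i_def by blast
  have above: "i < \<phi> x" if "i \<le> x" for x
  proof -
    have "i < \<phi> i" using strict_mono_imp_increasing[OF Suc.prems(1), of i] i(1) by simp
    also have "\<phi> i \<le> \<phi> x" using Suc.prems(1) that by (simp add: strict_mono_less_eq)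
    finally show ?thesis .
  qed
  have "j \<le> i" using Suc.prems(2) i(1) by (meson not_le)
  \<comment> \<open>As \<phi> omits \<open>i\<close>, it factors through the coface of index
    \<open>i\<close>, and \<phi>' is the other factor. It fixes every point below \<open>i\<close>,
    so the induction yields indices at least \<open>i\<close>, as the ordering of the word
    demands.\<close>
  define \<phi>' where "\<phi>' x = (if x < i then x else \<phi> x - 1)" for x
  have "strict_mono \<phi>'"
  proof (rule strict_monoI)
    fix x y :: nat assume "x < y"
    then show "\<phi>' x < \<phi>' y"
      using above[of x] above[of y] strict_monoD[OF Suc.prems(1) \<open>x < y\<close>] by (auto simp: \<phi>'_def)
  qed
  moreover have "\<forall>x\<le>k. \<phi>' x \<le> n - 1"
  proof (intro allI impI)
    fix x assume "x \<le> k"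
    then show "\<phi>' x \<le> n - 1" using Suc.prems(3)[rule_format, of x] kn by (auto simp: \<phi>'_def)
  qed
  moreover have "\<forall>x>k. \<phi>' x = n - 1 + (x - k)"
    using Suc.prems(4) i(2) kn by (auto simp: \<phi>'_def)
  moreover have "\<forall>x<i. \<phi>' x = x" by (simp add: \<phi>'_def)
  moreover have "d = n - 1 - k" "k \<le> n - 1" using Suc.hyps(2) by simp_all
  ultimately have "\<exists>ds. (\<forall>b \<in> set ds. is_D b \<and> i \<le> idx b) \<and> sorted_wrt (\<ge>) (map idx ds)
    \<and> word_ok (n - 1) ds \<and> word_map ds = \<phi>' \<and> word_tgt (n - 1) ds = k"
    by (intro Suc.hyps(1))
  then obtain ds where ds: "\<forall>b \<in> set ds. is_D b \<and> i \<le> idx b" "sorted_wrt (\<ge>) (map idx ds)"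
    "word_ok (n - 1) ds" "word_map ds = \<phi>'" "word_tgt (n - 1) ds = k"
    by blast
  have "word_map (ds @ [D n i]) = \<phi>"
  proof
    fix x
    show "word_map (ds @ [D n i]) x = \<phi> x"
      using above[of x] below[of x] by (cases "x < i") (auto simp: word_map_append ds(4) \<phi>'_def)
  qed
  moreover have "word_ok n (ds @ [D n i])" using ds kn i by simp
  ultimately show ?case
    using ds \<open>j \<le> i\<close> by (intro exI[of _ "ds @ [D n i]"]) (auto simp: sorted_wrt_append)
qed

text \<open>Each repetition of values of \<phi> is removed as a leading degeneracy, lowering
  \<open>k\<close>. A map without repetitions is strictly monotone and is handled by
  \<open>D_word_exists\<close>.\<close>

lemma nf_exists:
  assumes "mono \<phi>" "\<forall>x\<le>k. \<phi> x \<le> n" "\<forall>x>k. \<phi> x = n + (x - k)"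
  shows "\<exists>w. is_nf w \<and> word_ok n w \<and> word_map w = \<phi> \<and> word_tgt n w = k"
  using assms
proof (induction k arbitrary: \<phi> rule: less_induct)
  case (less k)
  have mono: "\<phi> x \<le> \<phi> y" if "x \<le> y" for x y using less.prems(1) that by (rule monoD)
  show ?case
  proof (cases "\<exists>x. \<phi> x = \<phi> (Suc x)")
    case False
    have "\<phi> x < \<phi> (Suc x)" for x using False mono[of x "Suc x"] by (metis le_neq_implies_less le_SucI order_refl)
    then have sm: "strict_mono \<phi>" by (simp add: strict_mono_Suc_iff)
    have "k \<le> n" using strict_mono_imp_increasing[OF sm, of k] less.prems(2) by (meson order.trans order_refl)
    then obtain ds where "\<forall>b \<in> set ds. is_D b \<and> 0 \<le> idx b" "sorted_wrt (\<ge>) (map idx ds)" "word_ok n ds"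
      "word_map ds = \<phi>" "word_tgt n ds = k"
      using D_word_exists[OF sm _ less.prems(2,3), of 0] by auto
    then show ?thesis unfolding is_nf_def by (intro exI[of _ ds]) force
  next
    case True
    \<comment> \<open>Beyond \<open>k\<close> the slope is 1, and at \<open>k\<close> the value
      jumps from at most \<open>n\<close> to \<open>n + 1\<close>. Repetitions are therefore bounded
      and a greatest one exists.\<close>
    have bound: "x < k" if "\<phi> x = \<phi> (Suc x)" for x
    proof (rule ccontr)
      assume "\<not> x < k"
      then show False
        using that less.prems(2)[rule_format, of x] less.prems(3)[rule_format, of "Suc x"]
          less.prems(3)[rule_format, of x] by (cases "x = k") auto
    qed
    define l where "l = (GREATEST x. \<phi> x = \<phi> (Suc x))"
    have l: "\<phi> l = \<phi> (Suc l)"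
      unfolding l_def using True bound by (metis (mono_tags, lifting) GreatestI_ex_nat less_imp_le)
    have l_max: "x \<le> l" if "\<phi> x = \<phi> (Suc x)" for x
      unfolding l_def using that bound by (metis (mono_tags, lifting) Greatest_le_nat less_imp_le)
    have lk: "l < k" using bound l by simp
    \<comment> \<open>Precomposition with the coface of index \<open>l\<close> leaves out one of the
      two equal values.\<close>
    define \<phi>' where "\<phi>' x = \<phi> (if x < l then x else Suc x)" for x
    have "mono \<phi>'" by (auto intro!: monoI mono simp: \<phi>'_def)
    moreover have "\<forall>x\<le>k - 1. \<phi>' x \<le> n" using less.prems(2) lk by (auto simp: \<phi>'_def)
    moreover have "\<forall>x>k - 1. \<phi>' x = n + (x - (k - 1))" using less.prems(3) lk by (auto simp: \<phi>'_def)
    ultimately obtain w where w: "is_nf w" "word_ok n w" "word_map w = \<phi>'" "word_tgt n w = k - 1"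
      using less.IH[of "k - 1" \<phi>'] lk by auto
    have "word_map (S k l # w) = \<phi>"
      using l by (auto intro!: ext simp: w(3) \<phi>'_def)
    moreover have "is_nf (S k l # w)"
    proof -
      obtain ss ds where sd: "w = ss @ ds" "\<forall>b \<in> set ss. is_S b" "\<forall>b \<in> set ds. is_D b"
        "sorted_wrt (>) (map idx ss)" "sorted_wrt (\<ge>) (map idx ds)"
        using w(1) unfolding is_nf_def by blast
      have "\<forall>b \<in> set ss. idx b < l"
      proof (cases ss)
        case (Cons b ss')
        then obtain m i where b: "b = S m i" using sd by (cases b) auto
        have "\<phi>' i = \<phi>' (Suc i)" unfolding w(3)[symmetric] sd Cons b by simp
        \<comment> \<open>A repetition of \<phi>' at some \<open>i \<ge> l\<close> would be a
          repetition of \<phi> at \<open>Suc i\<close>, contradicting the maximality of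
          \<open>l\<close>.\<close>
        then have "i < l" using l_max[of "Suc i"] unfolding \<phi>'_def by (auto split: if_splits)
        then show ?thesis using sd(4) Cons b by auto
      qed simp
      then show ?thesis using sd unfolding is_nf_def by (intro exI[of _ "S k l # ss"] exI[of _ ds]) auto
    qed
    moreover have "word_ok n (S k l # w)" using w lk by simp
    ultimately show ?thesis by (intro exI[of _ "S k l # w"]) simp
  qed
qed

text \<open>Existence and uniqueness make the definite description denote. From here on a normal
  form is used only as a well-formed word with the right total map and target.\<close>

lemma nf:
  assumes f: "f \<in> Ar delta_op"
  shows "word_ok (dsrc f) (nf f)" "word_map (nf f) = arr_map f" "word_tgt (dsrc f) (nf f) = dtgt f"
proof -
  let ?P = "\<lambda>w. word_ok (dsrc f) w \<and> word_arr (dsrc f) w = f \<and> is_nf w"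
  obtain w where w: "is_nf w" "word_ok (dsrc f) w" "word_map w = arr_map f" "word_tgt (dsrc f) w = dtgt f"
    using nf_exists[OF mono_arr_map[OF f], of "dtgt f" "dsrc f"] arr_map_bounds[OF f]
    by (auto simp: arr_map_def)
  have "?P w"
    using w by (auto intro!: arr_map_inject simp: word_arr_simps f)
  moreover have "v = w" if "?P v" for v
    by (rule nf_unique[of _ "dsrc f"]) (use that w word_arr_simps[of "dsrc f" v] in auto)
  ultimately have "?P (nf f)" unfolding nf_def by (rule theI)
  then show "word_ok (dsrc f) (nf f)" "word_map (nf f) = arr_map f" "word_tgt (dsrc f) (nf f) = dtgt f"
    using word_arr_simps[of "dsrc f" "nf f"] by auto
qed

section \<open>Functors and transformations on tuples\<close>

context monoid_on
begin

text \<open>Here the prescribed action meets the interval formula. For \<open>D n i\<close> with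
  \<open>0 < i < n\<close> the interval at \<open>i - 1\<close> has the two members
  \<open>i - 1\<close> and \<open>i\<close>; for \<open>D n 0\<close> all intervals are shifted
  singletons; for \<open>D n n\<close> the last entry lies outside the target; for
  \<open>S n j\<close> the interval at \<open>j\<close> is empty.\<close>

lemma bar_op_map:
  assumes H [simp]: "\<And>i. H i \<in> R" and b: "basic_ok b"
  shows "bar_op t u b (map H [0..<bsrc b])
    = map (\<lambda>i. bigop t u [basic_map b i..<basic_map b (Suc i)] H) [0..<btgt b]"
proof (cases b)
  case (D n i)
  consider "i = 0" | "i = n" "0 < i" | "0 < i" "i < n" using b D by fastforce
  then show ?thesis
  proof cases
    case 1
    then show ?thesis using D b by (auto intro!: nth_equalityI)
  next
    case 2
    then show ?thesis using D by (auto intro!: nth_equalityI)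
  next
    case 3
    have two: "[i - Suc 0..<i] = [i - Suc 0]" using 3 by (simp add: upt_rec)
    show ?thesis
    proof (rule nth_equalityI)
      fix k assume k: "k < length (bar_op t u b (map H [0..<bsrc b]))"
      consider "k < i - 1" | "k = i - 1" | "i \<le> k" using 3 by linarith
      then show "bar_op t u b (map H [0..<bsrc b]) ! k
        = map (\<lambda>i. bigop t u [basic_map b i..<basic_map b (Suc i)] H) [0..<btgt b] ! k"
        using k 3 D by cases (auto simp: nth_append two)
    qed (use 3 D in auto)
  qed
next
  case (S n j)
  have jn: "j < n" using b S by auto
  show ?thesis
  proof (rule nth_equalityI)
    fix k assume k: "k < length (bar_op t u b (map H [0..<bsrc b]))"
    consider "k < j" | "k = j" | "j < k" by linarith
    then show "bar_op t u b (map H [0..<bsrc b]) ! k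
      = map (\<lambda>i. bigop t u [basic_map b i..<basic_map b (Suc i)] H) [0..<btgt b] ! k"
    proof cases
      case 3
      then obtain k' where k': "k = Suc k'" "j \<le> k'" by (cases k) auto
      then have "k - j = Suc (k' - j)" by simp
      then show ?thesis using k jn S k' by (simp add: nth_append)
    qed (use k jn S in \<open>auto simp: nth_append\<close>)
  qed (use jn S in auto)
qed

lemma bar_word_map:
  assumes H: "\<And>i. H i \<in> R" and w: "word_ok n w"
  shows "foldr (bar_op t u) w (map H [0..<n])
    = map (\<lambda>i. bigop t u [word_map w i..<word_map w (Suc i)] H) [0..<word_tgt n w]"
  using w
proof (induction w)
  case Nil
  then show ?case by (simp add: H)
next
  case (Cons b w)
  let ?H = "\<lambda>i. bigop t u [word_map w i..<word_map w (Suc i)] H"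
  have "foldr (bar_op t u) (b # w) (map H [0..<n]) = bar_op t u b (map ?H [0..<bsrc b])"
    using Cons by simp
  also have "\<dots> = map (\<lambda>i. bigop t u [basic_map b i..<basic_map b (Suc i)] ?H) [0..<btgt b]"
    using Cons.prems H by (intro bar_op_map) simp_all
  finally show ?case by (simp add: bigop_upt H)
qed

end

lemma map2_map_map: "map2 f (map g xs) (map h xs) = map (\<lambda>x. f (g x) (h x)) xs"
  by (induction xs) simp_all

text \<open>Blocks form a monoid under componentwise product, so the bar construction of a power is
  covered by the same product formula.\<close>

lemma monoid_on_power:
  assumes "monoid_on R t u"
  shows "monoid_on {L. length L = p \<and> set L \<subseteq> R} (map2 t) (replicate p u)"
proof -
  interpret monoid_on R t u by fact
  have nth: "L ! i \<in> R" if "set L \<subseteq> R" "i < length L" for L i using that by auto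
  show ?thesis
    by unfold_locales
      (auto simp: set_zip nth intro!: nth_equalityI t_assoc)
qed

lemma bigop_power:
  "bigop (map2 t) (replicate p u) is (\<lambda>i. map (A i) [0..<p])
    = map (\<lambda>j. bigop t u is (\<lambda>i. A i j)) [0..<p]"
  by (induction "is") (simp_all add: map2_map_map map_replicate_const del: map_map)

section \<open>Finite corners of matrices, listed row by row\<close>

definition mat :: "nat \<Rightarrow> nat \<Rightarrow> (nat \<Rightarrow> nat \<Rightarrow> 'x) \<Rightarrow> 'x list" where
  "mat n m A = concat (map (\<lambda>i. map (A i) [0..<m]) [0..<n])"

lemma mat_0 [simp]: "mat 0 m A = []"
  and mat_Suc: "mat (Suc n) m A = mat n m A @ map (A n) [0..<m]"
  by (simp_all add: mat_def)

lemma length_mat [simp]: "length (mat n m A) = n * m"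
  by (induction n) (simp_all add: mat_Suc)

lemma nth_mat:
  assumes "i < n" "j < m"
  shows "mat n m A ! (i * m + j) = A i j"
  using assms
proof (induction n)
  case (Suc n)
  show ?case
  proof (cases "i = n")
    case False
    then have "i < n" using Suc by simp
    then have "i * m + j < n * m"
      using mult_le_mono1[of "Suc i" n m] \<open>j < m\<close> by simp
    then show ?thesis using Suc \<open>i < n\<close> by (simp add: mat_Suc nth_append)
  qed (use Suc in \<open>simp add: mat_Suc nth_append\<close>)
qed simp

lemma nth_mat_div_mod: "k < n * m \<Longrightarrow> mat n m A ! k = A (k div m) (k mod m)"
  using nth_mat[of "k div m" n "k mod m" m A] less_mult_imp_div_less[of k n m]
  by (cases "m = 0") simp_all

lemma mat_cong: "(\<And>i j. \<lbrakk>i < n; j < m\<rbrakk> \<Longrightarrow> A i j = B i j) \<Longrightarrow> mat n m A = mat n m B"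
  by (auto simp: mat_def intro!: arg_cong[of _ _ concat])

lemma map_mat: "map f (mat n m A) = mat n m (\<lambda>i j. f (A i j))"
  by (simp add: mat_def map_concat o_def)

lemma map2_mat: "map2 f (mat n m A) (mat n m B) = mat n m (\<lambda>i j. f (A i j) (B i j))"
  by (intro nth_equalityI) (simp_all add: nth_mat_div_mod)

lemma mat_nth_self: "length X = n * m \<Longrightarrow> mat n m (\<lambda>i j. X ! (i * m + j)) = X"
  by (intro nth_equalityI) (simp_all add: nth_mat_div_mod)

text \<open>Division with remainder by \<open>m\<close> recovers row and column from a position;
  this translates the list updates that define \<chi>.\<close>

lemma mat_update:
  assumes "a < n" "b < m"
  shows "(mat n m A)[a * m + b := x] = mat n m (\<lambda>i j. if i = a \<and> j = b then x else A i j)"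
proof (rule nth_equalityI)
  fix k assume k: "k < length ((mat n m A)[a * m + b := x])"
  have "a * m + b = k \<longleftrightarrow> k div m = a \<and> k mod m = b"
    using assms by (metis div_mult_mod_eq div_mult_self3 mod_mult_self3 div_less add_0_right gr_implies_not0 mod_less)
  then show "(mat n m A)[a * m + b := x] ! k
      = mat n m (\<lambda>i j. if i = a \<and> j = b then x else A i j) ! k"
    using k by (auto simp: nth_mat_div_mod nth_list_update)
qed simp

lemma blocks_mat: "blocks n m (mat n m A) = map (\<lambda>i. map (A i) [0..<m]) [0..<n]"
proof (rule nth_equalityI)
  fix i assume "i < length (blocks n m (mat n m A))"
  then have i: "i < n" by (simp add: blocks_def)
  then have "Suc i * m \<le> n * m" by (intro mult_le_mono1) simp
  then have *: "m \<le> n * m - i * m" "i * m \<le> n * m" using i by simp_all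
  have "take m (drop (i * m) (mat n m A)) = map (A i) [0..<m]"
  proof (rule nth_equalityI)
    fix j assume "j < length (take m (drop (i * m) (mat n m A)))"
    then have "j < m" by simp
    with i * show "take m (drop (i * m) (mat n m A)) ! j = map (A i) [0..<m] ! j"
      by (simp add: nth_mat)
  qed (use * i in simp)
  then show "blocks n m (mat n m A) ! i = map (\<lambda>i. map (A i) [0..<m]) [0..<n] ! i"
    using i by (simp add: blocks_def)
qed (simp add: blocks_def)

lemma fo_bar_word: "fo (bar_word C T w) = foldr (bar_op (ob_ten T) (unt T)) w"
  and fa_bar_word: "fa (bar_word C T w) = foldr (bar_op (ar_ten T) (ident C (unt T))) w"
  by (induction w) (simp_all add: bar_word_def id_ftor_def comp_ftor_def bar_basic_def id_def)

lemma comp_ftor_simps [simp]: "fo (G \<circ>\<^sub>F F) A = fo G (fo F A)" "fa (G \<circ>\<^sub>F F) f = fa G (fa F f)"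
  by (simp_all add: comp_ftor_def)

text \<open>Colour 1 multiplies entire blocks componentwise, that is, along each column.
  \<open>map_block_map\<close> is the counterpart for colour 2, which acts inside every
  block.\<close>

lemma bar_block_map:
  assumes "monoid_on R t u" "\<And>i j. A i j \<in> R" "word_ok n w"
  shows "concat (foldr (bar_op (map2 t) (replicate p u)) w (blocks n p (mat n p A)))
    = mat (word_tgt n w) p (\<lambda>i j. bigop t u [word_map w i..<word_map w (Suc i)] (\<lambda>a. A a j))"
proof -
  interpret monoid_on "{L. length L = p \<and> set L \<subseteq> R}" "map2 t" "replicate p u"
    using assms(1) by (rule monoid_on_power)
  have "foldr (bar_op (map2 t) (replicate p u)) w (map (\<lambda>i. map (A i) [0..<p]) [0..<n])
    = map (\<lambda>i. bigop (map2 t) (replicate p u) [word_map w i..<word_map w (Suc i)]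
        (\<lambda>i. map (A i) [0..<p])) [0..<word_tgt n w]"
    using assms by (intro bar_word_map) auto
  then show ?thesis unfolding blocks_mat by (simp add: bigop_power mat_def)
qed

lemma map_block_map:
  assumes "monoid_on R t u" "\<And>i j. A i j \<in> R" "word_ok m w"
  shows "concat (map (foldr (bar_op t u) w) (blocks k m (mat k m A)))
    = mat k (word_tgt m w) (\<lambda>i j. bigop t u [word_map w j..<word_map w (Suc j)] (A i))"
proof -
  interpret monoid_on R t u by fact
  show ?thesis unfolding blocks_mat using assms by (simp add: bar_word_map mat_def o_def)
qed

context two_fold_strict_monoidal
begin

lemma fo_bar_pow_word:
  assumes "mob A" "word_ok n w"
  shows "fo (flat_ftor n p (bar_word (cat_power M p) (smon_power (mon1 M) p) w)) (mat n p A)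
    = mat (word_tgt n w) p (F1 (word_map w) A)"
  using bar_block_map[OF ob1.monoid_on_axioms mobD[OF assms(1)] assms(2)]
  by (simp add: flat_ftor_def fo_bar_word smon_power_def mon1_def F1_def)

lemma fa_bar_pow_word:
  assumes "mhom f A B" "word_ok n w"
  shows "fa (flat_ftor n p (bar_word (cat_power M p) (smon_power (mon1 M) p) w)) (mat n p f)
    = mat (word_tgt n w) p (G1 (word_map w) f)"
  using bar_block_map[OF ar1.monoid_on_axioms mhomD(1)[OF assms(1)] assms(2)]
  by (simp add: flat_ftor_def fa_bar_word smon_power_def cat_power_def mon1_def G1_def)

lemma fo_prod_word:
  assumes "mob A" "word_ok m w"
  shows "fo (prod_ftor k m (bar_word M (mon2 M) w)) (mat k m A)
    = mat k (word_tgt m w) (F2 (word_map w) A)"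
  using map_block_map[OF ob2.monoid_on_axioms mobD[OF assms(1)] assms(2)]
  by (simp add: prod_ftor_def flat_ftor_def fo_bar_word mon2_def F2_def)

lemma fa_prod_word:
  assumes "mhom f A B" "word_ok m w"
  shows "fa (prod_ftor k m (bar_word M (mon2 M) w)) (mat k m f)
    = mat k (word_tgt m w) (G2 (word_map w) f)"
  using map_block_map[OF ar2.monoid_on_axioms mhomD(1)[OF assms(1)] assms(2)]
  by (simp add: prod_ftor_def flat_ftor_def fa_bar_word mon2_def G2_def)

lemma bar_word_single: "bar_word C T [b] = bar_basic C T b"
  by (simp add: bar_word_def comp_ftor_def id_ftor_def bar_basic_def o_def)

lemma basic_ftor_mat:
  assumes "basic_ok b"
  shows "mob A \<Longrightarrow> fo (bar_pow_basic M (mon1 M) p b) (mat (bsrc b) p A)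
      = mat (btgt b) p (F1 (basic_map b) A)"
    and "mhom f A B \<Longrightarrow> fa (bar_pow_basic M (mon1 M) p b) (mat (bsrc b) p f)
      = mat (btgt b) p (G1 (basic_map b) f)"
    and "mob A \<Longrightarrow> fo (prod_ftor k (bsrc b) (bar_basic M (mon2 M) b)) (mat k (bsrc b) A)
      = mat k (btgt b) (F2 (basic_map b) A)"
    and "mhom f A B \<Longrightarrow> fa (prod_ftor k (bsrc b) (bar_basic M (mon2 M) b)) (mat k (bsrc b) f)
      = mat k (btgt b) (G2 (basic_map b) f)"
  using fo_bar_pow_word[of A "bsrc b" "[b]" p] fa_bar_pow_word[of f A B "bsrc b" "[b]" p]
    fo_prod_word[of A "bsrc b" "[b]" k] fa_prod_word[of f A B "bsrc b" "[b]" k] assms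
  by (simp_all add: bar_word_single bar_pow_basic_def id_comp)

text \<open>The functor is evaluated along normal forms, yet the result depends only on
  \<open>arr_map\<close>. Comparison with composites of arrows therefore reduces to composition of
  maps.\<close>

lemma two_bar_ar_mat:
  assumes "f \<in> Ar delta_op" "g \<in> Ar delta_op"
  shows "mob A \<Longrightarrow> fo (two_bar_ar M (f, g)) (mat (dsrc f) (dsrc g) A)
      = mat (dtgt f) (dtgt g) (F2 (arr_map g) (F1 (arr_map f) A))"
    and "mhom h A B \<Longrightarrow> fa (two_bar_ar M (f, g)) (mat (dsrc f) (dsrc g) h)
      = mat (dtgt f) (dtgt g) (G2 (arr_map g) (G1 (arr_map f) h))"
  using nf[OF assms(1)] nf[OF assms(2)]
    fo_bar_pow_word[of A "dsrc f" "nf f" "dsrc g"] fa_bar_pow_word[of h A B "dsrc f" "nf f" "dsrc g"]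
    fo_prod_word[of "F1 (arr_map f) A" "dsrc g" "nf g" "dtgt f"]
    fa_prod_word[of "G1 (arr_map f) h" "F1 (arr_map f) A" "F1 (arr_map f) B" "dsrc g" "nf g" "dtgt f"]
  by (simp_all add: two_bar_ar_def bar_pow_def bar_def mhom_G1)

lemma fo_shuffle_ftor_mat:
  assumes "word_ok n (col1 \<Theta>)" "word_ok m (col2 \<Theta>)" "mob A"
  shows "fo (shuffle_ftor M n m \<Theta>) (mat n m A)
    = mat (word_tgt n (col1 \<Theta>)) (word_tgt m (col2 \<Theta>)) (shuffle_ob \<Theta> A)"
  using assms
proof (induction \<Theta> rule: col1.induct)
  case (2 b \<Theta>)
  then show ?case using basic_ftor_mat(1)[of b "shuffle_ob \<Theta> A"] by simp
next
  case (3 b \<Theta>)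
  then show ?case using basic_ftor_mat(3)[of b "shuffle_ob \<Theta> A"] by simp
qed (simp add: id_ftor_def)

lemma fa_shuffle_ftor_mat:
  assumes "word_ok n (col1 \<Theta>)" "word_ok m (col2 \<Theta>)" "mhom f A B"
  shows "fa (shuffle_ftor M n m \<Theta>) (mat n m f)
    = mat (word_tgt n (col1 \<Theta>)) (word_tgt m (col2 \<Theta>)) (shuffle_ar \<Theta> f)"
  using assms
proof (induction \<Theta> rule: col1.induct)
  case (2 b \<Theta>)
  then show ?case using basic_ftor_mat(2)[OF _ mhom_shuffle_ar[OF 2(4)], of b] by simp
next
  case (3 b \<Theta>)
  then show ?case using basic_ftor_mat(4)[OF _ mhom_shuffle_ar[OF 3(4)], of b] by simp
qed (simp add: id_ftor_def)

end

section \<open>Normalizing paths\<close>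

lemma swap_step_cols:
  assumes "swap_step \<Theta> \<Theta>'"
  shows "col1 \<Theta> = col1 \<Theta>'" "col2 \<Theta> = col2 \<Theta>'"
  using assms by (auto simp: swap_step_def)

text \<open>A swap determines its own position, because the two words first differ right after
  \<Pi>. Hence the definite description in \<open>step_trans\<close> denotes.\<close>

lemma swap_unique:
  assumes "\<Pi> @ Col1 f # Col2 g # \<Lambda> = \<Pi>' @ Col1 f' # Col2 g' # \<Lambda>'"
    "\<Pi> @ Col2 g # Col1 f # \<Lambda> = \<Pi>' @ Col2 g' # Col1 f' # \<Lambda>'"
  shows "\<Pi> = \<Pi>' \<and> f = f' \<and> g = g' \<and> \<Lambda> = \<Lambda>'"
  using assms
proof (induction \<Pi> arbitrary: \<Pi>')
  case Nil
  then show ?case by (cases \<Pi>') auto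
next
  case (Cons x \<Pi>)
  then show ?case by (cases \<Pi>') auto
qed

lemma step_trans_eq:
  "step_trans M n m (\<Pi> @ Col1 f # Col2 g # \<Lambda>) (\<Pi> @ Col2 g # Col1 f # \<Lambda>)
    = whisker_chi M n m \<Pi> f g \<Lambda>"
  unfolding step_trans_def
proof (rule the_equality)
  fix \<alpha>
  assume "\<exists>\<Pi>' f' g' \<Lambda>'. \<Pi> @ Col1 f # Col2 g # \<Lambda> = \<Pi>' @ [Col1 f', Col2 g'] @ \<Lambda>' \<and>
     \<Pi> @ Col2 g # Col1 f # \<Lambda> = \<Pi>' @ [Col2 g', Col1 f'] @ \<Lambda>' \<and> \<alpha> = whisker_chi M n m \<Pi>' f' g' \<Lambda>'"
  then show "\<alpha> = whisker_chi M n m \<Pi> f g \<Lambda>"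
    using swap_unique[of \<Pi> f g \<Lambda>] by fastforce
qed auto

lemma swap_step_Cons: "swap_step \<Theta> \<Theta>' \<Longrightarrow> swap_step (x # \<Theta>) (x # \<Theta>')"
  unfolding swap_step_def by (metis append_Cons)

lemma swap_steps_Cons: "swap_step\<^sup>*\<^sup>* \<Theta> \<Theta>' \<Longrightarrow> swap_step\<^sup>*\<^sup>* (x # \<Theta>) (x # \<Theta>')"
  by (induction rule: rtranclp_induct) (auto intro: rtranclp.rtrancl_into_rtrancl swap_step_Cons)

lemma swap_steps_bubble: "swap_step\<^sup>*\<^sup>* (Col1 f # map Col2 \<Gamma> @ \<Theta>) (map Col2 \<Gamma> @ Col1 f # \<Theta>)"
proof (induction \<Gamma>)
  case (Cons g \<Gamma>)
  have "swap_step (Col1 f # map Col2 (g # \<Gamma>) @ \<Theta>) (Col2 g # Col1 f # map Col2 \<Gamma> @ \<Theta>)"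
    unfolding swap_step_def by (intro exI[of _ "[]"]) auto
  with swap_steps_Cons[OF Cons, of "Col2 g"] show ?case
    by (simp add: converse_rtranclp_into_rtranclp)
qed simp

lemma swap_steps_normal: "swap_step\<^sup>*\<^sup>* \<Theta> (map Col2 (col2 \<Theta>) @ map Col1 (col1 \<Theta>))"
proof (induction \<Theta> rule: col1.induct)
  case (2 b \<Theta>)
  then show ?case
    using swap_steps_Cons[OF 2, of "Col1 b"] swap_steps_bubble[of b "col2 \<Theta>" "map Col1 (col1 \<Theta>)"]
    by simp
next
  case (3 b \<Theta>)
  then show ?case using swap_steps_Cons[OF 3, of "Col2 b"] by simp
qed simp

lemma in_shuffles: "\<Theta> \<in> shuffles (map Col1 (col1 \<Theta>)) (map Col2 (col2 \<Theta>))"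
  by (induction \<Theta> rule: col1.induct) (auto intro: Cons_in_shuffles_leftI Cons_in_shuffles_rightI)

text \<open>Gives meaning to the choice of path in \<open>phi\<close>. The path is built backwards
  from the normal shuffle, adding one swap at its front.\<close>

lemma normalizing_path_exists: "\<exists>P. normalizing_path (col1 \<Theta>) (col2 \<Theta>) \<Theta> P"
proof -
  let ?N = "map Col2 (col2 \<Theta>) @ map Col1 (col1 \<Theta>)"
  have "\<exists>P. normalizing_path (col1 \<Theta>') (col2 \<Theta>') \<Theta>' P"
    if "swap_step\<^sup>*\<^sup>* \<Theta>' ?N" for \<Theta>'
    using that
  proof (induction rule: converse_rtranclp_induct)
    case base
    have "normalizing_path (col1 ?N) (col2 ?N) ?N [?N]"
      using in_shuffles[of ?N] by (simp add: normalizing_path_def)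
    then show ?case ..
  next
    case (step y z)
    then obtain P where P: "normalizing_path (col1 z) (col2 z) z P" by blast
    note cols = swap_step_cols[OF step(1)]
    have "swap_step ((y # P) ! i) ((y # P) ! Suc i)" if "Suc i < length (y # P)" for i
      using that P step(1) by (cases i) (auto simp: normalizing_path_def hd_conv_nth)
    then have "normalizing_path (col1 y) (col2 y) y (y # P)"
      using P in_shuffles[of y] cols by (simp add: normalizing_path_def)
    then show ?case ..
  qed
  then show ?thesis using swap_steps_normal by blast
qed

context two_fold_strict_monoidal
begin

text \<open>One singleton interval, of rows or of columns, suffices to make the entry an
  identity.\<close>

lemma X_single:
  assumes "mob A" "\<phi> (Suc i) = Suc (\<phi> i) \<or> \<psi> (Suc j) = Suc (\<psi> j)"
  shows "X \<phi> \<psi> A i j = mid (F1 \<phi> (F2 \<psi> A)) i j"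
  using assms(2) mobD[OF assms(1)]
  by (auto simp: X_def mid_def F1_def F2_def simp del: K.simps)

lemma chi_mat:
  assumes A: "mob A" and f: "basic_ok f" and g: "basic_ok g"
  shows "chi M f g (mat (bsrc f) (bsrc g) A)
    = mat (btgt f) (btgt g) (X (basic_map f) (basic_map g) A)"
proof -
  let ?I = "mid (F1 (basic_map f) (F2 (basic_map g) A))"
  let ?X = "X (basic_map f) (basic_map g) A"
  have ids: "map (ident M) (fo (bar_pow_basic M (mon1 M) (btgt g) f \<circ>\<^sub>F
      prod_ftor (bsrc f) (bsrc g) (bar_basic M (mon2 M) g)) (mat (bsrc f) (bsrc g) A))
    = mat (btgt f) (btgt g) ?I"
    using A f g by (simp add: basic_ftor_mat map_mat mid_def)
  have single: "?X i j = ?I i j"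
    if "basic_map f (Suc i) = Suc (basic_map f i) \<or> basic_map g (Suc j) = Suc (basic_map g j)" for i j
    using X_single[OF A that] .
  \<comment> \<open>In the exceptional cases of \<chi>, exactly one row interval and one column
    interval in range differ from a singleton, so \<open>X\<close> departs from the identity matrix
    in a single entry.\<close>
  have upd: "mat (btgt f) (btgt g) ?X = (mat (btgt f) (btgt g) ?I)[a * btgt g + b := x]"
    if "a < btgt f" "b < btgt g" "?X a b = x"
      "\<And>i. i \<noteq> a \<Longrightarrow> i < btgt f \<Longrightarrow> basic_map f (Suc i) = Suc (basic_map f i)"
      "\<And>j. j \<noteq> b \<Longrightarrow> j < btgt g \<Longrightarrow> basic_map g (Suc j) = Suc (basic_map g j)" for a b x
    unfolding mat_update[OF that(1,2)]
    by (rule mat_cong) (use that single in auto)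
  \<comment> \<open>Outer faces fall under this case: all their intervals in range are singletons,
    that of \<open>D n n\<close> with two members or more not arising below
    \<open>n - 1\<close>.\<close>
  have same: "mat (btgt f) (btgt g) ?X = mat (btgt f) (btgt g) ?I"
    if "(\<forall>i < btgt f. basic_map f (Suc i) = Suc (basic_map f i))
      \<or> (\<forall>j < btgt g. basic_map g (Suc j) = Suc (basic_map g j))"
    by (rule mat_cong) (use that single in auto)
  note small = K_small[of A, OF mobD[OF A]]
  have two: "[i - Suc 0..<Suc i] = [i - Suc 0, i]" if "0 < i" for i :: nat
    using that by (simp add: upt_rec)
  show ?thesis
  proof (cases f)
    case f': (D n j)
    show ?thesis
    proof (cases g)
      case g': (D m i)
      show ?thesis
      proof (cases "1 \<le> j \<and> j \<le> n - 1 \<and> 1 \<le> i \<and> i \<le> m - 1")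
        case True
        then have lt: "j - 1 < n" "j < n" "i - 1 < m" "i < m" by auto
        have "?X (j - 1) (i - 1) = \<iota> (A (j - 1) (i - 1)) (A (j - 1) i) (A j (i - 1)) (A j i)"
          using True by (simp add: X_def f' g' two small del: K.simps upt_Suc)
        moreover have "mat n m A ! ((j - 1) * m + (i - 1)) = A (j - 1) (i - 1)"
          "mat n m A ! ((j - 1) * m + i) = A (j - 1) i"
          "mat n m A ! (j * m + (i - 1)) = A j (i - 1)" "mat n m A ! (j * m + i) = A j i"
          using nth_mat[OF lt(1,3), of A] nth_mat[OF lt(1,4), of A] nth_mat[OF lt(2,3), of A]
            nth_mat[OF lt(2,4), of A] by simp_all
        moreover have "mat (btgt f) (btgt g) ?X
          = (mat (btgt f) (btgt g) ?I)[(j - 1) * btgt g + (i - 1) := ?X (j - 1) (i - 1)]"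
          by (rule upd) (use lt True in \<open>auto simp: f' g'\<close>)
        ultimately show ?thesis
          using True ids f' g' by (simp add: chi_def)
      next
        case False
        then have "(\<forall>i < btgt f. basic_map f (Suc i) = Suc (basic_map f i))
          \<or> (\<forall>j < btgt g. basic_map g (Suc j) = Suc (basic_map g j))"
          using f' g' by auto
        then show ?thesis using same False ids f' g' by (auto simp: chi_def Let_def)
      qed
    next
      case g': (S m i)
      show ?thesis
      proof (cases "1 \<le> j \<and> j \<le> n - 1")
        case True
        have "?X (j - 1) i = \<tau>"
          using True by (simp add: X_def f' g' two small del: K.simps upt_Suc)
        moreover have "mat (btgt f) (btgt g) ?X = (mat (btgt f) (btgt g) ?I)[(j - 1) * btgt g + i := ?X (j - 1) i]"
          by (rule upd) (use True f g in \<open>auto simp: f' g'\<close>)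
        ultimately show ?thesis
          using True ids f' g' by (simp add: chi_def)
      next
        case False
        then have "\<forall>i < btgt f. basic_map f (Suc i) = Suc (basic_map f i)"
          using f' by auto
        then show ?thesis using same False ids f' g' by (auto simp: chi_def Let_def)
      qed
    qed
  next
    case f': (S n j)
    show ?thesis
    proof (cases g)
      case g': (D m i)
      show ?thesis
      proof (cases "1 \<le> i \<and> i \<le> m - 1")
        case True
        have "?X j (i - 1) = \<beta>"
          using True by (simp add: X_def f' g' two small del: K.simps upt_Suc)
        moreover have "mat (btgt f) (btgt g) ?X = (mat (btgt f) (btgt g) ?I)[j * btgt g + (i - 1) := ?X j (i - 1)]"
          by (rule upd) (use True f g in \<open>auto simp: f' g'\<close>)
        ultimately show ?thesis
          using True ids f' g' by (simp add: chi_def)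
      next
        case False
        then have "\<forall>i < btgt g. basic_map g (Suc i) = Suc (basic_map g i)"
          using g' by auto
        then show ?thesis using same False ids f' g' by (auto simp: chi_def Let_def)
      qed
    next
      case g': (S m i)
      have "?X j i = \<kappa>" by (simp add: X_def f' g')
      moreover have "mat (btgt f) (btgt g) ?X = (mat (btgt f) (btgt g) ?I)[j * btgt g + i := ?X j i]"
        by (rule upd) (use f g in \<open>auto simp: f' g'\<close>)
      ultimately show ?thesis
        using ids f' g' by (simp add: chi_def)
    qed
  qed
qed

lemma whisker_chi_mat:
  assumes A: "mob A" and ok: "word_ok n (col1 (\<Pi> @ Col1 f # Col2 g # \<Lambda>))"
    "word_ok m (col2 (\<Pi> @ Col1 f # Col2 g # \<Lambda>))"
  shows "whisker_chi M n m \<Pi> f g \<Lambda> (mat n m A)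
    = mat (word_tgt n (col1 (\<Pi> @ Col1 f # Col2 g # \<Lambda>))) (word_tgt m (col2 (\<Pi> @ Col1 f # Col2 g # \<Lambda>)))
        (shuffle_ar \<Pi> (X (basic_map f) (basic_map g) (shuffle_ob \<Lambda> A)))"
proof -
  have "fo (shuffle_ftor M n m \<Lambda>) (mat n m A) = mat (bsrc f) (bsrc g) (shuffle_ob \<Lambda> A)"
    using fo_shuffle_ftor_mat[of n \<Lambda> m A] A ok by simp
  moreover have "chi M f g (mat (bsrc f) (bsrc g) (shuffle_ob \<Lambda> A))
    = mat (btgt f) (btgt g) (X (basic_map f) (basic_map g) (shuffle_ob \<Lambda> A))"
    using A ok by (intro chi_mat) simp_all
  moreover have "fa (shuffle_ftor M (btgt f) (btgt g) \<Pi>)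
      (mat (btgt f) (btgt g) (X (basic_map f) (basic_map g) (shuffle_ob \<Lambda> A)))
    = mat (word_tgt (btgt f) (col1 \<Pi>)) (word_tgt (btgt g) (col2 \<Pi>))
        (shuffle_ar \<Pi> (X (basic_map f) (basic_map g) (shuffle_ob \<Lambda> A)))"
    using A ok by (intro fa_shuffle_ftor_mat[OF _ _ mhom_X]) simp_all
  ultimately show ?thesis by (simp add: whisker_chi_def)
qed

lemma psi_normal: "mob A \<Longrightarrow> psi (map Col2 \<Gamma> @ map Col1 \<Phi>) A = mid (shuffle_ob (map Col2 \<Gamma> @ map Col1 \<Phi>) A)"
  using psi_Col1[of A "[]" \<Phi>] by (simp add: psi_Col2 G_mid shuffle_ob_append shuffle_ob_map)

text \<open>Path independence: by \<open>psi_step\<close> every swap contributes exactly the factor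
  by which \<open>psi\<close> changes, and at the normal shuffle \<open>psi\<close> is an identity.
  The composite is therefore determined by the head of the path.\<close>

lemma path_trans_mat:
  assumes A: "mob A" and "word_ok n (col1 (hd P))" "word_ok m (col2 (hd P))" "P \<noteq> []"
    "last P = map Col2 (col2 (hd P)) @ map Col1 (col1 (hd P))"
    "\<forall>i. Suc i < length P \<longrightarrow> swap_step (P ! i) (P ! Suc i)"
  shows "path_trans M n m P (mat n m A)
    = mat (word_tgt n (col1 (hd P))) (word_tgt m (col2 (hd P))) (psi (hd P) A)"
  using assms(2-)
proof (induction P rule: induct_list012)
  case (2 \<Theta>)
  then have "psi \<Theta> A = mid (shuffle_ob \<Theta> A)" using psi_normal[OF A, of "col2 \<Theta>" "col1 \<Theta>"] by simp
  then show ?case using fo_shuffle_ftor_mat[of n \<Theta> m A] 2 A by (simp add: map_mat mid_def)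
next
  case (3 \<Theta> \<Theta>' P)
  have "swap_step \<Theta> \<Theta>'" using 3(7)[rule_format, of 0] by simp
  then obtain \<Pi> f g \<Lambda> where \<Theta>: "\<Theta> = \<Pi> @ Col1 f # Col2 g # \<Lambda>" "\<Theta>' = \<Pi> @ Col2 g # Col1 f # \<Lambda>"
    by (auto simp: swap_step_def)
  have "path_trans M n m (\<Theta>' # P) (mat n m A)
      = mat (word_tgt n (col1 \<Theta>')) (word_tgt m (col2 \<Theta>')) (psi \<Theta>' A)"
    using 3(2) 3(3-7) \<Theta> by fastforce
  moreover have "step_trans M n m \<Theta> \<Theta>' (mat n m A) = mat (word_tgt n (col1 \<Theta>)) (word_tgt m (col2 \<Theta>))
      (shuffle_ar \<Pi> (X (basic_map f) (basic_map g) (shuffle_ob \<Lambda> A)))"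
    using whisker_chi_mat[OF A, of n \<Pi> f g \<Lambda> m] 3(3,4) by (simp add: \<Theta> step_trans_eq)
  moreover have "psi \<Theta> A = psi \<Theta>' A \<bullet> shuffle_ar \<Pi> (X (basic_map f) (basic_map g) (shuffle_ob \<Lambda> A))"
    using psi_step[OF A] \<Theta> by simp
  ultimately show ?case by (simp add: map2_mat mcmp_def \<Theta>)
qed simp

lemma phi_mat:
  assumes "mob A" "word_ok n (col1 \<Theta>)" "word_ok m (col2 \<Theta>)"
  shows "phi M n m \<Theta> (mat n m A) = mat (word_tgt n (col1 \<Theta>)) (word_tgt m (col2 \<Theta>)) (psi \<Theta> A)"
proof -
  define P where "P = (SOME P. normalizing_path (col1 \<Theta>) (col2 \<Theta>) \<Theta> P)"
  have "normalizing_path (col1 \<Theta>) (col2 \<Theta>) \<Theta> P"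
    unfolding P_def using normalizing_path_exists by (rule someI_ex)
  then show ?thesis
    using path_trans_mat[of A n P m] assms unfolding phi_def P_def[symmetric] normalizing_path_def by simp
qed

text \<open>In the shuffle of four blocks only the second colour 1 block has a crossing to make,
  over the first colour 2 block. The first colour 1 block prepares the object, and the second colour
  2 block whiskers from outside.\<close>

definition omega_mx :: "(nat \<Rightarrow> nat) \<Rightarrow> (nat \<Rightarrow> nat) \<Rightarrow> (nat \<Rightarrow> nat) \<Rightarrow> (nat \<Rightarrow> nat) \<Rightarrow> (nat \<Rightarrow> nat \<Rightarrow> 'o) \<Rightarrow> nat \<Rightarrow> nat \<Rightarrow> 'a" where
  "omega_mx \<phi>\<^sub>2 \<psi>\<^sub>2 \<phi>\<^sub>1 \<psi>\<^sub>1 A = G2 \<psi>\<^sub>2 (X \<phi>\<^sub>2 \<psi>\<^sub>1 (F1 \<phi>\<^sub>1 A))"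

lemma omega_mat:
  assumes A: "mob A"
    and ar: "f\<^sub>1 \<in> Ar delta_op" "g\<^sub>1 \<in> Ar delta_op" "f\<^sub>2 \<in> Ar delta_op" "g\<^sub>2 \<in> Ar delta_op"
    and cmp: "dsrc f\<^sub>2 = dtgt f\<^sub>1" "dsrc g\<^sub>2 = dtgt g\<^sub>1"
  shows "omega M (f\<^sub>2, g\<^sub>2) (f\<^sub>1, g\<^sub>1) (mat (dsrc f\<^sub>1) (dsrc g\<^sub>1) A)
    = mat (dtgt f\<^sub>2) (dtgt g\<^sub>2) (omega_mx (arr_map f\<^sub>2) (arr_map g\<^sub>2) (arr_map f\<^sub>1) (arr_map g\<^sub>1) A)"
proof -
  let ?\<Theta> = "map Col2 (nf g\<^sub>2) @ map Col1 (nf f\<^sub>2) @ map Col2 (nf g\<^sub>1) @ map Col1 (nf f\<^sub>1)"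
  let ?N = "map Col2 (nf g\<^sub>1) @ map Col1 (nf f\<^sub>1)"
  have "psi (map Col1 (nf f\<^sub>2) @ ?N) A = X (arr_map f\<^sub>2) (arr_map g\<^sub>1) (F1 (arr_map f\<^sub>1) A)"
    using psi_Col1[OF A, of ?N "nf f\<^sub>2"] A psi_normal[OF A] ar by (simp add: shuffle_ob_append shuffle_ob_map nf)
  then have "psi ?\<Theta> A = omega_mx (arr_map f\<^sub>2) (arr_map g\<^sub>2) (arr_map f\<^sub>1) (arr_map g\<^sub>1) A"
    using A ar by (simp add: psi_Col2 nf omega_mx_def)
  moreover have "word_ok (dsrc f\<^sub>1) (col1 ?\<Theta>)" "word_ok (dsrc g\<^sub>1) (col2 ?\<Theta>)"
    "word_tgt (dsrc f\<^sub>1) (col1 ?\<Theta>) = dtgt f\<^sub>2" "word_tgt (dsrc g\<^sub>1) (col2 ?\<Theta>) = dtgt g\<^sub>2"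
    using nf[OF ar(1)] nf[OF ar(2)] nf[OF ar(3)] nf[OF ar(4)] cmp by simp_all
  ultimately show ?thesis
    using phi_mat[OF A, of "dsrc f\<^sub>1" ?\<Theta> "dsrc g\<^sub>1"] by (simp add: omega_def)
qed

end

section \<open>The lax functor\<close>

lemma prod_cat_simps [simp]:
  "Ob (prod_cat C C') = Ob C \<times> Ob C'" "Ar (prod_cat C C') = Ar C \<times> Ar C'"
  "dm (prod_cat C C') (f, g) = (dm C f, dm C' g)" "cd (prod_cat C C') (f, g) = (cd C f, cd C' g)"
  "ident (prod_cat C C') (A, B) = (ident C A, ident C' B)"
  "cmp (prod_cat C C') (f', g') (f, g) = (cmp C f' f, cmp C' g' g)"
  by (simp_all add: prod_cat_def)

lemma category_prod_cat:
  assumes "category C" "category C'"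
  shows "category (prod_cat C C')"
proof -
  interpret C: category C by fact
  interpret D: category C' by fact
  show ?thesis
    by unfold_locales
      (use C.ident_in D.ident_in C.cmp_in D.cmp_in in \<open>auto simp: hom_def C.dm_in D.dm_in C.cd_in D.cd_in
        C.cmp_assoc D.cmp_assoc C.ident_left D.ident_left C.ident_right D.ident_right\<close>)
qed

text \<open>The entries outside the relevant corner are chosen canonically, so that composable tuples of
  arrows become composable matrices.\<close>

definition pad :: "'x \<Rightarrow> nat \<Rightarrow> nat \<Rightarrow> 'x list \<Rightarrow> nat \<Rightarrow> nat \<Rightarrow> 'x" where
  "pad z n m L i j = (if i < n \<and> j < m then L ! (i * m + j) else z)"

lemma mat_pad [simp]: "length L = n * m \<Longrightarrow> mat n m (pad z n m L) = L"
  using mat_nth_self[of L n m] mat_cong[of n m "pad z n m L" "\<lambda>i j. L ! (i * m + j)"]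
  by (simp add: pad_def)

lemma set_mat: "(\<And>i j. A i j \<in> R) \<Longrightarrow> set (mat n m A) \<subseteq> R"
  by (auto simp: mat_def)

lemma pad_index: "i < n \<Longrightarrow> j < m \<Longrightarrow> i * m + j < n * (m :: nat)"
  using mult_le_mono1[of "Suc i" n m] by simp

section \<open>Transfer between tuples and padded matrices, and the lax functor laws\<close>

context two_fold_strict_monoidal
begin

lemma category_cat_power: "category (cat_power M k)"
proof
  have nth: "L ! i \<in> R" if "set L \<subseteq> R" "i < length L" for L i and R :: "'x set" using that by auto
  fix f g h
  { assume f: "f \<in> Ar (cat_power M k)"
    show "dm (cat_power M k) f \<in> Ob (cat_power M k)" "cd (cat_power M k) f \<in> Ob (cat_power M k)"
      using f by (auto simp: cat_power_def)
    show "cmp (cat_power M k) (ident (cat_power M k) (cd (cat_power M k) f)) f = f"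
      "cmp (cat_power M k) f (ident (cat_power M k) (dm (cat_power M k) f)) = f"
      using f by (auto simp: cat_power_def nth intro!: nth_equalityI)
    assume g: "g \<in> Ar (cat_power M k)" "dm (cat_power M k) g = cd (cat_power M k) f"
    then have gf: "dm M (g ! i) = cd M (f ! i)" if "i < k" for i
      using f that by (auto simp: cat_power_def list_eq_iff_nth_eq)
    show "cmp (cat_power M k) g f \<in> hom (cat_power M k) (dm (cat_power M k) f) (cd (cat_power M k) g)"
      using f g gf by (auto simp: cat_power_def hom_def nth set_zip intro!: nth_equalityI)
    assume h: "h \<in> Ar (cat_power M k)" "dm (cat_power M k) h = cd (cat_power M k) g"
    then have "dm M (h ! i) = cd M (g ! i)" if "i < k" for i
      using g that by (auto simp: cat_power_def list_eq_iff_nth_eq)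
    with f g h gf show "cmp (cat_power M k) (cmp (cat_power M k) h g) f
        = cmp (cat_power M k) h (cmp (cat_power M k) g f)"
      by (auto simp: cat_power_def nth intro!: nth_equalityI cmp_assoc) }
next
  fix A assume "A \<in> Ob (cat_power M k)"
  then show "ident (cat_power M k) A \<in> hom (cat_power M k) A A"
    by (auto simp: cat_power_def hom_def subset_iff intro!: nth_equalityI)
qed

lemma mob_pad:
  assumes "L \<in> Ob (cat_power M (n * m))"
  shows "mob (pad I\<^sub>1 n m L)"
proof -
  have "L ! (i * m + j) \<in> Ob M" if "i < n" "j < m" for i j
    using assms pad_index[OF that] by (auto simp: cat_power_def)
  then show ?thesis by (simp add: mob_def pad_def)
qed

lemma mhom_pad:
  assumes "L \<in> Ar (cat_power M (n * m))"
  shows "mhom (pad (\<one> I\<^sub>1) n m L) (pad I\<^sub>1 n m (dm (cat_power M (n * m)) L))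
    (pad I\<^sub>1 n m (cd (cat_power M (n * m)) L))"
proof -
  have "L ! (i * m + j) \<in> Ar M" "i * m + j < length L" if "i < n" "j < m" for i j
    using assms pad_index[OF that] by (auto simp: cat_power_def)
  then show ?thesis by (simp add: mhom_def pad_def cat_power_def)
qed

lemma mat_Ob:
  assumes "mob A"
  shows "mat n m A \<in> Ob (cat_power M (n * m))"
  using set_mat[of A, OF mobD[OF assms]] by (simp add: cat_power_def)

lemma mat_hom:
  assumes "mhom f A B"
  shows "mat n m f \<in> hom (cat_power M (n * m)) (mat n m A) (mat n m B)"
  using mhomD[OF assms] set_mat[of f "Ar M"] by (simp add: cat_power_def hom_def map_mat)

lemma mat_ident: "ident (cat_power M k) (mat n m A) = mat n m (mid A)"
  by (simp add: cat_power_def map_mat mid_def)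

lemma mat_cmp: "cmp (cat_power M k) (mat n m g) (mat n m f) = mat n m (g \<bullet> f)"
  by (simp add: cat_power_def map2_mat mcmp_def)

lemma two_bar_ob_simp: "two_bar_ob M (n, m) = cat_power M (n * m)"
  by (simp add: two_bar_ob_def)

lemma mat_ObE:
  assumes "L \<in> Ob (cat_power M (n * m))"
  obtains A where "mob A" "L = mat n m A"
  using assms mob_pad[OF assms] by (intro that[of "pad I\<^sub>1 n m L"]) (simp_all add: cat_power_def)

lemma mat_ArE:
  assumes "L \<in> Ar (cat_power M (n * m))"
  obtains f A B where "mhom f A B" "L = mat n m f" "dm (cat_power M (n * m)) L = mat n m A"
    "cd (cat_power M (n * m)) L = mat n m B"
  using assms by (intro that[OF mhom_pad[OF assms]]) (simp_all add: cat_power_def)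

lemma two_bar_functor:
  assumes f: "f \<in> Ar delta_op" and g: "g \<in> Ar delta_op"
  shows "is_functor (cat_power M (dsrc f * dsrc g)) (cat_power M (dtgt f * dtgt g)) (two_bar_ar M (f, g))"
  unfolding is_functor_def
proof (intro conjI ballI impI)
  let ?C = "cat_power M (dsrc f * dsrc g)" and ?W = "two_bar_ar M (f, g)"
  note W = two_bar_ar_mat[OF f g]
  {
    fix L assume "L \<in> Ob ?C"
    then obtain A where A: "mob A" "L = mat (dsrc f) (dsrc g) A" by (rule mat_ObE)
    show "fo ?W L \<in> Ob (cat_power M (dtgt f * dtgt g))"
      using A by (simp add: W mat_Ob)
    show "fa ?W (ident ?C L) = ident (cat_power M (dtgt f * dtgt g)) (fo ?W L)"
      using A by (simp add: W mat_ident W(2)[OF mhom_mid] G_mid)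
  next
    fix L assume "L \<in> Ar ?C"
    then obtain h A B where h: "mhom h A B" "L = mat (dsrc f) (dsrc g) h"
      "dm ?C L = mat (dsrc f) (dsrc g) A" "cd ?C L = mat (dsrc f) (dsrc g) B" by (rule mat_ArE)
    show "fa ?W L \<in> hom (cat_power M (dtgt f * dtgt g)) (fo ?W (dm ?C L)) (fo ?W (cd ?C L))"
      using mhom_mob[OF h(1)] W(2)[OF h(1)] mat_hom[OF mhom_G2[OF mhom_G1[OF h(1)]]]
      unfolding h(3,4) by (simp add: h(2) W(1))
  next
    fix L L' assume L: "L \<in> Ar ?C" and L': "L' \<in> Ar ?C" and eq: "dm ?C L' = cd ?C L"
    let ?h = "pad (\<one> I\<^sub>1) (dsrc f) (dsrc g) L" and ?h' = "pad (\<one> I\<^sub>1) (dsrc f) (dsrc g) L'"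
    \<comment> \<open>Rewriting by \<open>eq\<close> makes the domain of the padded
      \<open>L'\<close> literally the codomain of the padded \<open>L\<close>, so the matrices
      compose everywhere and not only in the corner.\<close>
    note h = mhom_pad[OF L] and h' = mhom_pad[OF L', unfolded eq]
    have "L = mat (dsrc f) (dsrc g) ?h" "L' = mat (dsrc f) (dsrc g) ?h'"
      using L L' by (simp_all add: cat_power_def)
    then show "fa ?W (cmp ?C L' L) = cmp (cat_power M (dtgt f * dtgt g)) (fa ?W L') (fa ?W L)"
      using W(2)[OF h] W(2)[OF h'] W(2)[OF mhom_mcmp[OF h h']]
        G2_mcmp[OF mhom_G1[OF h] mhom_G1[OF h']] G1_mcmp[OF h h']
      by (metis mat_cmp)
  }
qed

lemma mhom_omega_mx:
  assumes A: "mob A" and mono: "mono \<phi>\<^sub>1" "mono \<psi>\<^sub>1"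
  shows "mhom (omega_mx \<phi>\<^sub>2 \<psi>\<^sub>2 \<phi>\<^sub>1 \<psi>\<^sub>1 A) (F2 \<psi>\<^sub>2 (F1 \<phi>\<^sub>2 (F2 \<psi>\<^sub>1 (F1 \<phi>\<^sub>1 A))))
    (F2 (\<psi>\<^sub>1 \<circ> \<psi>\<^sub>2) (F1 (\<phi>\<^sub>1 \<circ> \<phi>\<^sub>2) A))"
proof -
  have "mob (F1 \<phi>\<^sub>1 A)" using A by simp
  from mhom_G2[OF mhom_X[OF this, of \<phi>\<^sub>2 \<psi>\<^sub>1], of \<psi>\<^sub>2] show ?thesis
    using A mono by (simp add: omega_mx_def F_comp)
qed

lemma omega_mx_nat:
  assumes f: "mhom f A B" and mono: "mono \<phi>\<^sub>1" "mono \<psi>\<^sub>1"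
  shows "omega_mx \<phi>\<^sub>2 \<psi>\<^sub>2 \<phi>\<^sub>1 \<psi>\<^sub>1 B \<bullet> G2 \<psi>\<^sub>2 (G1 \<phi>\<^sub>2 (G2 \<psi>\<^sub>1 (G1 \<phi>\<^sub>1 f)))
    = G2 (\<psi>\<^sub>1 \<circ> \<psi>\<^sub>2) (G1 (\<phi>\<^sub>1 \<circ> \<phi>\<^sub>2) f) \<bullet> omega_mx \<phi>\<^sub>2 \<psi>\<^sub>2 \<phi>\<^sub>1 \<psi>\<^sub>1 A"
proof -
  note h = mhom_G1[OF f, of \<phi>\<^sub>1]
  note X = mhom_X[OF mhom_mob(1)[OF h]] mhom_X[OF mhom_mob(2)[OF h]]
  have "omega_mx \<phi>\<^sub>2 \<psi>\<^sub>2 \<phi>\<^sub>1 \<psi>\<^sub>1 B \<bullet> G2 \<psi>\<^sub>2 (G1 \<phi>\<^sub>2 (G2 \<psi>\<^sub>1 (G1 \<phi>\<^sub>1 f)))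
    = G2 \<psi>\<^sub>2 (X \<phi>\<^sub>2 \<psi>\<^sub>1 (F1 \<phi>\<^sub>1 B) \<bullet> G1 \<phi>\<^sub>2 (G2 \<psi>\<^sub>1 (G1 \<phi>\<^sub>1 f)))"
    by (simp add: omega_mx_def G2_mcmp[OF mhom_G1[OF mhom_G2[OF h]] X(2)])
  also have "\<dots> = G2 \<psi>\<^sub>2 (G2 \<psi>\<^sub>1 (G1 \<phi>\<^sub>2 (G1 \<phi>\<^sub>1 f)) \<bullet> X \<phi>\<^sub>2 \<psi>\<^sub>1 (F1 \<phi>\<^sub>1 A))"
    by (simp add: X_nat[OF h])
  also have "\<dots> = G2 \<psi>\<^sub>2 (G2 \<psi>\<^sub>1 (G1 \<phi>\<^sub>2 (G1 \<phi>\<^sub>1 f))) \<bullet> omega_mx \<phi>\<^sub>2 \<psi>\<^sub>2 \<phi>\<^sub>1 \<psi>\<^sub>1 A"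
    by (simp add: omega_mx_def G2_mcmp[OF X(1) mhom_G2[OF mhom_G1[OF h]]])
  also have "G2 \<psi>\<^sub>2 (G2 \<psi>\<^sub>1 (G1 \<phi>\<^sub>2 (G1 \<phi>\<^sub>1 f))) = G2 (\<psi>\<^sub>1 \<circ> \<psi>\<^sub>2) (G1 (\<phi>\<^sub>1 \<circ> \<phi>\<^sub>2) f)"
    by (simp add: G_comp(1)[OF f mono(1)] G_comp(2)[OF mhom_G1[OF f] mono(2)])
  finally show ?thesis .
qed

lemma omega_natural:
  assumes ar: "f\<^sub>1 \<in> Ar delta_op" "g\<^sub>1 \<in> Ar delta_op" "f\<^sub>2 \<in> Ar delta_op" "g\<^sub>2 \<in> Ar delta_op"
    and cmp: "dsrc f\<^sub>2 = dtgt f\<^sub>1" "dsrc g\<^sub>2 = dtgt g\<^sub>1"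
  shows "is_nat_trans (cat_power M (dsrc f\<^sub>1 * dsrc g\<^sub>1)) (cat_power M (dtgt f\<^sub>2 * dtgt g\<^sub>2))
    (two_bar_ar M (f\<^sub>2, g\<^sub>2) \<circ>\<^sub>F two_bar_ar M (f\<^sub>1, g\<^sub>1))
    (two_bar_ar M (cmp delta_op f\<^sub>2 f\<^sub>1, cmp delta_op g\<^sub>2 g\<^sub>1)) (omega M (f\<^sub>2, g\<^sub>2) (f\<^sub>1, g\<^sub>1))"
  unfolding is_nat_trans_def
proof (intro conjI ballI)
  let ?f = "cmp delta_op f\<^sub>2 f\<^sub>1" and ?g = "cmp delta_op g\<^sub>2 g\<^sub>1"
  have c: "?f \<in> Ar delta_op" "?g \<in> Ar delta_op" "arr_map ?f = arr_map f\<^sub>1 \<circ> arr_map f\<^sub>2"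
    "arr_map ?g = arr_map g\<^sub>1 \<circ> arr_map g\<^sub>2"
    using ar cmp by (simp_all add: delta_op_cmp_in arr_map_cmp)
  note W1 = two_bar_ar_mat[OF ar(1,2)] and W2 = two_bar_ar_mat[OF ar(3,4), unfolded cmp]
    and W = two_bar_ar_mat[OF c(1,2), unfolded c(3,4) delta_op_simps]
  note omega_mx = omega_mat[OF _ ar cmp] and mono = mono_arr_map[OF ar(1)] mono_arr_map[OF ar(2)]
  {
    fix L assume "L \<in> Ob (cat_power M (dsrc f\<^sub>1 * dsrc g\<^sub>1))"
    then obtain A where A: "mob A" "L = mat (dsrc f\<^sub>1) (dsrc g\<^sub>1) A" by (rule mat_ObE)
    show "omega M (f\<^sub>2, g\<^sub>2) (f\<^sub>1, g\<^sub>1) L \<in> hom (cat_power M (dtgt f\<^sub>2 * dtgt g\<^sub>2))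
      (fo (two_bar_ar M (f\<^sub>2, g\<^sub>2) \<circ>\<^sub>F two_bar_ar M (f\<^sub>1, g\<^sub>1)) L) (fo (two_bar_ar M (?f, ?g)) L)"
      using mat_hom[OF mhom_omega_mx[OF A(1) mono, of "arr_map f\<^sub>2" "arr_map g\<^sub>2"], of "dtgt f\<^sub>2" "dtgt g\<^sub>2"] A
      by (simp add: W1(1) W2(1) W(1) omega_mx)
  next
    fix L assume "L \<in> Ar (cat_power M (dsrc f\<^sub>1 * dsrc g\<^sub>1))"
    then obtain h A B where h: "mhom h A B" "L = mat (dsrc f\<^sub>1) (dsrc g\<^sub>1) h"
      "dm (cat_power M (dsrc f\<^sub>1 * dsrc g\<^sub>1)) L = mat (dsrc f\<^sub>1) (dsrc g\<^sub>1) A"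
      "cd (cat_power M (dsrc f\<^sub>1 * dsrc g\<^sub>1)) L = mat (dsrc f\<^sub>1) (dsrc g\<^sub>1) B" by (rule mat_ArE)
    show "cmp (cat_power M (dtgt f\<^sub>2 * dtgt g\<^sub>2))
        (omega M (f\<^sub>2, g\<^sub>2) (f\<^sub>1, g\<^sub>1) (cd (cat_power M (dsrc f\<^sub>1 * dsrc g\<^sub>1)) L))
        (fa (two_bar_ar M (f\<^sub>2, g\<^sub>2) \<circ>\<^sub>F two_bar_ar M (f\<^sub>1, g\<^sub>1)) L)
      = cmp (cat_power M (dtgt f\<^sub>2 * dtgt g\<^sub>2)) (fa (two_bar_ar M (?f, ?g)) L)
        (omega M (f\<^sub>2, g\<^sub>2) (f\<^sub>1, g\<^sub>1) (dm (cat_power M (dsrc f\<^sub>1 * dsrc g\<^sub>1)) L))"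
      using mhom_mob[OF h(1)] unfolding h(3,4)
      by (simp add: h(2) W1(2)[OF h(1)] W2(2)[OF mhom_G2[OF mhom_G1[OF h(1)]]] W(2)[OF h(1)] omega_mx
          mat_cmp omega_mx_nat[OF h(1) mono])
  }
qed

lemma two_bar_ident:
  shows "mob A \<Longrightarrow> fo (two_bar_ar M (ident delta_op n, ident delta_op m)) (mat n m A) = mat n m A"
    and "mhom f B B' \<Longrightarrow> fa (two_bar_ar M (ident delta_op n, ident delta_op m)) (mat n m f) = mat n m f"
  using two_bar_ar_mat[OF delta_op_ident_in[of n] delta_op_ident_in[of m]]
  by (simp_all add: arr_map_ident)

text \<open>An identity factor turns the only crossing into a cell of \<open>X\<close> with
  \<open>id\<close> in one argument, trivial by \<open>X_id\<close>.\<close>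

lemma omega_ident:
  assumes A: "mob A" and fg: "f \<in> Ar delta_op" "g \<in> Ar delta_op"
  shows "omega M (f, g) (ident delta_op (dsrc f), ident delta_op (dsrc g)) (mat (dsrc f) (dsrc g) A)
      = mat (dtgt f) (dtgt g) (mid (F2 (arr_map g) (F1 (arr_map f) A)))"
    and "omega M (ident delta_op (dtgt f), ident delta_op (dtgt g)) (f, g) (mat (dsrc f) (dsrc g) A)
      = mat (dtgt f) (dtgt g) (mid (F2 (arr_map g) (F1 (arr_map f) A)))"
  using omega_mat[OF A delta_op_ident_in[of "dsrc f"] delta_op_ident_in[of "dsrc g"] fg]
    omega_mat[OF A fg delta_op_ident_in[of "dtgt f"] delta_op_ident_in[of "dtgt g"]] A
  by (simp_all add: omega_mx_def arr_map_ident G_mid)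

text \<open>Every transformation in the law is the corner of an infinite matrix, and
  \<open>arr_map_cmp\<close> matches composite arrows with composite maps; the equation is then the
  corner of \<open>lax_coherence\<close>.\<close>

lemma omega_coherence:
  assumes A: "mob A"
    and ar: "f\<^sub>1 \<in> Ar delta_op" "g\<^sub>1 \<in> Ar delta_op" "f\<^sub>2 \<in> Ar delta_op" "g\<^sub>2 \<in> Ar delta_op"
      "f\<^sub>3 \<in> Ar delta_op" "g\<^sub>3 \<in> Ar delta_op"
    and cmp: "dsrc f\<^sub>2 = dtgt f\<^sub>1" "dsrc g\<^sub>2 = dtgt g\<^sub>1" "dsrc f\<^sub>3 = dtgt f\<^sub>2" "dsrc g\<^sub>3 = dtgt g\<^sub>2"
    and L: "L = mat (dsrc f\<^sub>1) (dsrc g\<^sub>1) A"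
  shows "cmp (cat_power M k) (omega M (cmp delta_op f\<^sub>3 f\<^sub>2, cmp delta_op g\<^sub>3 g\<^sub>2) (f\<^sub>1, g\<^sub>1) L)
      (omega M (f\<^sub>3, g\<^sub>3) (f\<^sub>2, g\<^sub>2) (fo (two_bar_ar M (f\<^sub>1, g\<^sub>1)) L))
    = cmp (cat_power M k) (omega M (f\<^sub>3, g\<^sub>3) (cmp delta_op f\<^sub>2 f\<^sub>1, cmp delta_op g\<^sub>2 g\<^sub>1) L)
      (fa (two_bar_ar M (f\<^sub>3, g\<^sub>3)) (omega M (f\<^sub>2, g\<^sub>2) (f\<^sub>1, g\<^sub>1) L))"
proof -
  note [simp] = ar cmp A delta_op_cmp_in arr_map_cmp
  have "mob (F2 (arr_map g\<^sub>1) (F1 (arr_map f\<^sub>1) A))" by simp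
  note o32 = omega_mat[OF this ar(3-6) cmp(3,4), unfolded cmp(1,2)]
  note o321 = omega_mat[OF A ar(1,2) delta_op_cmp_in[OF ar(3,5) cmp(3)] delta_op_cmp_in[OF ar(4,6) cmp(4)],
      unfolded delta_op_simps, OF cmp(1,2)]
  note o21 = omega_mat[OF A ar(1-4) cmp(1,2)]
  note o3_21 = omega_mat[OF A delta_op_cmp_in[OF ar(1,3) cmp(1)] delta_op_cmp_in[OF ar(2,4) cmp(2)] ar(5,6),
      unfolded delta_op_simps, OF cmp(3,4)]
  note W3 = two_bar_ar_mat(2)[OF ar(5,6) mhom_omega_mx[OF A mono_arr_map[OF ar(1)] mono_arr_map[OF ar(2)]],
      unfolded cmp(3,4)]
  show ?thesis
    using lax_coherence[OF A, of "arr_map f\<^sub>1" "arr_map f\<^sub>2" "arr_map g\<^sub>1" "arr_map g\<^sub>2" "arr_map g\<^sub>3" "arr_map f\<^sub>3"]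
    unfolding L two_bar_ar_mat(1)[OF ar(1,2) A] o32 o321 o21 o3_21 W3 mat_cmp by (simp add: omega_mx_def)
qed

end

theorem theorem4p5:
  fixes M :: "('o, 'a) two_fold"
  assumes "two_fold_strict_monoidal M"
  shows "lax_functor (prod_cat delta_op delta_op) (two_bar_ob M) (two_bar_ar M) (omega M)"
proof -
  interpret two_fold_strict_monoidal M by fact
  show ?thesis
    unfolding lax_functor_def
  proof (intro conjI)
    show "category (prod_cat delta_op delta_op)"
      by (intro category_prod_cat category_delta_op)
    show "\<forall>x \<in> Ob (prod_cat delta_op delta_op). category (two_bar_ob M x)"
      using category_cat_power by (auto simp: two_bar_ob_def)
    show "\<forall>e \<in> Ar (prod_cat delta_op delta_op). is_functor (two_bar_ob M (dm (prod_cat delta_op delta_op) e))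
        (two_bar_ob M (cd (prod_cat delta_op delta_op) e)) (two_bar_ar M e)"
      by (auto simp: two_bar_ob_simp intro: two_bar_functor)
    show "\<forall>x \<in> Ob (prod_cat delta_op delta_op).
        ftor_eq_on (two_bar_ob M x) (two_bar_ar M (ident (prod_cat delta_op delta_op) x)) id_ftor"
      by (auto simp: two_bar_ob_simp ftor_eq_on_def id_ftor_def two_bar_ident(1) elim!: mat_ObE mat_ArE
          intro: two_bar_ident(2))
    show "\<forall>e\<^sub>1 \<in> Ar (prod_cat delta_op delta_op). \<forall>e\<^sub>2 \<in> Ar (prod_cat delta_op delta_op).
        dm (prod_cat delta_op delta_op) e\<^sub>2 = cd (prod_cat delta_op delta_op) e\<^sub>1 \<longrightarrow>
        is_nat_trans (two_bar_ob M (dm (prod_cat delta_op delta_op) e\<^sub>1))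
          (two_bar_ob M (cd (prod_cat delta_op delta_op) e\<^sub>2))
          (two_bar_ar M e\<^sub>2 \<circ>\<^sub>F two_bar_ar M e\<^sub>1)
          (two_bar_ar M (cmp (prod_cat delta_op delta_op) e\<^sub>2 e\<^sub>1)) (omega M e\<^sub>2 e\<^sub>1)"
      by (auto simp: two_bar_ob_simp intro: omega_natural)
    show "\<forall>e \<in> Ar (prod_cat delta_op delta_op).
        \<forall>X \<in> Ob (two_bar_ob M (dm (prod_cat delta_op delta_op) e)).
        omega M e (ident (prod_cat delta_op delta_op) (dm (prod_cat delta_op delta_op) e)) X
          = ident (two_bar_ob M (cd (prod_cat delta_op delta_op) e)) (fo (two_bar_ar M e) X) \<and>
        omega M (ident (prod_cat delta_op delta_op) (cd (prod_cat delta_op delta_op) e)) e X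
          = ident (two_bar_ob M (cd (prod_cat delta_op delta_op) e)) (fo (two_bar_ar M e) X)"
      by (auto simp: two_bar_ob_simp omega_ident two_bar_ar_mat mat_ident elim!: mat_ObE)
    show "\<forall>e\<^sub>1 \<in> Ar (prod_cat delta_op delta_op). \<forall>e\<^sub>2 \<in> Ar (prod_cat delta_op delta_op).
        \<forall>e\<^sub>3 \<in> Ar (prod_cat delta_op delta_op).
        dm (prod_cat delta_op delta_op) e\<^sub>2 = cd (prod_cat delta_op delta_op) e\<^sub>1 \<longrightarrow>
        dm (prod_cat delta_op delta_op) e\<^sub>3 = cd (prod_cat delta_op delta_op) e\<^sub>2 \<longrightarrow>
        (\<forall>X \<in> Ob (two_bar_ob M (dm (prod_cat delta_op delta_op) e\<^sub>1)).
           cmp (two_bar_ob M (cd (prod_cat delta_op delta_op) e\<^sub>3))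
             (omega M (cmp (prod_cat delta_op delta_op) e\<^sub>3 e\<^sub>2) e\<^sub>1 X) (omega M e\<^sub>3 e\<^sub>2 (fo (two_bar_ar M e\<^sub>1) X))
           = cmp (two_bar_ob M (cd (prod_cat delta_op delta_op) e\<^sub>3))
             (omega M e\<^sub>3 (cmp (prod_cat delta_op delta_op) e\<^sub>2 e\<^sub>1) X) (fa (two_bar_ar M e\<^sub>3) (omega M e\<^sub>2 e\<^sub>1 X)))"
      by (auto simp: two_bar_ob_simp elim!: mat_ObE intro!: omega_coherence)
  qed
qed

end
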